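(* Let $f \in \dot{\mathrm{BV}}(\mathbb{R}^n)$ and suppose that $\alpha \in (0,1)$ and $n \geq 2$. Let $\varphi$ be a positive Schwartz function on $\mathbb{R}^n$. Then for $\mathcal{M}_\alpha \in \{ M_\alpha^{lac}, M_\alpha^{\varphi}\}$ (the lacunary fractional maximal function or the smooth fractional maximal function associated with $\varphi$), there exists a constant $C$, depending only on the dimension $n$, $\alpha$ and $\varphi$, such that \[ \| \nabla \mathcal{M}_\alpha f \|_{L^{p}(\mathbb{R}^n)} \leq C\, | f |_{\mathrm{BV}(\mathbb{R}^n)} \] for $p = n/(n-\alpha)$.
   Context: The lacunary fractional maximal function is \[ M_{\alpha}^{lac}f (x) := \sup_{ k \in \mathbb{Z} } \left| \frac{2^{\alpha k}}{|B(0,2^{k})|} \int_{B(x,2^{k})} f(y) \, dy \right| . \] For integrable $\varphi$ and $t>0$ put $\varphi_t(x)=t^{-n}\varphi(x/t)$; the smooth fractional maximal function is \[ M_{\alpha}^{\varphi}f(x) := \sup_{t > 0} t^{\alpha} | \varphi_{t} * f(x) | . \] The variation of a function $f$ on $\mathbb{R}^n$ is \[ |f|_{\mathrm{BV}}:=\sup \Big\{ \int_{\mathbb{R}^n} f \, \mathrm{div} (g) \, dx : \ g \in C^1_c(\mathbb{R}^n, \mathbb{R}^n), \ \| g\|_\infty \leq 1 \Big\}, \qquad \| g \|_{\infty}:= \Big\| \Big(\sum_{i=1}^n g_i^2 \Big)^{1/2} \Big\|_{L^\infty}, \] and $f \in \dot{\mathrm{BV}}(\mathbb{R}^n)$ means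 that $|f|_{\mathrm{BV}}$ is finite. The gradient $\nabla$ is understood in the weak sense.
   Formalization: The formal theorem assumes the maximal function of f is finite at some point; otherwise (e.g. f = 1, with zero variation) it is identically infinite and its gradient is undefined. *)

theory Defs
  imports "HOL-Analysis.Analysis" "HOL-Probability.Essential_Supremum"
begin

section \<open>Differentiation, test functions, Schwartz functions\<close>

definition partial_deriv :: "'n \<Rightarrow> (real^'n \<Rightarrow> real) \<Rightarrow> real^'n \<Rightarrow> real" where
  "partial_deriv i u x = frechet_derivative u (at x) (axis i 1)"

primrec iter_partial :: "'n list \<Rightarrow> (real^'n \<Rightarrow> real) \<Rightarrow> real^'n \<Rightarrow> real" where
  "iter_partial [] u = u"
| "iter_partial (i # is) u = partial_deriv i (iter_partial is u)"

text \<open>Every iterated partial derivative exists and is (totally) differentiable; this is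
  equivalent to membership in \<open>C\<^sup>\<infinity>\<close>.\<close>

definition smooth :: "(real^'n \<Rightarrow> real) \<Rightarrow> bool" where
  "smooth u \<longleftrightarrow> (\<forall>is x. iter_partial is u differentiable (at x))"

definition schwartz :: "(real^'n \<Rightarrow> real) \<Rightarrow> bool" where
  "schwartz u \<longleftrightarrow> smooth u \<and>
     (\<forall>is (m::nat). bounded (range (\<lambda>x. norm x ^ m * iter_partial is u x)))"

definition compactly_supported :: "('a::topological_space \<Rightarrow> 'b::zero) \<Rightarrow> bool" where
  "compactly_supported u \<longleftrightarrow> compact (closure {x. u x \<noteq> 0})"

definition C1c :: "(real^'n \<Rightarrow> real^'n) set" where
  "C1c = {g. (\<exists>g' :: real^'n \<Rightarrow> (real^'n) \<Rightarrow>\<^sub>L (real^'n).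
                (\<forall>x. (g has_derivative blinfun_apply (g' x)) (at x)) \<and> continuous_on UNIV g')
             \<and> compactly_supported g}"

definition divergence :: "(real^'n \<Rightarrow> real^'n) \<Rightarrow> real^'n \<Rightarrow> real" where
  "divergence g x = (\<Sum>i\<in>UNIV. partial_deriv i (\<lambda>y. g y $ i) x)"

section \<open>Functions of bounded variation\<close>

definition locally_integrable :: "(real^'n \<Rightarrow> 'b::euclidean_space) \<Rightarrow> bool" where
  "locally_integrable f \<longleftrightarrow> (\<forall>K. compact K \<longrightarrow> f absolutely_integrable_on K)"

text \<open>The coercion \<open>ennreal\<close> sends negative reals to 0. This does not affect the supremum below,
  since \<open>g = 0\<close> is admissible.\<close>

definition BV_seminorm :: "(real^'n \<Rightarrow> real) \<Rightarrow> ennreal" where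
  "BV_seminorm f =
     (SUP g \<in> {g \<in> C1c. esssup lebesgue (\<lambda>x. ereal (norm (g x))) \<le> 1}.
        ennreal (LINT x|lebesgue. f x * divergence g x))"

definition BV_dot :: "(real^'n \<Rightarrow> real) set" where
  "BV_dot = {f. locally_integrable f \<and> BV_seminorm f < \<infinity>}"

section \<open>Fractional maximal functions\<close>

text \<open>The values are extended reals: on a nonzero constant function, whose BV seminorm is 0,
  \<open>lac_maximal\<close> is identically \<open>\<infinity>\<close>, and so is \<open>smooth_maximal\<close> if \<open>\<phi> \<ge> 0\<close> is not zero. A gradient
  is only meaningful if \<open>\<infinity>\<close> is not the only value.\<close>

definition lac_maximal :: "real \<Rightarrow> (real^'n \<Rightarrow> real) \<Rightarrow> real^'n \<Rightarrow> ennreal" where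
  "lac_maximal \<alpha> f x =
     (SUP k::int. ennreal \<bar>2 powr (\<alpha> * of_int k) / measure lebesgue (ball (0::real^'n) (2 powi k))
                         * (LINT y:ball x (2 powi k)|lebesgue. f y)\<bar>)"

definition dilate :: "(real^'n \<Rightarrow> real) \<Rightarrow> real \<Rightarrow> real^'n \<Rightarrow> real" where
  "dilate \<phi> t x = \<phi> (x /\<^sub>R t) / t ^ CARD('n)"

definition convolve :: "(real^'n \<Rightarrow> real) \<Rightarrow> (real^'n \<Rightarrow> real) \<Rightarrow> real^'n \<Rightarrow> real" where
  "convolve u f x = (LINT y|lebesgue. u (x - y) * f y)"

definition smooth_maximal ::
    "(real^'n \<Rightarrow> real) \<Rightarrow> real \<Rightarrow> (real^'n \<Rightarrow> real) \<Rightarrow> real^'n \<Rightarrow> ennreal" where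
  "smooth_maximal \<phi> \<alpha> f x =
     (SUP t \<in> {0<..}. ennreal (t powr \<alpha> * \<bar>convolve (dilate \<phi> t) f x\<bar>))"

section \<open>Weak gradient and Lebesgue norm\<close>

text \<open>A maximal function takes values in \<open>[0, \<infinity>]\<close>; having a weak gradient includes being finite
  almost everywhere and locally integrable.\<close>

definition has_weak_gradient :: "(real^'n \<Rightarrow> ennreal) \<Rightarrow> (real^'n \<Rightarrow> real^'n) \<Rightarrow> bool" where
  "has_weak_gradient F G \<longleftrightarrow>
     (AE x in lebesgue. F x < \<infinity>) \<and>
     locally_integrable (\<lambda>x. enn2real (F x)) \<and> locally_integrable G \<and>
     (\<forall>\<psi> i. smooth \<psi> \<and> compactly_supported \<psi> \<longrightarrow>
        (LINT x|lebesgue. enn2real (F x) * partial_deriv i \<psi> x)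
          = - (LINT x|lebesgue. G x $ i * \<psi> x))"

definition Lp_norm :: "real \<Rightarrow> (real^'n \<Rightarrow> 'b::real_normed_vector) \<Rightarrow> ennreal" where
  "Lp_norm p G =
     (let I = (\<integral>\<^sup>+x. ennreal (norm (G x) powr p) \<partial>lebesgue)
      in if I = \<infinity> then \<infinity> else ennreal (enn2real I powr (1 / p)))"

end

theory Submission
  imports Defs
begin

text \<open>
  Both maximal functions are suprema of \<open>w\<^sub>b \<bar>K\<^sub>b * f\<bar>\<close> over a family of kernels \<open>K\<^sub>b\<close> at dyadic scales
  \<open>2\<^sup>k\<close>, so a difference quotient of the maximal function is dominated by the supremum over \<open>k\<close> of
  \<open>2\<^bsup>\<alpha>k\<^esup>\<close> times dominated difference quotients of \<open>K\<^sub>b * f\<close>. The supremum is replaced by an \<open>l\<^sup>p\<close> sum over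
  \<open>k\<close>. For a point mass in place of the gradient this sum diverges, but \<open>f\<close> can be split into dyadic
  truncations \<open>f\<^sub>j\<close> of height \<open>2\<^sup>j\<close>, whose variations add up to that of \<open>f\<close>. For one truncation of variation \<open>V\<close>
  the terms decay geometrically away from the scale \<open>(V / 2\<^sup>j)\<^bsup>1/(n - 1)\<^esup>\<close>: at small scales because the difference
  quotients of \<open>K\<^sub>b * f\<^sub>j\<close> are at most \<open>2\<^bsup>j - k\<^esup>\<close>, at large scales because the weak Sobolev inequality bounds the
  \<open>L\<^sup>1\<close> norm of \<open>f\<^sub>j\<close>. This gives \<open>V\<^sup>p\<close> for the \<open>p\<close>-th power of the sum, and Jensen's inequality adds up the truncations.
  All of this is done for differences instead of derivatives; the weak gradient of the maximal function is obtained
  at the end from its difference quotients, which are bounded in \<open>L\<^sup>p\<close>, by an elementary form of weak compactness.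
\<close>

section \<open>Convolution of nonnegative functions\<close>

text \<open>The exponent is dictated by scaling: \<open>p = n / (n - \<alpha>)\<close> satisfies
  \<open>\<alpha> p = n (p - 1)\<close>. A gradient of mass V at a point has averages of size
  \<open>V 2^(-kn)\<close> at scale \<open>2^k\<close>, so every scale contributes about
  \<open>2^(\<alpha>kp) (V 2^(-kn))^(p-1) V = V^p\<close>; decay therefore has to come from the
  truncations, on both sides of one critical scale. Below it the ratio is
  \<open>2^(-(n-1)(p-1))\<close>, which is less than 1 because \<open>\<alpha> > 0\<close> gives
  \<open>p > 1\<close>; the same \<open>p > 1\<close> gives the uniform convexity behind the weak
  limit. A second obstacle is additive constants: they do not change the variation, but for kernels
  of nonzero integral a nonzero mean value at infinity makes the maximal function infinite
  everywhere. In dimension at least 2 such a mean value exists, and finiteness of the maximal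
  function at one point forces it to be 0, after which averages over balls decay with the radius.
  Variation is measured by L1 norms of increments \<open>f (x + v) - f x\<close>, on which
  truncation acts pointwise; the level sets of one truncation are controlled by the variation of the
  one below it, which keeps the bounds summable over the heights.\<close>

lemma nn_integral_lborel_translate:
  fixes a :: "'a::euclidean_space"
  assumes [measurable]: "f \<in> borel_measurable borel"
  shows "(\<integral>\<^sup>+x. f (x + a) \<partial>lborel) = (\<integral>\<^sup>+x. f x \<partial>lborel)"
  by (subst (2) lborel_distr_plus[of a, symmetric]) (simp add: nn_integral_distr add.commute)

lemma nn_integral_lborel_reflect:
  fixes a :: "'a::euclidean_space"
  assumes [measurable]: "f \<in> borel_measurable borel"
  shows "(\<integral>\<^sup>+x. f (a - x) \<partial>lborel) = (\<integral>\<^sup>+x. f x \<partial>lborel)"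
  by (subst (2) lborel_affine[of "-1" a]) (simp_all add: nn_integral_density nn_integral_distr)

lemma integral_kernel_reflect:
  fixes k :: "'a::euclidean_space \<Rightarrow> real"
  assumes "integrable lborel k"
  shows "integrable lborel (\<lambda>y. k (x - y))" "(LINT y|lborel. k (x - y)) = (LINT y|lborel. k y)"
proof -
  have km [measurable]: "k \<in> borel_measurable borel" using assms by auto
  have "distr lborel borel (\<lambda>y. x - y) = lborel"
    by (subst (2) lborel_affine[of "-1" x]) (simp_all add: density_1)
  then have "integrable (distr lborel borel (\<lambda>y. x - y)) k" "(LINT y|distr lborel borel (\<lambda>y. x - y). k y) = (LINT y|lborel. k y)"
    using assms by auto
  then show "integrable lborel (\<lambda>y. k (x - y))" "(LINT y|lborel. k (x - y)) = (LINT y|lborel. k y)"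
    by (auto simp: integrable_distr_eq integral_distr)
qed

lemma integral_shift_mult:
  fixes F \<psi> :: "'a::euclidean_space \<Rightarrow> real"
  assumes [measurable]: "F \<in> borel_measurable borel" "\<psi> \<in> borel_measurable borel"
    and i: "integrable lborel (\<lambda>x. F (x + v) * \<psi> x)"
  shows "integrable lborel (\<lambda>x. F x * \<psi> (x - v))"
    and "(LINT x|lborel. F (x + v) * \<psi> x) = (LINT x|lborel. F x * \<psi> (x - v))"
proof -
  have "integrable lborel (\<lambda>x. F (v + x) * \<psi> (v + x - v))" using i by (simp add: add.commute)
  then have "integrable (distr lborel borel ((+) v)) (\<lambda>x. F x * \<psi> (x - v))"
    by (subst integrable_distr_eq) auto
  then show "integrable lborel (\<lambda>x. F x * \<psi> (x - v))" by (simp add: lborel_distr_plus)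
  have "(LINT x|lborel. F (x + v) * \<psi> x) = (LINT x|distr lborel borel ((+) v). F x * \<psi> (x - v))"
    by (subst integral_distr) (auto simp: add.commute)
  then show "(LINT x|lborel. F (x + v) * \<psi> x) = (LINT x|lborel. F x * \<psi> (x - v))"
    by (simp add: lborel_distr_plus)
qed

text \<open>Valued in [0,\<infinity>]: it only serves to dominate, and measurability alone gives
  Fubini and the bounds below.\<close>

definition nconv :: "('a::euclidean_space \<Rightarrow> ennreal) \<Rightarrow> ('a \<Rightarrow> ennreal) \<Rightarrow> 'a \<Rightarrow> ennreal" where
  "nconv u f x = (\<integral>\<^sup>+y. u (x - y) * f y \<partial>lborel)"

lemma borel_measurable_nconv [measurable]:
  fixes u :: "'a::euclidean_space \<Rightarrow> ennreal"
  assumes [measurable]: "u \<in> borel_measurable borel" "f \<in> borel_measurable borel"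
  shows "nconv u f \<in> borel_measurable borel"
  unfolding nconv_def by measurable

lemma nn_integral_nconv:
  fixes u :: "'a::euclidean_space \<Rightarrow> ennreal"
  assumes [measurable]: "u \<in> borel_measurable borel" "f \<in> borel_measurable borel"
  shows "(\<integral>\<^sup>+x. nconv u f x \<partial>lborel) = (\<integral>\<^sup>+x. u x \<partial>lborel) * (\<integral>\<^sup>+x. f x \<partial>lborel)"
proof -
  have "(\<integral>\<^sup>+x. nconv u f x \<partial>lborel) = (\<integral>\<^sup>+y. \<integral>\<^sup>+x. u (x - y) * f y \<partial>lborel \<partial>lborel)"
    unfolding nconv_def by (rule lborel_pair.Fubini'[symmetric]) measurable
  also have "\<dots> = (\<integral>\<^sup>+y. (\<integral>\<^sup>+x. u x \<partial>lborel) * f y \<partial>lborel)"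
    using nn_integral_lborel_translate[of u "- y" for y]
    by (intro nn_integral_cong) (simp add: nn_integral_multc)
  also have "\<dots> = (\<integral>\<^sup>+x. u x \<partial>lborel) * (\<integral>\<^sup>+x. f x \<partial>lborel)"
    by (simp add: nn_integral_cmult)
  finally show ?thesis .
qed

lemma nconv_le_left:
  fixes u :: "'a::euclidean_space \<Rightarrow> ennreal"
  assumes [measurable]: "f \<in> borel_measurable borel" and "\<And>y. u y \<le> c"
  shows "nconv u f x \<le> c * (\<integral>\<^sup>+y. f y \<partial>lborel)"
  unfolding nconv_def using assms
  by (subst nn_integral_cmult[symmetric]) (auto intro!: nn_integral_mono mult_right_mono)

lemma nconv_le_right:
  fixes u :: "'a::euclidean_space \<Rightarrow> ennreal"
  assumes [measurable]: "u \<in> borel_measurable borel" and "\<And>y. f y \<le> c"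
  shows "nconv u f x \<le> (\<integral>\<^sup>+y. u y \<partial>lborel) * c"
proof -
  have "nconv u f x \<le> (\<integral>\<^sup>+y. u (x - y) * c \<partial>lborel)"
    unfolding nconv_def using assms by (auto intro!: nn_integral_mono mult_left_mono)
  also have "\<dots> = (\<integral>\<^sup>+y. u y \<partial>lborel) * c"
    by (simp add: nn_integral_multc nn_integral_lborel_reflect)
  finally show ?thesis .
qed

lemma nconv_mono:
  assumes "\<And>y. u y \<le> u' y" "\<And>y. f y \<le> f' y"
  shows "nconv u f x \<le> nconv u' f' x"
  unfolding nconv_def by (intro nn_integral_mono mult_mono assms) auto

lemma nconv_add_right:
  fixes u :: "'a::euclidean_space \<Rightarrow> ennreal"
  assumes [measurable]: "u \<in> borel_measurable borel" "f \<in> borel_measurable borel" "g \<in> borel_measurable borel"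
  shows "nconv u (\<lambda>x. f x + g x) x = nconv u f x + nconv u g x"
  unfolding nconv_def by (simp add: distrib_left nn_integral_add)

lemma sets_borel_ball [measurable]: "ball c r \<in> sets borel"
  by simp

section \<open>Functions of bounded translation variation\<close>

text \<open>Balls about the origin exhaust the space, so they test every ball. The measure is
  \<open>lborel\<close> because translations and Fubini are applied to Borel functions throughout; a
  Lebesgue measurable function is replaced by a Borel representative at the end.\<close>

definition loc_int :: "('a::euclidean_space \<Rightarrow> real) \<Rightarrow> bool" where
  "loc_int g \<longleftrightarrow> (\<forall>r. integrable lborel (\<lambda>y. indicator (ball 0 r) y * g y))"

text \<open>A derivative-free form of bounded variation: the L1 modulus of continuity is at most
  \<open>norm v * V\<close>. Pointwise operations such as truncation act directly on it. For
  negative \<open>V\<close> the right side is 0, hence the separate conditions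
  \<open>V \<ge> 0\<close> below.\<close>

definition translation_var :: "('a::euclidean_space \<Rightarrow> real) \<Rightarrow> real \<Rightarrow> bool" where
  "translation_var g V \<longleftrightarrow> g \<in> borel_measurable borel \<and>
     (\<forall>v. (\<integral>\<^sup>+x. ennreal \<bar>g (x + v) - g x\<bar> \<partial>lborel) \<le> ennreal (norm v * V))"

lemma translation_var_measurable [measurable_dest]:
  "translation_var g V \<Longrightarrow> g \<in> borel_measurable borel"
  by (simp add: translation_var_def)

lemma translation_varD:
  "translation_var g V \<Longrightarrow> (\<integral>\<^sup>+x. ennreal \<bar>g (x + v) - g x\<bar> \<partial>lborel) \<le> ennreal (norm v * V)"
  by (simp add: translation_var_def)

lemma loc_int_translate:
  fixes g :: "'a::euclidean_space \<Rightarrow> real"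
  assumes "loc_int g"
  shows "integrable lborel (\<lambda>y. indicator (ball 0 r) y * g (x + y))"
proof -
  have "integrable lborel (\<lambda>y. indicator (ball x r) y * (indicator (ball 0 (r + norm x)) y * g y))"
    using integrable_mult_indicator[of "ball x r" lborel "\<lambda>y. indicator (ball 0 (r + norm x)) y * g y"] assms
    by (auto simp: loc_int_def)
  also have "(\<lambda>y. indicator (ball x r) y * (indicator (ball 0 (r + norm x)) y * g y))
    = (\<lambda>y. indicator (ball x r) y * g y)"
  proof -
    have "norm y < r + norm x" if "norm (x - y) < r" for y
      using that norm_triangle_sub[of y x] by (simp add: norm_minus_commute)
    then show ?thesis by (auto simp: fun_eq_iff indicator_def dist_norm)
  qed
  finally have "integrable (distr lborel borel ((+) x)) (\<lambda>y. indicator (ball x r) y * g y)"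
    by (simp add: lborel_distr_plus)
  then have "integrable lborel (\<lambda>y. indicator (ball x r) (x + y) * g (x + y))"
    by (rule integrable_distr[rotated]) auto
  also have "(\<lambda>y. indicator (ball x r) (x + y) * g (x + y)) = (\<lambda>y. indicator (ball 0 r) y * g (x + y))"
    by (auto simp: fun_eq_iff indicator_def dist_norm)
  finally show ?thesis .
qed

lemma loc_int_shift:
  fixes g :: "'a::euclidean_space \<Rightarrow> real"
  shows "loc_int g \<Longrightarrow> loc_int (\<lambda>x. g (x + v))"
  using loc_int_translate[of g _ v] by (simp add: loc_int_def add.commute)

section \<open>Averages over balls\<close>

definition vball :: "'a::euclidean_space itself \<Rightarrow> real \<Rightarrow> real" where
  "vball T r = measure lborel (ball (0::'a) r)"

definition ball_avg :: "real \<Rightarrow> ('a::euclidean_space \<Rightarrow> real) \<Rightarrow> 'a \<Rightarrow> real" where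
  "ball_avg r g x = (LINT y|lborel. indicator (ball 0 r) y * g (x + y)) / vball TYPE('a) r"

lemma vball_pos [simp]: "r > 0 \<Longrightarrow> vball TYPE('a::euclidean_space) r > 0"
  by (simp add: vball_def content_ball_pos)

lemma vball_nonneg [simp]: "vball T r \<ge> 0"
  by (simp add: vball_def)

lemma vball_scale: "r \<ge> 0 \<Longrightarrow> vball TYPE('a::euclidean_space) r = r ^ DIM('a) * vball TYPE('a) 1"
  unfolding vball_def by (rule content_ball_conv_unit_ball)

lemma emeasure_vball: "emeasure lborel (ball (c::'a::euclidean_space) r) = ennreal (vball TYPE('a) r)"
proof (cases "r \<ge> 0")
  case True
  then have "measure lborel (ball c r) = vball TYPE('a) r"
    using content_ball_conv_unit_ball[of r c] content_ball_conv_unit_ball[of r "0::'a"] by (simp add: vball_def)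
  then show ?thesis
    using emeasure_lborel_ball_finite[of c r] by (subst emeasure_eq_ennreal_measure) auto
next
  case False
  then show ?thesis by (simp add: ball_empty vball_def)
qed

lemma ball_avg_diff_le:
  fixes g :: "'a::euclidean_space \<Rightarrow> real"
  assumes g: "loc_int g" and [measurable]: "g \<in> borel_measurable borel" and r: "r > 0"
  shows "ennreal \<bar>ball_avg r g x - a\<bar>
    \<le> ennreal (1 / vball TYPE('a) r) * (\<integral>\<^sup>+y. indicator (ball 0 r) y * ennreal \<bar>g (x + y) - a\<bar> \<partial>lborel)"
proof -
  have int1: "integrable lborel (\<lambda>y. indicator (ball 0 r) y * g (x + y))"
    by (rule loc_int_translate[OF g])
  have int2: "integrable lborel (\<lambda>y::'a. indicator (ball 0 r) y * a)"
    by (simp add: emeasure_vball)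
  have "ball_avg r g x - a = (LINT y|lborel. indicator (ball 0 r) y * (g (x + y) - a)) / vball TYPE('a) r"
    using r int1 int2 content_ball_pos[OF r, of "0::'a"] by (simp add: ball_avg_def right_diff_distrib vball_def diff_divide_distrib)
  then have "ennreal \<bar>ball_avg r g x - a\<bar>
      = ennreal (1 / vball TYPE('a) r) * ennreal \<bar>LINT y|lborel. indicator (ball 0 r) y * (g (x + y) - a)\<bar>"
    using vball_pos[OF r, where 'a='a] by (simp add: ennreal_mult'[symmetric])
  moreover have "ennreal \<bar>LINT y|lborel. indicator (ball 0 r) y * (g (x + y) - a)\<bar>
     \<le> (\<integral>\<^sup>+y. ennreal (norm (indicator (ball 0 r) y * (g (x + y) - a))) \<partial>lborel)"
    using int1 int2 integral_norm_bound_ennreal[of lborel "\<lambda>y. indicator (ball 0 r) y * (g (x + y) - a)"]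
    by (simp add: right_diff_distrib)
  moreover have "(\<integral>\<^sup>+y. ennreal (norm (indicator (ball 0 r) y * (g (x + y) - a))) \<partial>lborel)
     = (\<integral>\<^sup>+y. indicator (ball 0 r) y * ennreal \<bar>g (x + y) - a\<bar> \<partial>lborel)"
    by (intro nn_integral_cong) (auto simp: indicator_def)
  ultimately show ?thesis
    by (simp add: mult_left_mono)
qed

text \<open>A Poincare inequality in L1: \<open>ball_avg r g x - g x\<close> is an average of
  increments \<open>g (x + y) - g x\<close> with \<open>norm y < r\<close>, and by Fubini each of
  these contributes an L1 norm of at most \<open>r * V\<close>.\<close>

lemma nn_integral_ball_avg_diff:
  fixes g :: "'a::euclidean_space \<Rightarrow> real"
  assumes g: "loc_int g" "translation_var g V" and r: "r > 0" and V: "V \<ge> 0"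
  shows "(\<integral>\<^sup>+x. ennreal \<bar>ball_avg r g x - g x\<bar> \<partial>lborel) \<le> ennreal (r * V)"
proof -
  have [measurable]: "g \<in> borel_measurable borel" using g by measurable
  define v where "v = vball TYPE('a) r"
  have v: "v > 0" unfolding v_def using r by simp
  have "(\<integral>\<^sup>+x. ennreal \<bar>ball_avg r g x - g x\<bar> \<partial>lborel)
     \<le> (\<integral>\<^sup>+x. ennreal (1 / v) * (\<integral>\<^sup>+y. indicator (ball 0 r) y * ennreal \<bar>g (x + y) - g x\<bar> \<partial>lborel) \<partial>lborel)"
    unfolding v_def by (intro nn_integral_mono ball_avg_diff_le g r) measurable
  also have "\<dots> = ennreal (1 / v) * (\<integral>\<^sup>+x. \<integral>\<^sup>+y. indicator (ball 0 r) y * ennreal \<bar>g (x + y) - g x\<bar> \<partial>lborel \<partial>lborel)"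
    by (rule nn_integral_cmult) measurable
  also have "(\<integral>\<^sup>+x. \<integral>\<^sup>+y. indicator (ball 0 r) y * ennreal \<bar>g (x + y) - g x\<bar> \<partial>lborel \<partial>lborel)
    = (\<integral>\<^sup>+y. \<integral>\<^sup>+x. indicator (ball 0 r) y * ennreal \<bar>g (x + y) - g x\<bar> \<partial>lborel \<partial>lborel)"
    by (rule lborel_pair.Fubini'[symmetric]) measurable
  also have "\<dots> \<le> (\<integral>\<^sup>+(y::'a). indicator (ball 0 r) y * ennreal (r * V) \<partial>lborel)"
  proof (intro nn_integral_mono)
    fix y :: 'a
    have "(\<integral>\<^sup>+x. ennreal \<bar>g (x + y) - g x\<bar> \<partial>lborel) \<le> ennreal (r * V)" if "y \<in> ball 0 r"
      using translation_varD[OF g(2), of y] that V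
      by (elim order_trans) (auto intro!: ennreal_leI mult_right_mono)
    then show "(\<integral>\<^sup>+x. indicator (ball 0 r) y * ennreal \<bar>g (x + y) - g x\<bar> \<partial>lborel) \<le> indicator (ball 0 r) y * ennreal (r * V)"
      by (auto simp: indicator_def)
  qed
  also have "ennreal (1 / v) * (\<integral>\<^sup>+(y::'a). indicator (ball 0 r) y * ennreal (r * V) \<partial>lborel)
     = ennreal (1 / v) * (ennreal v * ennreal (r * V))"
    by (simp add: nn_integral_multc emeasure_vball v_def)
  also have "\<dots> = ennreal (r * V)"
    using v r V by (simp add: ennreal_mult'[symmetric] )
  finally show ?thesis by (simp add: mult_left_mono)
qed

text \<open>The two averages are compared through the double average of
  \<open>g (x + z) - g (x + y)\<close> over both balls. Seen from \<open>x + y\<close> the increment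
  is shorter than \<open>3 * r\<close>, so the constant is \<open>3 * r\<close> times the volume of
  the ball of radius \<open>3 * r\<close>, divided by the volumes of the balls of radius
  \<open>r\<close> and \<open>2 * r\<close>.\<close>

lemma ball_avg_double:
  fixes g :: "'a::euclidean_space \<Rightarrow> real"
  assumes g: "loc_int g" "translation_var g V" and r: "r > 0" and V: "V \<ge> 0"
  shows "\<bar>ball_avg r g x - ball_avg (2 * r) g x\<bar>
     \<le> 3 * (3/2) ^ DIM('a) / vball TYPE('a) 1 * (r / r ^ DIM('a) * V)"
proof -
  have [measurable]: "g \<in> borel_measurable borel" using g by measurable
  define v where "v = vball TYPE('a) r"
  define w where "w = vball TYPE('a) (2 * r)"
  have v: "v > 0" "w > 0" unfolding v_def w_def using r by auto
  let ?I = "\<lambda>r y. indicator (ball (0::'a) r) y :: ennreal"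
  have "ennreal \<bar>ball_avg r g x - ball_avg (2*r) g x\<bar>
    \<le> ennreal (1 / v) * (\<integral>\<^sup>+y. ?I r y * ennreal \<bar>g (x + y) - ball_avg (2*r) g x\<bar> \<partial>lborel)"
    unfolding v_def by (intro ball_avg_diff_le g r) measurable
  also have "\<dots> \<le> ennreal (1 / v) * (\<integral>\<^sup>+y. ?I r y * (ennreal (1 / w) *
       (\<integral>\<^sup>+z. ?I (2*r) z * ennreal \<bar>g (x + z) - g (x + y)\<bar> \<partial>lborel)) \<partial>lborel)"
  proof (intro mult_left_mono nn_integral_mono)
    fix y
    show "ennreal \<bar>g (x + y) - ball_avg (2*r) g x\<bar> \<le> ennreal (1 / w) *
       (\<integral>\<^sup>+z. ?I (2*r) z * ennreal \<bar>g (x + z) - g (x + y)\<bar> \<partial>lborel)"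
      unfolding w_def using ball_avg_diff_le[OF g(1), of "2 * r" x "g (x + y)"] r
      by (simp add: abs_minus_commute)
  qed auto
  \<comment> \<open>Substitute \<open>z + y\<close> for \<open>z\<close>: if
    \<open>norm y < r\<close> and \<open>norm (z + y) < 2 * r\<close>, then
    \<open>norm z < 3 * r\<close>. The restriction on \<open>y\<close> is then dropped, so that
    \<open>y\<close> ranges over the whole space and \<open>translation_varD\<close>
    applies.\<close>
  also have "\<dots> \<le> ennreal (1 / v) * (\<integral>\<^sup>+y. ennreal (1 / w) *
       (\<integral>\<^sup>+z. ?I (3*r) z * ennreal \<bar>g (x + y + z) - g (x + y)\<bar> \<partial>lborel) \<partial>lborel)"
  proof (intro mult_left_mono nn_integral_mono)
    fix y
    show "?I r y * (ennreal (1 / w) * (\<integral>\<^sup>+z. ?I (2*r) z * ennreal \<bar>g (x + z) - g (x + y)\<bar> \<partial>lborel))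
      \<le> ennreal (1 / w) * (\<integral>\<^sup>+z. ?I (3*r) z * ennreal \<bar>g (x + y + z) - g (x + y)\<bar> \<partial>lborel)"
    proof (cases "y \<in> ball 0 r")
      case True
      have "(\<integral>\<^sup>+z. ?I (2*r) z * ennreal \<bar>g (x + z) - g (x + y)\<bar> \<partial>lborel)
         = (\<integral>\<^sup>+z. ?I (2*r) (z + y) * ennreal \<bar>g (x + (z + y)) - g (x + y)\<bar> \<partial>lborel)"
        by (rule nn_integral_lborel_translate[symmetric]) measurable
      also have "\<dots> \<le> (\<integral>\<^sup>+z. ?I (3*r) z * ennreal \<bar>g (x + y + z) - g (x + y)\<bar> \<partial>lborel)"
      proof (intro nn_integral_mono)
        fix z
        have "norm z \<le> norm (z + y) + norm y"
          by (metis add_diff_cancel norm_triangle_ineq4)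
        then show "?I (2*r) (z + y) * ennreal \<bar>g (x + (z + y)) - g (x + y)\<bar>
           \<le> ?I (3*r) z * ennreal \<bar>g (x + y + z) - g (x + y)\<bar>"
          using True by (auto simp: indicator_def ac_simps)
      qed
      finally show ?thesis using True by (simp add: mult_left_mono)
    qed auto
  qed auto
  also have "\<dots> = ennreal (1 / v) * ennreal (1 / w) * (\<integral>\<^sup>+y. \<integral>\<^sup>+z. ?I (3*r) z * ennreal \<bar>g (x + y + z) - g (x + y)\<bar> \<partial>lborel \<partial>lborel)"
    by (subst nn_integral_cmult) (measurable, simp add: mult.assoc)
  also have "(\<integral>\<^sup>+y. \<integral>\<^sup>+z. ?I (3*r) z * ennreal \<bar>g (x + y + z) - g (x + y)\<bar> \<partial>lborel \<partial>lborel)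
    = (\<integral>\<^sup>+z. \<integral>\<^sup>+y. ?I (3*r) z * ennreal \<bar>g (x + y + z) - g (x + y)\<bar> \<partial>lborel \<partial>lborel)"
    by (rule lborel_pair.Fubini'[symmetric]) measurable
  also have "\<dots> \<le> (\<integral>\<^sup>+z. ?I (3*r) z * ennreal (3 * r * V) \<partial>lborel)"
  proof (intro nn_integral_mono)
    fix z :: 'a
    have "(\<integral>\<^sup>+y. ennreal \<bar>g (x + y + z) - g (x + y)\<bar> \<partial>lborel)
       = (\<integral>\<^sup>+y. ennreal \<bar>g (y + x + z) - g (y + x)\<bar> \<partial>lborel)" by (simp add: ac_simps)
    also have "\<dots> = (\<integral>\<^sup>+y. ennreal \<bar>g (y + z) - g y\<bar> \<partial>lborel)"
      by (rule nn_integral_lborel_translate) measurable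
    also have "\<dots> \<le> ennreal (norm z * V)" by (rule translation_varD[OF g(2)])
    finally have *: "(\<integral>\<^sup>+y. ennreal \<bar>g (x + y + z) - g (x + y)\<bar> \<partial>lborel) \<le> ennreal (norm z * V)" .
    show "(\<integral>\<^sup>+y. ?I (3*r) z * ennreal \<bar>g (x + y + z) - g (x + y)\<bar> \<partial>lborel) \<le> ?I (3*r) z * ennreal (3 * r * V)"
    proof (cases "z \<in> ball 0 (3 * r)")
      case True
      then have "norm z * V \<le> 3 * r * V" using V by (auto intro!: mult_right_mono)
      then have "ennreal (norm z * V) \<le> ennreal (3 * r * V)" by (rule ennreal_leI)
      with * True show ?thesis by (simp only: indicator_simps mult_1_left)
    qed auto
  qed
  also have "(\<integral>\<^sup>+z. ?I (3*r) z * ennreal (3 * r * V) \<partial>lborel) = ennreal (vball TYPE('a) (3 * r)) * ennreal (3 * r * V)"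
    by (simp add: nn_integral_multc emeasure_vball)
  also have "ennreal (1 / v) * ennreal (1 / w) * (ennreal (vball TYPE('a) (3 * r)) * ennreal (3 * r * V))
    = ennreal (1 / v * (1 / w) * (vball TYPE('a) (3 * r) * (3 * r * V)))"
    using v r V vball_pos[of "3 * r", where 'a='a] by (simp add: ennreal_mult'[symmetric] del: vball_pos)
  finally have "ennreal \<bar>ball_avg r g x - ball_avg (2 * r) g x\<bar>
     \<le> ennreal (1 / v * (1 / w) * (vball TYPE('a) (3 * r) * (3 * r * V)))"
    by (simp add: mult_left_mono)
  then have "\<bar>ball_avg r g x - ball_avg (2 * r) g x\<bar> \<le> 1 / v * (1 / w) * (vball TYPE('a) (3 * r) * (3 * r * V))"
    using v r V vball_pos[of "3 * r", where 'a='a] by (subst (asm) ennreal_le_iff) (auto simp del: vball_pos)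
  also have "\<dots> = 3 * (3/2) ^ DIM('a) / vball TYPE('a) 1 * (r / r ^ DIM('a) * V)"
  proof -
    define u where "u = vball TYPE('a) 1"
    define N where "N = DIM('a)"
    define R where "R = r ^ N"
    have u: "u > 0" and R: "R > 0" unfolding u_def R_def using r by auto
    have e: "v = R * u" "w = 2 ^ N * R * u" "vball TYPE('a) (3 * r) = 3 ^ N * R * u"
      unfolding v_def w_def u_def N_def R_def using r
      by (simp_all add: vball_scale[of r] vball_scale[of "2*r"] vball_scale[of "3*r"] power_mult_distrib)
    have "1 / (R * u) * (1 / (2 ^ N * R * u)) * (3 ^ N * R * u * (3 * r * V))
      = 3 * (3 ^ N / 2 ^ N) / u * (r / R * V)"
      using u R by (simp add: mult_ac)
    then show ?thesis unfolding e u_def[symmetric] N_def[symmetric] R_def[symmetric] power_divide .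
  qed
  finally show ?thesis .
qed

section \<open>Averages at large radii and the mean value at infinity\<close>

lemma geometric_increments_limit:
  fixes a :: "nat \<Rightarrow> real"
  assumes a: "\<And>m. \<bar>a m - a (Suc m)\<bar> \<le> B / 2 ^ m"
  obtains L where "a \<longlonglongrightarrow> L" "\<bar>a 0 - L\<bar> \<le> 2 * B"
proof -
  have s: "(\<lambda>m. B / 2 ^ m) sums (B * 2)"
    using sums_mult[OF geometric_sums[of "1/2::real"], of B] by (simp add: power_one_over field_simps)
  have sm: "summable (\<lambda>m. \<bar>a (Suc m) - a m\<bar>)"
    using a by (intro summable_comparison_test'[OF sums_summable[OF s], of 0]) (simp add: abs_minus_commute)
  then have "summable (\<lambda>m. a (Suc m) - a m)" by (rule summable_rabs_cancel)
  then have "(\<lambda>n. (\<Sum>m<n. a (Suc m) - a m) + a 0) \<longlonglongrightarrow> (\<Sum>m. a (Suc m) - a m) + a 0"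
    by (intro tendsto_add summable_LIMSEQ tendsto_const)
  then obtain L where L: "a \<longlonglongrightarrow> L" by (auto simp: sum_lessThan_telescope)
  have "(\<lambda>m. a (Suc m) - a m) sums (L - a 0)" by (rule telescope_sums[OF L])
  then have "\<bar>L - a 0\<bar> \<le> (\<Sum>m. \<bar>a (Suc m) - a m\<bar>)"
    using summable_rabs[OF sm] by (simp add: sums_iff)
  also have "\<dots> \<le> (\<Sum>m. B / 2 ^ m)"
    using a by (intro suminf_le sm sums_summable[OF s]) (simp add: abs_minus_commute)
  also have "\<dots> = B * 2" using s by (simp add: sums_iff)
  finally show thesis using L that by (auto simp: abs_minus_commute)
qed

text \<open>The indicator is dropped after subtracting, which leaves the L1 norm of one increment of
  \<open>g\<close>. The volume in the denominator makes the averages at two points agree in the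
  limit of large radii.\<close>

lemma ball_avg_shift:
  fixes g :: "'a::euclidean_space \<Rightarrow> real"
  assumes g: "loc_int g" "translation_var g V" and r: "r > 0" and V: "V \<ge> 0"
  shows "\<bar>ball_avg r g x - ball_avg r g y\<bar> \<le> norm (x - y) * V / vball TYPE('a) r"
proof -
  have [measurable]: "g \<in> borel_measurable borel" using g by measurable
  have v: "vball TYPE('a) r > 0" using r by simp
  have int: "integrable lborel (\<lambda>z. indicator (ball 0 r) z * g (x + z))" for x
    by (rule loc_int_translate[OF g(1)])
  have eq: "ball_avg r g x - ball_avg r g y
     = (LINT z|lborel. indicator (ball 0 r) z * g (x + z) - indicator (ball 0 r) z * g (y + z)) / vball TYPE('a) r"
    unfolding ball_avg_def by (simp add: int diff_divide_distrib)
  have "ennreal \<bar>LINT z|lborel. indicator (ball 0 r) z * g (x + z) - indicator (ball 0 r) z * g (y + z)\<bar>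
     \<le> (\<integral>\<^sup>+z. ennreal (norm (indicator (ball 0 r) z * g (x + z) - indicator (ball 0 r) z * g (y + z))) \<partial>lborel)"
    unfolding real_norm_def[symmetric] by (rule integral_norm_bound_ennreal) (simp add: int)
  also have "\<dots> \<le> (\<integral>\<^sup>+z. ennreal \<bar>g (z + y + (x - y)) - g (z + y)\<bar> \<partial>lborel)"
    by (intro nn_integral_mono) (auto simp: indicator_def add.commute)
  also have "\<dots> = (\<integral>\<^sup>+z. ennreal \<bar>g (z + (x - y)) - g z\<bar> \<partial>lborel)"
    by (rule nn_integral_lborel_translate) measurable
  also have "\<dots> \<le> ennreal (norm (x - y) * V)" by (rule translation_varD[OF g(2)])
  finally have e: "ennreal \<bar>LINT z|lborel. indicator (ball 0 r) z * g (x + z) - indicator (ball 0 r) z * g (y + z)\<bar>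
    \<le> ennreal (norm (x - y) * V)" .
  from e have "\<bar>LINT z|lborel. indicator (ball 0 r) z * g (x + z) - indicator (ball 0 r) z * g (y + z)\<bar> \<le> norm (x - y) * V"
    using V by (subst (asm) ennreal_le_iff) auto
  with v show ?thesis unfolding eq abs_divide
    by (subst abs_of_pos[OF v]) (rule divide_right_mono, auto)
qed

text \<open>Twice the constant of \<open>ball_avg_double\<close>: in dimension at least 2 the
  increments at the radii \<open>r * 2 ^ m\<close> are bounded by a geometric series of ratio
  1/2.\<close>

definition avg_const :: "'a::euclidean_space itself \<Rightarrow> real" where
  "avg_const T = 6 * (3/2) ^ DIM('a) / vball T 1"

lemma avg_const_pos: "avg_const TYPE('a::euclidean_space) > 0"
  by (simp add: avg_const_def)

text \<open>In dimension at least 2 the dyadic increments of the averages form a convergent geometric series,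
  so a function of bounded variation has a mean value at infinity.\<close>

lemma mean_at_infinity:
  fixes g :: "'a::euclidean_space \<Rightarrow> real"
  assumes g: "loc_int g" "translation_var g V" and V: "V \<ge> 0" and n: "DIM('a) \<ge> 2"
  obtains c where "\<And>x k. \<bar>ball_avg (2 powi k) g x - c\<bar> \<le> avg_const TYPE('a) * (2 powi k / (2 powi k) ^ DIM('a) * V)"
    and "\<And>x. (\<lambda>m. ball_avg (2 ^ m) g x) \<longlonglongrightarrow> c"
proof -
  have step: "\<exists>L. (\<lambda>m. ball_avg (r * 2 ^ m) g x) \<longlonglongrightarrow> L
     \<and> \<bar>ball_avg r g x - L\<bar> \<le> avg_const TYPE('a) * (r / r ^ DIM('a) * V)" if r: "r > 0" for r x
  proof -
    have "\<bar>ball_avg (r * 2 ^ m) g x - ball_avg (r * 2 ^ Suc m) g x\<bar>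
      \<le> (3 * (3/2) ^ DIM('a) / vball TYPE('a) 1 * (r / r ^ DIM('a) * V)) / 2 ^ m" for m
    proof -
      \<comment> \<open>Dimension at least 2 gives the decay: the m-th increment carries the factor
        \<open>2 ^ m / (2 ^ m) ^ DIM('a) \<le> 1 / 2 ^ m\<close>.\<close>
      have "(2::real) ^ m * 2 ^ m = (2 ^ m) ^ 2" by (simp add: power2_eq_square)
      also have "\<dots> \<le> (2 ^ m) ^ DIM('a)" using n by (intro power_increasing) auto
      finally have *: "(2::real) ^ m / (2 ^ m) ^ DIM('a) \<le> 1 / 2 ^ m"
        by (simp add: divide_simps)
      have "\<bar>ball_avg (r * 2 ^ m) g x - ball_avg (r * 2 ^ Suc m) g x\<bar>
        \<le> 3 * (3/2) ^ DIM('a) / vball TYPE('a) 1 * ((r * 2 ^ m) / (r * 2 ^ m) ^ DIM('a) * V)"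
        using ball_avg_double[OF g, of "r * 2 ^ m" x] r V by (simp add: mult_ac)
      also have "\<dots> = 3 * (3/2) ^ DIM('a) / vball TYPE('a) 1 * (r / r ^ DIM('a) * V) * (2 ^ m / (2 ^ m) ^ DIM('a))"
        by (simp add: power_mult_distrib mult_ac)
      also have "\<dots> \<le> 3 * (3/2) ^ DIM('a) / vball TYPE('a) 1 * (r / r ^ DIM('a) * V) * (1 / 2 ^ m)"
        using r V less_imp_le[OF vball_pos[of 1, where 'a='a]]
        by (intro mult_left_mono * mult_nonneg_nonneg divide_nonneg_nonneg) auto
      finally show ?thesis by simp
    qed
    then obtain L where "(\<lambda>m. ball_avg (r * 2 ^ m) g x) \<longlonglongrightarrow> L"
      "\<bar>ball_avg (r * 2 ^ 0) g x - L\<bar> \<le> 2 * (3 * (3/2) ^ DIM('a) / vball TYPE('a) 1 * (r / r ^ DIM('a) * V))"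
      by (rule geometric_increments_limit)
    then show ?thesis unfolding avg_const_def by (intro exI[of _ L]) simp
  qed
  define L where "L x = lim (\<lambda>m. ball_avg (2 ^ m) g x)" for x
  have L: "(\<lambda>m. ball_avg (2 ^ m) g x) \<longlonglongrightarrow> L x" for x
    using step[of 1 x] unfolding L_def by (auto intro: convergentI simp: convergent_LIMSEQ_iff[symmetric])
  have vlim: "(\<lambda>m. 1 / vball TYPE('a) (2 ^ m)) \<longlonglongrightarrow> 0"
  proof (rule tendsto_sandwich[of "\<lambda>_. 0" _ _ "\<lambda>m. 1 / vball TYPE('a) 1 * (1/2) ^ m"])
    show "\<forall>\<^sub>F m in sequentially. 1 / vball TYPE('a) (2 ^ m) \<le> 1 / vball TYPE('a) 1 * (1/2) ^ m"
    proof (intro always_eventually allI)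
      fix m
      have "(2::real) ^ m \<le> (2 ^ m) ^ DIM('a)" by (intro self_le_power) auto
      then show "1 / vball TYPE('a) (2 ^ m) \<le> 1 / vball TYPE('a) 1 * (1/2) ^ m"
        using vball_pos[of 1, where 'a='a] unfolding vball_scale[of "2 ^ m", simplified]
        by (simp add: power_one_over field_simps del: vball_pos)
    qed
    show "(\<lambda>m. 1 / vball TYPE('a) 1 * (1/2) ^ m) \<longlonglongrightarrow> 0"
      by (intro tendsto_mult_right_zero LIMSEQ_realpow_zero) auto
  qed (auto intro!: always_eventually less_imp_le)
  have Leq: "L x = L y" for x y
  proof -
    have "(\<lambda>m. ball_avg (2 ^ m) g x - ball_avg (2 ^ m) g y) \<longlonglongrightarrow> 0"
    proof (rule Lim_null_comparison)
      show "(\<lambda>m. norm (x - y) * V * (1 / vball TYPE('a) (2 ^ m))) \<longlonglongrightarrow> 0"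
        by (intro tendsto_mult_right_zero vlim)
    qed (use ball_avg_shift[OF g] V in \<open>auto intro!: always_eventually\<close>)
    moreover have "(\<lambda>m. ball_avg (2 ^ m) g x - ball_avg (2 ^ m) g y) \<longlonglongrightarrow> L x - L y"
      by (intro tendsto_diff L)
    ultimately show ?thesis using LIMSEQ_unique by fastforce
  qed
  have "\<bar>ball_avg (2 powi k) g x - L 0\<bar> \<le> avg_const TYPE('a) * (2 powi k / (2 powi k) ^ DIM('a) * V)" for x k
  proof -
    obtain L' where L': "(\<lambda>m. ball_avg (2 powi k * 2 ^ m) g x) \<longlonglongrightarrow> L'"
      "\<bar>ball_avg (2 powi k) g x - L'\<bar> \<le> avg_const TYPE('a) * (2 powi k / (2 powi k) ^ DIM('a) * V)"
      using step[of "2 powi k" x] by auto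
    \<comment> \<open>For negative \<open>k\<close> the first \<open>nat (- k)\<close> radii are
      below 1. Once they are dropped, the radii \<open>2 powi k * 2 ^ m\<close> form a tail of the
      radii \<open>2 ^ m\<close>, so the limit does not depend on \<open>k\<close>.\<close>
    have "(\<lambda>m. ball_avg (2 powi k * 2 ^ (m + nat (-k))) g x) \<longlonglongrightarrow> L'"
      by (rule LIMSEQ_ignore_initial_segment[OF L'(1)])
    moreover have "2 powi k * 2 ^ (m + nat (-k)) = (2::real) ^ (m + nat k)" for m
    proof -
      have "2 powi k * (2::real) ^ (m + nat (-k)) = 2 powi k * 2 powi (int (m + nat (-k)))"
        by (simp only: power_int_of_nat)
      also have "\<dots> = (2::real) powi (k + int (m + nat (-k)))"
        by (rule power_int_add[symmetric]) simp
      also have "k + int (m + nat (-k)) = int (m + nat k)" by simp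
      finally show ?thesis by (simp only: power_int_of_nat)
    qed
    ultimately have "(\<lambda>m. ball_avg (2 ^ (m + nat k)) g x) \<longlonglongrightarrow> L'" by simp
    moreover have "(\<lambda>m. ball_avg (2 ^ (m + nat k)) g x) \<longlonglongrightarrow> L x"
      by (rule LIMSEQ_ignore_initial_segment[OF L])
    ultimately show ?thesis using L'(2) Leq[of x 0] LIMSEQ_unique by metis
  qed
  with that[of "L 0"] L Leq show thesis by metis
qed

text \<open>The averages are at most the L1 norm divided by the volume, so the mean value at
  infinity is 0. This is applied to the truncations of \<open>f\<close>, which are integrable even
  when \<open>f\<close> is not.\<close>

lemma mean_at_infinity_zero:
  fixes g :: "'a::euclidean_space \<Rightarrow> real"
  assumes g: "translation_var g V" "integrable lborel g" and V: "V \<ge> 0" and n: "DIM('a) \<ge> 2"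
  shows "\<bar>ball_avg (2 powi k) g x\<bar> \<le> avg_const TYPE('a) * (2 powi k / (2 powi k) ^ DIM('a) * V)"
proof -
  have li: "loc_int g"
    unfolding loc_int_def using integrable_mult_indicator[OF _ g(2)] by auto
  obtain c where c: "\<And>x k. \<bar>ball_avg (2 powi k) g x - c\<bar> \<le> avg_const TYPE('a) * (2 powi k / (2 powi k) ^ DIM('a) * V)"
    and lim: "\<And>x. (\<lambda>m. ball_avg (2 ^ m) g x) \<longlonglongrightarrow> c"
    using mean_at_infinity[OF li g(1) V n] by metis
  have "(\<lambda>m. ball_avg (2 ^ m) g 0) \<longlonglongrightarrow> 0"
  proof (rule Lim_null_comparison)
    show "\<forall>\<^sub>F m in sequentially. norm (ball_avg (2 ^ m) g 0) \<le> (LINT x|lborel. \<bar>g x\<bar>) / vball TYPE('a) 1 * (1/2) ^ m"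
    proof (intro always_eventually allI)
      fix m :: nat
      have v: "vball TYPE('a) 1 > 0" by simp
      have p: "(2::real) ^ m \<le> (2 ^ m) ^ DIM('a)" by (intro self_le_power) auto
      have "\<bar>LINT y|lborel. indicator (ball 0 (2 ^ m)) y * g (0 + y)\<bar>
          \<le> (LINT y|lborel. \<bar>indicator (ball 0 (2 ^ m)) y * g (0 + y)\<bar>)"
        by (rule integral_abs_bound)
      also have "\<dots> \<le> (LINT x|lborel. \<bar>g x\<bar>)"
        using li g(2) unfolding loc_int_def by (intro integral_mono) (auto simp: indicator_def)
      finally have "\<bar>ball_avg (2 ^ m) g 0\<bar> \<le> (LINT x|lborel. \<bar>g x\<bar>) / (vball TYPE('a) 1 * (2 ^ m) ^ DIM('a))"
        using v unfolding ball_avg_def vball_scale[of "2 ^ m", simplified] abs_divide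
        by (subst abs_of_pos[of "_ * _"])
          (auto simp: mult.commute intro!: divide_right_mono mult_nonneg_nonneg less_imp_le[OF v])
      also have "\<dots> \<le> (LINT x|lborel. \<bar>g x\<bar>) / (vball TYPE('a) 1 * 2 ^ m)"
        using v p by (intro divide_left_mono mult_left_mono) auto
      finally show "norm (ball_avg (2 ^ m) g 0) \<le> (LINT x|lborel. \<bar>g x\<bar>) / vball TYPE('a) 1 * (1/2) ^ m"
        by (simp add: power_one_over)
    qed
    show "(\<lambda>m. (LINT x|lborel. \<bar>g x\<bar>) / vball TYPE('a) 1 * (1/2) ^ m) \<longlonglongrightarrow> 0"
      by (intro tendsto_mult_right_zero LIMSEQ_realpow_zero) auto
  qed
  with lim[of 0] have "c = 0" by (rule LIMSEQ_unique)
  with c show ?thesis by simp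
qed

section \<open>Level sets of functions of bounded variation\<close>

lemma dyadic_approx:
  fixes t :: real assumes "t > 0" "n > 0"
  obtains k :: int where "t \<le> (2 powi k) ^ n" "2 powi k \<le> 2 * t powr (1 / n)"
proof -
  define k where "k = \<lceil>log 2 (t powr (1/n))\<rceil>"
  have pos: "t powr (1/n) > 0" using assms by simp
  have e: "2 powi k = 2 powr (real_of_int k)" by (simp add: powr_real_of_int')
  have "t powr (1/n) = 2 powr log 2 (t powr (1/n))" using pos by simp
  also have "\<dots> \<le> 2 powr (real_of_int k)" unfolding k_def by (intro powr_mono) auto
  finally have 1: "t powr (1/n) \<le> 2 powi k" using e by simp
  have "t = (t powr (1/n)) ^ n" using assms by (simp add: powr_realpow[symmetric] powr_powr)
  also have "\<dots> \<le> (2 powi k) ^ n" using 1 by (intro power_mono) auto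
  finally have a: "t \<le> (2 powi k) ^ n" .
  have "2 powr (real_of_int k) \<le> 2 powr (log 2 (t powr (1/n)) + 1)"
    unfolding k_def by (intro powr_mono) linarith+
  also have "\<dots> = 2 * t powr (1/n)" using pos by (simp add: powr_add)
  finally have "2 powi k \<le> 2 * t powr (1/n)" by (simp only: e)
  with a show thesis by (rule that)
qed

text \<open>At a suitable dyadic radius \<open>r\<close> all averages are at most
  \<open>l / 2\<close>, so on the level set \<open>g\<close> differs from its average by at least
  \<open>l / 2\<close>. Chebyshev's inequality and \<open>nn_integral_ball_avg_diff\<close> bound
  the measure by \<open>2 * r * V / l\<close>. The radius is of order
  \<open>(V / l) powr (1 / (n - 1))\<close>, whence the Sobolev exponent
  \<open>n / (n - 1)\<close>.\<close>

lemma weak_type_sobolev: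
  fixes g :: "'a::euclidean_space \<Rightarrow> real"
  assumes g: "loc_int g" "translation_var g V" and V: "V > 0" and n: "DIM('a) \<ge> 2" and l: "l > 0"
    and avg: "\<And>x k. \<bar>ball_avg (2 powi k) g x\<bar> \<le> avg_const TYPE('a) * (2 powi k / (2 powi k) ^ DIM('a) * V)"
  shows "emeasure lborel {x. \<bar>g x\<bar> \<ge> l}
     \<le> ennreal (4 * (2 * avg_const TYPE('a)) powr (1 / (real DIM('a) - 1)) * (V / l) powr (real DIM('a) / (real DIM('a) - 1)))"
proof -
  have [measurable]: "g \<in> borel_measurable borel" using g by measurable
  define D where "D = avg_const TYPE('a)"
  have D: "D > 0" unfolding D_def by (rule avg_const_pos)
  define N where "N = DIM('a) - 1"
  have N: "N > 0" "DIM('a) = Suc N" "real N = real DIM('a) - 1" using n by (auto simp: N_def)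
  have pos: "2 * D * V / l > 0" using D V l by simp
  \<comment> \<open>At radius \<open>r\<close> the averages are at most
    \<open>D * V / r ^ N\<close>, which is at most \<open>l / 2\<close> exactly when
    \<open>r ^ N \<ge> 2 * D * V / l\<close>.\<close>
  obtain k where k: "2 * D * V / l \<le> (2 powi k) ^ N" "2 powi k \<le> 2 * (2 * D * V / l) powr (1 / N)"
    by (rule dyadic_approx[OF pos N(1)])
  define r :: real where "r = 2 powi k"
  have r: "r > 0" by (simp add: r_def)
  have "D * (r / r ^ DIM('a) * V) = D * V / r ^ N" using r unfolding N(2) by simp
  also have "\<dots> \<le> l / 2" using k(1) l r unfolding r_def[symmetric] by (simp add: field_simps)
  finally have a0: "D * (r / r ^ DIM('a) * V) \<le> l / 2" .
  have a: "\<bar>ball_avg r g x\<bar> \<le> l / 2" for x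
    by (rule order_trans[OF avg[of k x, folded r_def D_def] a0])
  have "ennreal (l / 2) * emeasure lborel {x. \<bar>g x\<bar> \<ge> l} = (\<integral>\<^sup>+x. ennreal (l/2) * indicator {x. \<bar>g x\<bar> \<ge> l} x \<partial>lborel)"
    by (subst nn_integral_cmult_indicator) measurable
  also have "\<dots> \<le> (\<integral>\<^sup>+x. ennreal \<bar>ball_avg r g x - g x\<bar> \<partial>lborel)"
  proof (intro nn_integral_mono)
    fix x
    show "ennreal (l/2) * indicator {x. \<bar>g x\<bar> \<ge> l} x \<le> ennreal \<bar>ball_avg r g x - g x\<bar>"
    proof (cases "l \<le> \<bar>g x\<bar>")
      case True
      then have "l / 2 \<le> \<bar>ball_avg r g x - g x\<bar>" using a[of x] by linarith
      then show ?thesis using True by (simp add: ennreal_leI)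
    qed auto
  qed
  also have "\<dots> \<le> ennreal (r * V)"
    using V by (intro nn_integral_ball_avg_diff g r) auto
  finally have "ennreal (2 / l) * (ennreal (l / 2) * emeasure lborel {x. \<bar>g x\<bar> \<ge> l}) \<le> ennreal (2 / l) * ennreal (r * V)"
    by (rule mult_left_mono) auto
  then have "emeasure lborel {x. \<bar>g x\<bar> \<ge> l} \<le> ennreal (2 / l * (r * V))"
    using l r V by (simp add: mult.assoc[symmetric] ennreal_mult'[symmetric])
  also have "\<dots> \<le> ennreal (4 * (2 * D) powr (1 / (real DIM('a) - 1)) * (V / l) powr (real DIM('a) / (real DIM('a) - 1)))"
  proof (rule ennreal_leI)
    have "2 / l * (r * V) \<le> 2 / l * (2 * (2 * D * V / l) powr (1 / N) * V)"
      using k(2) l V unfolding r_def[symmetric] by (intro mult_left_mono mult_right_mono) auto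
    also have "\<dots> = 4 * (2 * D) powr (1 / N) * ((V / l) powr (1 / N) * (V / l) powr 1)"
      using D V l by (simp add: powr_mult powr_divide mult_ac)
    also have "(V / l) powr (1 / N) * (V / l) powr 1 = (V / l) powr (real DIM('a) / (real DIM('a) - 1))"
      unfolding powr_add[symmetric] N(3) using N by (auto simp: field_simps intro!: arg_cong[where f="\<lambda>z. _ powr z"])
    finally show "2 / l * (r * V) \<le> 4 * (2 * D) powr (1 / (real DIM('a) - 1)) * (V / l) powr (real DIM('a) / (real DIM('a) - 1))"
      using N(3) by simp
  qed
  finally show ?thesis by (simp add: D_def)
qed

section \<open>Dyadic truncation\<close>

definition clip :: "real \<Rightarrow> real \<Rightarrow> real" where
  "clip d s = max (- d) (min d s)"

text \<open>Odd and nondecreasing in \<open>s\<close>: the part of \<open>s\<close> lying between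
  the heights \<open>2 powi j\<close> and \<open>2 powi (j + 1)\<close>. As a difference of clips it
  telescopes in \<open>j\<close>.\<close>

definition trunc :: "int \<Rightarrow> real \<Rightarrow> real" where
  "trunc j s = clip (2 powi (j + 1)) s - clip (2 powi j) s"

lemma powi_Suc2: "(2::real) powi (j + 1) = 2 * 2 powi j"
  by (simp add: power_int_add)

lemma clip_diff:
  assumes "t > 0"
  shows "a \<le> b \<Longrightarrow> clip (2 * t) a - clip t a \<le> clip (2 * t) b - clip t b"
    and "\<bar>clip (2 * t) a - clip t a\<bar> \<le> t"
    and "\<bar>a\<bar> < t \<Longrightarrow> clip (2 * t) a - clip t a = 0"
    and "2 * t \<le> \<bar>a\<bar> \<Longrightarrow> \<bar>clip (2 * t) a - clip t a\<bar> = t"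
    and "\<bar>clip (2 * t) a - clip t a\<bar> \<le> \<bar>a\<bar>"
  using assms unfolding clip_def max_def min_def abs_if by (auto split: if_splits)

lemma
  shows trunc_mono: "a \<le> b \<Longrightarrow> trunc j a \<le> trunc j b"
    and abs_trunc_le: "\<bar>trunc j a\<bar> \<le> 2 powi j"
    and trunc_eq_0: "\<bar>a\<bar> < 2 powi j \<Longrightarrow> trunc j a = 0"
    and abs_trunc_large: "2 powi (j + 1) \<le> \<bar>a\<bar> \<Longrightarrow> \<bar>trunc j a\<bar> = 2 powi j"
    and abs_trunc_le_self: "\<bar>trunc j a\<bar> \<le> \<bar>a\<bar>"
  unfolding trunc_def powi_Suc2 by (intro clip_diff; simp)+

lemma borel_measurable_trunc [measurable]: "trunc j \<in> borel_measurable borel"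
  unfolding trunc_def clip_def by measurable

lemma sum_trunc:
  "(\<Sum>j\<in>{- int J..<int J}. trunc j s) = clip (2 ^ J) s - clip (2 powi (- int J)) s"
proof -
  have "(\<Sum>j\<in>{a..<a + int m}. trunc j s) = clip (2 powi (a + int m)) s - clip (2 powi a) s" for a m
  proof (induction m)
    case (Suc m)
    have "{a..<a + int (Suc m)} = insert (a + int m) {a..<a + int m}" by auto
    moreover have "a + int (Suc m) = a + int m + 1" by simp
    ultimately show ?case using Suc by (simp only: trunc_def) simp
  qed simp
  from this[of "- int J" "2 * J"] show ?thesis by simp
qed

lemma sum_trunc_tendsto: "(\<lambda>J. \<Sum>j\<in>{- int J..<int J}. trunc j s) \<longlonglongrightarrow> s"
proof -
  have "(\<lambda>J. clip (2 powi (- int J)) s) \<longlonglongrightarrow> 0"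
  proof (rule Lim_null_comparison)
    show "(\<lambda>J. (1/2::real) ^ J) \<longlonglongrightarrow> 0" by (intro LIMSEQ_realpow_zero) auto
    show "\<forall>\<^sub>F J in sequentially. norm (clip (2 powi (- int J)) s) \<le> (1/2) ^ J"
    proof (intro always_eventually allI)
      fix J
      have "(0::real) < 2 powi (- int J)" by simp
      then have "\<bar>clip (2 powi (- int J)) s\<bar> \<le> 2 powi (- int J)"
        unfolding clip_def max_def min_def abs_if by auto
      then show "norm (clip (2 powi (- int J)) s) \<le> (1/2) ^ J"
        by (simp add: power_int_minus power_one_over inverse_eq_divide)
    qed
  qed
  moreover have "\<forall>\<^sub>F J in sequentially. clip (2 ^ J) s = s"
  proof -
    obtain m where "\<bar>s\<bar> < 2 ^ m" using real_arch_pow[of 2] by auto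
    have "clip (2 ^ J) s = s" if "J \<ge> m" for J
    proof -
      have "\<bar>s\<bar> \<le> 2 ^ J" using \<open>\<bar>s\<bar> < 2 ^ m\<close> power_increasing[OF that, of "2::real"] by linarith
      then show ?thesis unfolding clip_def by linarith
    qed
    then show ?thesis by (auto simp: eventually_sequentially)
  qed
  ultimately have "(\<lambda>J. clip (2 ^ J) s - clip (2 powi (- int J)) s) \<longlonglongrightarrow> s - 0"
    by (intro tendsto_diff) (rule tendsto_eventually)
  then show ?thesis by (simp add: sum_trunc)
qed

text \<open>Every \<open>trunc j\<close> is nondecreasing, so all increments between
  \<open>a\<close> and \<open>b\<close> have one sign and the sum of their absolute values
  telescopes to increments of two clips. Each \<open>clip t\<close> with \<open>t \<ge> 0\<close> is
  nondecreasing and 1-Lipschitz.\<close>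

lemma sum_trunc_diff_le:
  assumes "finite A"
  shows "(\<Sum>j\<in>A. \<bar>trunc j a - trunc j b\<bar>) \<le> \<bar>a - b\<bar>"
proof -
  have le: "(\<Sum>j\<in>{- int J..<int J}. \<bar>trunc j a - trunc j b\<bar>) \<le> b - a" if "a \<le> b" for a b J
  proof -
    have "(\<Sum>j\<in>{- int J..<int J}. \<bar>trunc j a - trunc j b\<bar>)
      = (\<Sum>j\<in>{- int J..<int J}. trunc j b) - (\<Sum>j\<in>{- int J..<int J}. trunc j a)"
      unfolding sum_subtractf[symmetric] using trunc_mono[OF that] by (intro sum.cong) (auto simp: abs_minus_commute)
    also have "\<dots> = (clip (2 ^ J) b - clip (2 ^ J) a) - (clip (2 powi (- int J)) b - clip (2 powi (- int J)) a)"
      by (simp add: sum_trunc)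
    also have "\<dots> \<le> b - a"
    proof -
      have "t \<ge> 0 \<Longrightarrow> clip t b - clip t a \<le> b - a" for t
        using that unfolding clip_def by linarith
      moreover have "clip t b \<ge> clip t a" for t
        using that unfolding clip_def by linarith
      ultimately show ?thesis by (smt (verit) zero_le_power)
    qed
    finally show ?thesis .
  qed
  obtain J where J: "A \<subseteq> {- int J..<int J}"
  proof -
    have "\<exists>m. \<forall>j\<in>A. nat \<bar>j\<bar> \<le> m" using finite_nat_set_iff_bounded_le[of "(\<lambda>j. nat \<bar>j\<bar>) ` A"] assms by auto
    then obtain m where "\<forall>j\<in>A. nat \<bar>j\<bar> \<le> m" ..
    then have "A \<subseteq> {- int (Suc m)..<int (Suc m)}" by force
    then show thesis by (rule that)
  qed
  have "(\<Sum>j\<in>A. \<bar>trunc j a - trunc j b\<bar>) \<le> (\<Sum>j\<in>{- int J..<int J}. \<bar>trunc j a - trunc j b\<bar>)"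
    by (intro sum_mono2 J) auto
  also have "\<dots> \<le> \<bar>a - b\<bar>"
    using le[of a b J] le[of b a J] by (cases "a \<le> b") (auto simp: abs_minus_commute)
  finally show ?thesis .
qed

text \<open>Write \<open>h\<close> as \<open>q / 2 ^ m + d\<close> with
  \<open>0 \<le> d \<le> 1 / 2 ^ m\<close>. Subadditivity handles the dyadic multiple, and the crude
  bound \<open>norm v * V\<close> handles the rest, which disappears as \<open>m\<close> grows. A
  bound along dyadic steps thus extends to all steps.\<close>

lemma subadditive_ray:
  fixes N :: "'a::real_normed_vector \<Rightarrow> real"
  assumes sub: "\<And>u v. N (u + v) \<le> N u + N v" and bound: "\<And>v. N v \<le> norm v * V" and nonneg: "\<And>v. N v \<ge> 0"
    and dy: "\<And>m. 2 ^ m * N ((1 / 2 ^ m) *\<^sub>R e) \<le> S" and h: "h \<ge> 0" and V: "V \<ge> 0"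
  shows "N (h *\<^sub>R e) \<le> h * S"
proof -
  have mult: "N (real q *\<^sub>R v) \<le> real q * N v" for q v
  proof (induction q)
    case 0 then show ?case using bound[of 0] by simp
  next
    case (Suc q)
    have "N (real (Suc q) *\<^sub>R v) \<le> N v + N (real q *\<^sub>R v)"
      using sub[of v "real q *\<^sub>R v"] by (simp add: scaleR_add_left)
    then show ?case using Suc by (simp add: algebra_simps)
  qed
  have S: "S \<ge> 0" using nonneg[of "(1 / 2 ^ 0) *\<^sub>R e"] dy[of 0] by simp
  have le: "N (h *\<^sub>R e) \<le> h * S + norm e * V * (1/2) ^ m" for m
  proof -
    define q where "q = nat \<lfloor>h * 2 ^ m\<rfloor>"
    have q: "real q \<le> h * 2 ^ m" "h * 2 ^ m \<le> real q + 1" using h by (auto simp: q_def)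
    define d where "d = h - real q / 2 ^ m"
    have d: "0 \<le> d" "d \<le> 1 / 2 ^ m" using q by (simp_all add: d_def diff_le_eq pos_divide_le_eq add_divide_distrib[symmetric] pos_le_divide_eq)
    have "h *\<^sub>R e = real q *\<^sub>R ((1 / 2 ^ m) *\<^sub>R e) + d *\<^sub>R e" by (simp add: d_def algebra_simps)
    then have "N (h *\<^sub>R e) \<le> N (real q *\<^sub>R ((1 / 2 ^ m) *\<^sub>R e)) + N (d *\<^sub>R e)" using sub by metis
    also have "\<dots> \<le> real q * N ((1 / 2 ^ m) *\<^sub>R e) + d * (norm e * V)"
      using mult[of q "(1 / 2 ^ m) *\<^sub>R e"] bound[of "d *\<^sub>R e"] d by (simp add: mult.assoc)
    also have "\<dots> \<le> h * S + 1 / 2 ^ m * (norm e * V)"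
    proof (intro add_mono mult_right_mono d)
      have "real q * N ((1 / 2 ^ m) *\<^sub>R e) \<le> h * 2 ^ m * N ((1 / 2 ^ m) *\<^sub>R e)"
        by (intro mult_right_mono q nonneg)
      also have "\<dots> \<le> h * S" using mult_left_mono[OF dy[of m] h] by (simp add: mult.assoc)
      finally show "real q * N ((1 / 2 ^ m) *\<^sub>R e) \<le> h * S" .
    qed (use V in auto)
    finally show ?thesis by (simp add: power_one_over mult_ac)
  qed
  show ?thesis
  proof (rule LIMSEQ_le_const)
    have "(\<lambda>m. h * S + norm e * V * (1/2) ^ m) \<longlonglongrightarrow> h * S + 0"
      by (intro tendsto_add tendsto_const tendsto_mult_right_zero LIMSEQ_realpow_zero) auto
    then show "(\<lambda>m. h * S + norm e * V * (1/2) ^ m) \<longlonglongrightarrow> h * S" by simp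
  qed (use le in auto)
qed

lemma nn_integral_translation_diff_add:
  fixes g :: "'a::euclidean_space \<Rightarrow> real"
  assumes [measurable]: "g \<in> borel_measurable borel"
  shows "(\<integral>\<^sup>+x. ennreal \<bar>g (x + (u + v)) - g x\<bar> \<partial>lborel)
     \<le> (\<integral>\<^sup>+x. ennreal \<bar>g (x + u) - g x\<bar> \<partial>lborel) + (\<integral>\<^sup>+x. ennreal \<bar>g (x + v) - g x\<bar> \<partial>lborel)"
proof -
  have "(\<integral>\<^sup>+x. ennreal \<bar>g (x + (u + v)) - g x\<bar> \<partial>lborel)
    \<le> (\<integral>\<^sup>+x. ennreal \<bar>g (x + v + u) - g (x + v)\<bar> + ennreal \<bar>g (x + v) - g x\<bar> \<partial>lborel)"
    by (intro nn_integral_mono) (auto simp: ennreal_plus[symmetric] ac_simps simp del: ennreal_plus intro!: ennreal_leI)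
  also have "\<dots> = (\<integral>\<^sup>+x. ennreal \<bar>g (x + v + u) - g (x + v)\<bar> \<partial>lborel) + (\<integral>\<^sup>+x. ennreal \<bar>g (x + v) - g x\<bar> \<partial>lborel)"
    by (rule nn_integral_add) measurable
  also have "(\<integral>\<^sup>+x. ennreal \<bar>g (x + v + u) - g (x + v)\<bar> \<partial>lborel) = (\<integral>\<^sup>+x. ennreal \<bar>g (x + u) - g x\<bar> \<partial>lborel)"
    by (rule nn_integral_lborel_translate) measurable
  finally show ?thesis .
qed

lemma nn_integral_translation_diff_minus:
  fixes g :: "'a::euclidean_space \<Rightarrow> real"
  assumes [measurable]: "g \<in> borel_measurable borel"
  shows "(\<integral>\<^sup>+x. ennreal \<bar>g (x - v) - g x\<bar> \<partial>lborel) = (\<integral>\<^sup>+x. ennreal \<bar>g (x + v) - g x\<bar> \<partial>lborel)"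
proof -
  have "(\<integral>\<^sup>+x. ennreal \<bar>g (x - v) - g x\<bar> \<partial>lborel) = (\<integral>\<^sup>+x. ennreal \<bar>g (x + v - v) - g (x + v)\<bar> \<partial>lborel)"
    by (rule nn_integral_lborel_translate[symmetric]) measurable
  then show ?thesis by (simp add: abs_minus_commute)
qed

text \<open>The dyadic difference quotients increase as the step is halved, and for each fixed step the
  truncations split the increments of \<open>f\<close> exactly; hence the variations of the truncations sum up.\<close>

lemma trunc_variation:
  fixes f :: "'a::euclidean_space \<Rightarrow> real"
  assumes f: "translation_var f V" and V: "V \<ge> 0"
  obtains W :: "int \<Rightarrow> real" where "\<And>j. W j \<ge> 0" "\<And>j. translation_var (\<lambda>x. trunc j (f x)) (W j)"
    "\<And>A. finite A \<Longrightarrow> (\<Sum>j\<in>A. W j) \<le> real DIM('a) * V"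
proof -
  have [measurable]: "f \<in> borel_measurable borel" using f by measurable
  define M where "M j v = (\<integral>\<^sup>+x. ennreal \<bar>trunc j (f (x + v)) - trunc j (f x)\<bar> \<partial>lborel)" for j and v :: 'a
  have Msum: "(\<Sum>j\<in>A. M j v) \<le> ennreal (norm v * V)" if "finite A" for A v
  proof -
    have "(\<Sum>j\<in>A. M j v) = (\<integral>\<^sup>+x. (\<Sum>j\<in>A. ennreal \<bar>trunc j (f (x + v)) - trunc j (f x)\<bar>) \<partial>lborel)"
      unfolding M_def by (rule nn_integral_sum[symmetric]) measurable
    also have "\<dots> \<le> (\<integral>\<^sup>+x. ennreal \<bar>f (x + v) - f x\<bar> \<partial>lborel)"
      by (intro nn_integral_mono) (simp add: sum_ennreal, intro ennreal_leI sum_trunc_diff_le that)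
    also have "\<dots> \<le> ennreal (norm v * V)" by (rule translation_varD[OF f])
    finally show ?thesis .
  qed
  have M1: "M j v \<le> ennreal (norm v * V)" for j v using Msum[of "{j}"] by simp
  have Madd: "M j (u + v) \<le> M j u + M j v" for j u v
    unfolding M_def by (rule nn_integral_translation_diff_add) measurable
  have Mminus: "M j (- v) = M j v" for j v
    unfolding M_def using nn_integral_translation_diff_minus[of "\<lambda>x. trunc j (f x)" v] by simp
  define m where "m j v = enn2real (M j v)" for j v
  have Mm: "M j v = ennreal (m j v)" for j v
    unfolding m_def using M1[of j v] by (intro ennreal_enn2real[symmetric]) (auto simp: less_top[symmetric] top_unique)
  have m0: "m j v \<ge> 0" for j v by (simp add: m_def)
  have msub: "m j (u + v) \<le> m j u + m j v" for j u v
    using Madd[of j u v] by (simp add: Mm m0 ennreal_plus[symmetric] del: ennreal_plus)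
  have mbound: "m j v \<le> norm v * V" for j v
    using M1[of j v] V by (simp add: Mm)
  have mminus: "m j (- v) = m j v" for j v by (simp add: m_def Mminus)
  have msum: "(\<Sum>j\<in>A. m j v) \<le> norm v * V" if "finite A" for A v
    using Msum[OF that, of v] V by (simp add: Mm m0 sum_ennreal sum_nonneg)
  \<comment> \<open>A supremum over all \<open>v\<close>, taken for each \<open>j\<close>
    separately, would not add up, since different \<open>j\<close> may favour different
    \<open>v\<close>. The monotone limit along the steps \<open>(1 / 2 ^ i) *\<^sub>R e\<close>
    commutes with finite sums over \<open>j\<close>.\<close>
  define S where "S j e i = 2 ^ i * m j ((1 / 2 ^ i) *\<^sub>R e)" for j e and i :: nat
  have Sinc: "incseq (S j e)" for j e
  proof (rule incseq_SucI)
    fix i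
    have "(1 / 2 ^ i) *\<^sub>R e = (1 / 2 ^ Suc i) *\<^sub>R e + (1 / 2 ^ Suc i) *\<^sub>R e"
      by (simp add: scaleR_add_left[symmetric])
    then have "m j ((1 / 2 ^ i) *\<^sub>R e) \<le> 2 * m j ((1 / 2 ^ Suc i) *\<^sub>R e)"
      using msub[of j "(1 / 2 ^ Suc i) *\<^sub>R e" "(1 / 2 ^ Suc i) *\<^sub>R e"] by simp
    then show "S j e i \<le> S j e (Suc i)" by (simp add: S_def)
  qed
  have Sbound: "S j e i \<le> norm e * V" for j e i
    using mbound[of j "(1 / 2 ^ i) *\<^sub>R e"] by (simp add: S_def field_simps)
  define L where "L j e = lim (S j e)" for j e
  have Slim: "S j e \<longlonglongrightarrow> L j e" for j e
    unfolding L_def using incseq_convergent[OF Sinc, of j e "norm e * V"] Sbound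
    by (metis limI)
  have SL: "S j e i \<le> L j e" for j e i by (rule incseq_le[OF Sinc Slim])
  have L0: "L j e \<ge> 0" for j e using SL[of j e 0] m0[of j e] by (simp add: S_def)
  have Lsum: "(\<Sum>j\<in>A. L j e) \<le> norm e * V" if "finite A" for A e
  proof (rule LIMSEQ_le_const2)
    show "(\<lambda>i. \<Sum>j\<in>A. S j e i) \<longlonglongrightarrow> (\<Sum>j\<in>A. L j e)" by (intro tendsto_sum Slim)
    have "(\<Sum>j\<in>A. S j e i) \<le> norm e * V" for i
      using msum[OF that, of "(1 / 2 ^ i) *\<^sub>R e"] by (simp add: S_def sum_distrib_left[symmetric] field_simps)
    then show "\<exists>N. \<forall>i\<ge>N. (\<Sum>j\<in>A. S j e i) \<le> norm e * V" by blast
  qed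
  have ray: "m j (h *\<^sub>R e) \<le> \<bar>h\<bar> * L j e" for j h e
  proof -
    have pos: "m j (h *\<^sub>R e) \<le> h * L j e" if "h \<ge> 0" for h
      using that SL[of j e] unfolding S_def
      by (intro subadditive_ray[where N="m j" and V=V and e=e and h=h and S="L j e"] msub mbound m0 V)
    show ?thesis
    proof (cases "h \<ge> 0")
      case False
      then show ?thesis using pos[of "- h"] mminus[of j "h *\<^sub>R e"] by simp
    qed (use pos in auto)
  qed
  \<comment> \<open>A general \<open>v\<close> is reached coordinate by coordinate, so the
    directional limits are added over the basis. Each direction contributes at most \<open>V\<close>
    to the sum over \<open>j\<close>, hence the factor \<open>DIM('a)\<close>.\<close>
  define W where "W j = (\<Sum>e\<in>Basis. L j e)" for j
  have mW: "m j v \<le> norm v * W j" for j v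
  proof -
    have "m j (\<Sum>e\<in>B. (v \<bullet> e) *\<^sub>R e) \<le> (\<Sum>e\<in>B. \<bar>v \<bullet> e\<bar> * L j e)" if "finite B" for B
      using that
    proof induction
      case empty then show ?case using mbound[of j 0] by simp
    next
      case (insert e B)
      then show ?case using msub[of j "(v \<bullet> e) *\<^sub>R e" "\<Sum>e\<in>B. (v \<bullet> e) *\<^sub>R e"] ray[of j "v \<bullet> e" e] by simp
    qed
    from this[OF finite_Basis] have "m j v \<le> (\<Sum>e\<in>Basis. \<bar>v \<bullet> e\<bar> * L j e)"
      by (simp add: euclidean_representation)
    also have "\<dots> \<le> (\<Sum>e\<in>Basis. norm v * L j e)"
      by (intro sum_mono mult_right_mono L0 Basis_le_norm)
    finally show ?thesis by (simp add: W_def sum_distrib_left)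
  qed
  show thesis
  proof
    show "W j \<ge> 0" for j by (simp add: W_def L0 sum_nonneg)
    show "translation_var (\<lambda>x. trunc j (f x)) (W j)" for j
      unfolding translation_var_def using mW[of j] Mm[of j, unfolded M_def] by (auto intro!: ennreal_leI)
    fix A :: "int set" assume A: "finite A"
    have "(\<Sum>j\<in>A. W j) = (\<Sum>e\<in>Basis. \<Sum>j\<in>A. L j e)" unfolding W_def by (rule sum.swap)
    also have "\<dots> \<le> (\<Sum>e\<in>(Basis::'a set). V)"
      using Lsum[OF A] by (intro sum_mono) (metis mult_1 norm_Basis)
    finally show "(\<Sum>j\<in>A. W j) \<le> real DIM('a) * V" by simp
  qed
qed

section \<open>The mixed-norm estimate for one truncation\<close>

lemma sum_geometric_int:
  fixes q :: real
  assumes A: "finite A" and q: "0 \<le> q" "q < 1"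
  shows "(\<Sum>k\<in>A. q ^ nat \<bar>k - K\<bar>) \<le> 2 / (1 - q)"
proof -
  have half: "(\<Sum>k\<in>B. q ^ nat \<bar>k - K\<bar>) \<le> 1 / (1 - q)" if "finite B" "inj_on (\<lambda>k. nat \<bar>k - K\<bar>) B" for B
  proof -
    have "(\<Sum>k\<in>B. q ^ nat \<bar>k - K\<bar>) = (\<Sum>m\<in>(\<lambda>k. nat \<bar>k - K\<bar>) ` B. q ^ m)"
      by (simp add: sum.reindex that)
    also have "\<dots> \<le> (\<Sum>m. q ^ m)"
      using q that by (intro sum_le_suminf summable_geometric) auto
    also have "\<dots> = 1 / (1 - q)" using q by (simp add: suminf_geometric)
    finally show ?thesis .
  qed
  have "(\<Sum>k\<in>A. q ^ nat \<bar>k - K\<bar>) = (\<Sum>k\<in>A \<inter> {K..} \<union> A \<inter> {..<K}. q ^ nat \<bar>k - K\<bar>)"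
    by (intro sum.cong) auto
  also have "\<dots> = (\<Sum>k\<in>A \<inter> {K..}. q ^ nat \<bar>k - K\<bar>) + (\<Sum>k\<in>A \<inter> {..<K}. q ^ nat \<bar>k - K\<bar>)"
    using A by (intro sum.union_disjoint) auto
  also have "\<dots> \<le> 1 / (1 - q) + 1 / (1 - q)"
    using A by (intro add_mono half) (auto simp: inj_on_def)
  finally show ?thesis by simp
qed

text \<open>Interpolation between L1 and L-infinity: pointwise,
  \<open>u^p \<le> B^(p-1) u\<close>.\<close>

lemma nn_integral_powr_le:
  assumes "\<And>x. u x \<le> ennreal B" "B \<ge> 0" "(\<integral>\<^sup>+x. u x \<partial>M) \<le> ennreal D" "D \<ge> 0" "p > 1"
    and [measurable]: "u \<in> borel_measurable M"
  shows "(\<integral>\<^sup>+x. ennreal (enn2real (u x) powr p) \<partial>M) \<le> ennreal (B powr (p - 1) * D)"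
proof -
  have "(\<integral>\<^sup>+x. ennreal (enn2real (u x) powr p) \<partial>M) \<le> (\<integral>\<^sup>+x. ennreal (B powr (p - 1)) * u x \<partial>M)"
  proof (intro nn_integral_mono)
    fix x
    have le: "enn2real (u x) \<le> B"
      using assms(1)[of x] assms(2) by (intro enn2real_leI) auto
    have "u x \<noteq> \<infinity>" using assms(1)[of x] by (auto simp: top_unique)
    then have u: "u x = ennreal (enn2real (u x))" by (simp add: less_top)
    have "enn2real (u x) powr p = enn2real (u x) powr (p - 1) * enn2real (u x) powr 1"
      unfolding powr_add[symmetric] by simp
    also have "\<dots> \<le> B powr (p - 1) * enn2real (u x)"
      using le assms(5) by (auto intro!: mult_right_mono powr_mono2)
    finally have "ennreal (enn2real (u x) powr p) \<le> ennreal (B powr (p - 1)) * ennreal (enn2real (u x))"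
      by (simp add: ennreal_mult'[symmetric] ennreal_leI)
    then show "ennreal (enn2real (u x) powr p) \<le> ennreal (B powr (p - 1)) * u x"
      using u by simp
  qed
  also have "\<dots> \<le> ennreal (B powr (p - 1)) * ennreal D"
    by (subst nn_integral_cmult) (auto intro!: mult_left_mono assms)
  finally show ?thesis using assms by (simp add: ennreal_mult')
qed

text \<open>\<open>c powr p\<close> comes from the four bounds on \<open>u k\<close>, the power of 2
  from rounding the critical scale up to a power of 2, and \<open>c1\<close> from the mass bound
  used above that scale. The last factor is a two-sided geometric series whose ratio is the worse of
  the decay rates below and above.\<close>

definition mixed_const :: "nat \<Rightarrow> real \<Rightarrow> real \<Rightarrow> real \<Rightarrow> real" where
  "mixed_const n p c c1 = c powr p * (2 powr (real (n - 1) * (p - 1)) + c1)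
     * (2 / (1 - max (2 powr (- (real (n - 1) * (p - 1)))) (1/2)))"

text \<open>Below the scale \<open>(W / d)\<^bsup>1 / (n - 1)\<^esup>\<close> one interpolates between the mass of the gradient and the
  height of the function, above it between its mass and the height of the averaged gradient.\<close>

lemma mixed_norm_one_level:
  fixes u :: "int \<Rightarrow> 'a \<Rightarrow> ennreal" and n :: nat
  assumes n: "n \<ge> 2" and p: "p > 1" and V: "0 \<le> V" "V \<le> W" "W > 0" and d: "d > 0" and c: "c > 0" "c1 \<ge> 0"
    and I: "0 \<le> I" "I \<le> c1 * d * (W / d) powr (real n / (real n - 1))"
    and [measurable]: "\<And>k. u k \<in> borel_measurable M"
    and u1: "\<And>k. (\<integral>\<^sup>+x. u k x \<partial>M) \<le> ennreal (c * V)"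
    and u2: "\<And>k x. u k x \<le> ennreal (c / (2 powi k) ^ n * V)"
    and u3: "\<And>k. (\<integral>\<^sup>+x. u k x \<partial>M) \<le> ennreal (c / 2 powi k * I)"
    and u4: "\<And>k x. u k x \<le> ennreal (c / 2 powi k * d)"
    and A: "finite A"
  shows "(\<Sum>k\<in>A. ennreal ((2 powi k) powr (real n * (p - 1))) * (\<integral>\<^sup>+x. ennreal (enn2real (u k x) powr p) \<partial>M))
    \<le> ennreal (mixed_const n p c c1 * W powr p)"
proof -
  define N where "N = n - 1"
  have N: "N > 0" "real n = real N + 1" "n = Suc N" using n by (auto simp: N_def)
  define t where "t = W / d"
  have t: "t > 0" "W = d * t" using V d by (auto simp: t_def)
  \<comment> \<open>At the radius \<open>t powr (1 / N)\<close> both interpolation bounds are of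
    order \<open>W powr p\<close>; \<open>2 powi K\<close> is this radius rounded up.\<close>
  obtain K where K: "t \<le> (2 powi K) ^ N" "2 powi K \<le> 2 * t powr (1 / N)"
    by (rule dyadic_approx[OF t(1) N(1)])
  define R :: real where "R = 2 powi K"
  have R: "R > 0" by (simp add: R_def)
  define b where "b = real N * (p - 1)"
  have b: "b > 0" using N p by (simp add: b_def)
  define q where "q = max (2 powr (- b)) (1/2)"
  have q: "0 \<le> q" "q < 1" "2 powr (- b) \<le> q" "1/2 \<le> q"
    using b by (auto simp: q_def powr_less_one)
  define E where "E = c powr p * (2 powr b + c1) * W powr p"
  have E: "E \<ge> 0" using c by (simp add: E_def)
  have level: "ennreal ((2 powi k) powr (real n * (p - 1))) * (\<integral>\<^sup>+x. ennreal (enn2real (u k x) powr p) \<partial>M)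
     \<le> ennreal (E * q ^ nat \<bar>k - K\<bar>)" for k
  proof -
    define r :: real where "r = 2 powi k"
    have r: "r > 0" by (simp add: r_def)
    have rR: "r = R * 2 powr (of_int (k - K))"
    proof -
      have "2 powr (of_int (k - K)) = (2::real) powi (k - K)" by (rule powr_real_of_int') auto
      then show ?thesis by (simp add: r_def R_def power_int_add[symmetric])
    qed
    have bound: "\<exists>X. (\<integral>\<^sup>+x. ennreal (enn2real (u k x) powr p) \<partial>M) \<le> ennreal X \<and> X \<ge> 0
      \<and> r powr (real n * (p - 1)) * X \<le> E * q ^ nat \<bar>k - K\<bar>"
    proof (cases "k \<le> K")
      case True
      define X where "X = (c / r * d) powr (p - 1) * (c * V)"
      have "(\<integral>\<^sup>+x. ennreal (enn2real (u k x) powr p) \<partial>M) \<le> ennreal X"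
        unfolding X_def using u4[of k] u1[of k] c d r V p
        by (intro nn_integral_powr_le) (auto simp: r_def)
      moreover have "X \<ge> 0" using c V by (simp add: X_def)
      moreover have "r powr (real n * (p - 1)) * X \<le> E * q ^ nat \<bar>k - K\<bar>"
      proof -
        \<comment> \<open>The factor \<open>r powr (p - 1)\<close> cancels the radius in the height
          bound \<open>c / r * d\<close>. What remains is \<open>r powr b\<close> with
          \<open>b > 0\<close>, which decays as \<open>k\<close> goes down from
          \<open>K\<close>.\<close>
        have "r powr (real n * (p - 1)) = r powr b * r powr (p - 1)"
          unfolding powr_add[symmetric] N(2) b_def by (simp add: algebra_simps)
        then have "r powr (real n * (p - 1)) * X = c powr (p - 1) * c powr 1 * (d powr (p - 1) * V) * r powr b"
          using c d r by (simp add: X_def powr_mult powr_divide)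
        also have "c powr (p - 1) * c powr 1 = c powr p" unfolding powr_add[symmetric] by simp
        also have "r powr b = R powr b * 2 powr (b * of_int (k - K))"
          using R by (simp add: rR powr_mult powr_powr mult.commute)
        also have "2 powr (b * of_int (k - K)) = (2 powr (- b)) ^ nat \<bar>k - K\<bar>"
          using True by (simp add: powr_realpow[symmetric] powr_powr algebra_simps)
        also have "R powr b \<le> (2 * t powr (1 / N)) powr b"
          using K(2) R b by (intro powr_mono2) (auto simp: R_def)
        also have "\<dots> = 2 powr b * t powr (p - 1)"
          using t N by (simp add: powr_mult powr_powr b_def)
        finally have "r powr (real n * (p - 1)) * X
          \<le> c powr p * (d powr (p - 1) * V) * (2 powr b * t powr (p - 1) * (2 powr (- b)) ^ nat \<bar>k - K\<bar>)"
          using V by (simp add: mult_left_mono mult_right_mono)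
        also have "\<dots> \<le> c powr p * (d powr (p - 1) * W) * (2 powr b * t powr (p - 1) * q ^ nat \<bar>k - K\<bar>)"
          using V q by (intro mult_mono mult_left_mono power_mono) auto
        also have "\<dots> = c powr p * 2 powr b * (W powr 1 * W powr (p - 1)) * q ^ nat \<bar>k - K\<bar>"
          using t d V by (simp add: powr_mult)
        also have "W powr 1 * W powr (p - 1) = W powr p" unfolding powr_add[symmetric] by simp
        also have "c powr p * 2 powr b * W powr p * q ^ nat \<bar>k - K\<bar> \<le> E * q ^ nat \<bar>k - K\<bar>"
          using c q unfolding E_def by (intro mult_right_mono mult_left_mono) auto
        finally show ?thesis .
      qed
      ultimately show ?thesis by blast
    next
      case False
      define X where "X = (c / r ^ n * V) powr (p - 1) * (c / r * I)"
      have "(\<integral>\<^sup>+x. ennreal (enn2real (u k x) powr p) \<partial>M) \<le> ennreal X"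
        unfolding X_def using u2[of k] u3[of k] c d r V p I
        by (intro nn_integral_powr_le) (auto simp: r_def)
      moreover have "X \<ge> 0" using c V I r by (simp add: X_def)
      moreover have "r powr (real n * (p - 1)) * X \<le> E * q ^ nat \<bar>k - K\<bar>"
      proof -
        \<comment> \<open>Here the weight cancels the radius in the height bound
          \<open>c / r ^ n * V\<close> entirely, and the factor \<open>1 / r\<close> of the mass
          bound gives the decay above \<open>K\<close>.\<close>
        have "(r ^ n) powr (p - 1) = r powr (real n * (p - 1))"
          using r by (simp add: powr_realpow[symmetric] powr_powr)
        then have "r powr (real n * (p - 1)) * X = c powr (p - 1) * c powr 1 * V powr (p - 1) * I * (1 / r)"
          using c r V by (simp add: X_def powr_mult powr_divide)
        also have "c powr (p - 1) * c powr 1 = c powr p" unfolding powr_add[symmetric] by simp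
        also have "1 / r = 1 / R * (1/2) ^ nat \<bar>k - K\<bar>"
          using False by (simp add: rR powr_realpow[symmetric] power_one_over)
        also have "1 / R \<le> 1 / t powr (1 / N)"
        proof -
          have "t powr (1 / N) \<le> (R ^ N) powr (1 / N)"
            using K(1) t by (intro powr_mono2) (auto simp: R_def)
          also have "\<dots> = R" using R N by (simp add: powr_realpow[symmetric] powr_powr)
          finally show ?thesis using t by (intro divide_left_mono) (auto simp: R)
        qed
        finally have "r powr (real n * (p - 1)) * X
          \<le> c powr p * V powr (p - 1) * I * (1 / t powr (1 / N) * (1/2) ^ nat \<bar>k - K\<bar>)"
          using V I by (simp add: mult_left_mono mult_right_mono)
        also have "\<dots> \<le> c powr p * W powr (p - 1) * (c1 * d * t powr (real n / (real n - 1))) * (1 / t powr (1 / N) * q ^ nat \<bar>k - K\<bar>)"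
          using V I q p c d t unfolding t_def by (intro mult_mono mult_left_mono power_mono powr_mono2) auto
        \<comment> \<open>The exponent \<open>n / (n - 1)\<close> is \<open>1 / N + 1\<close>: the
          first part is absorbed by the critical radius, the second turns \<open>d\<close> into
          \<open>W = d * t\<close>.\<close>
        also have "t powr (real n / (real n - 1)) = t powr (1 / N) * t powr 1"
          unfolding powr_add[symmetric] N(2) using N(1) by (simp add: add_divide_distrib add.commute)
        also have "c powr p * W powr (p - 1) * (c1 * d * (t powr (1 / N) * t powr 1)) * (1 / t powr (1 / N) * q ^ nat \<bar>k - K\<bar>)
          = c powr p * c1 * (W powr (p - 1) * W powr 1) * q ^ nat \<bar>k - K\<bar>"
          using t V d by simp
        also have "W powr (p - 1) * W powr 1 = W powr p" unfolding powr_add[symmetric] by simp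
        also have "c powr p * c1 * W powr p * q ^ nat \<bar>k - K\<bar> \<le> E * q ^ nat \<bar>k - K\<bar>"
          using c q unfolding E_def by (intro mult_right_mono mult_left_mono) auto
        finally show ?thesis .
      qed
      ultimately show ?thesis by blast
    qed
    then obtain X where X: "(\<integral>\<^sup>+x. ennreal (enn2real (u k x) powr p) \<partial>M) \<le> ennreal X" "X \<ge> 0"
      "r powr (real n * (p - 1)) * X \<le> E * q ^ nat \<bar>k - K\<bar>" by blast
    have "ennreal (r powr (real n * (p - 1))) * (\<integral>\<^sup>+x. ennreal (enn2real (u k x) powr p) \<partial>M)
       \<le> ennreal (r powr (real n * (p - 1))) * ennreal X" by (intro mult_left_mono X) auto
    also have "\<dots> = ennreal (r powr (real n * (p - 1)) * X)" using X by (simp add: ennreal_mult')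
    also have "\<dots> \<le> ennreal (E * q ^ nat \<bar>k - K\<bar>)" by (intro ennreal_leI X)
    finally show ?thesis by (simp add: r_def)
  qed
  have "(\<Sum>k\<in>A. ennreal ((2 powi k) powr (real n * (p - 1))) * (\<integral>\<^sup>+x. ennreal (enn2real (u k x) powr p) \<partial>M))
    \<le> (\<Sum>k\<in>A. ennreal (E * q ^ nat \<bar>k - K\<bar>))" by (intro sum_mono level)
  also have "\<dots> = ennreal (E * (\<Sum>k\<in>A. q ^ nat \<bar>k - K\<bar>))"
    using E q by (subst sum_ennreal) (auto simp: sum_distrib_left)
  also have "\<dots> \<le> ennreal (E * (2 / (1 - q)))"
    using E q by (intro ennreal_leI mult_left_mono sum_geometric_int A) auto
  also have "E * (2 / (1 - q)) = mixed_const n p c c1 * W powr p"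
    unfolding E_def mixed_const_def q_def b_def N_def by simp
  finally show ?thesis .
qed

text \<open>Jensen's inequality for the p-th power at the points \<open>a j * T / W j\<close> with
  weights \<open>W j / T\<close>, where \<open>T\<close> is the sum of the remaining
  \<open>W j\<close>. Indices with \<open>a j = 0\<close> are removed beforehand so that all points
  are positive.\<close>

lemma powr_sum_le_weighted:
  fixes a W :: "'b \<Rightarrow> real"
  assumes A: "finite A" and a: "\<And>j. j \<in> A \<Longrightarrow> a j \<ge> 0" and W: "\<And>j. j \<in> A \<Longrightarrow> W j > 0"
    and S: "(\<Sum>j\<in>A. W j) \<le> S" and p: "p > 1"
  shows "(\<Sum>j\<in>A. a j) powr p \<le> S powr (p - 1) * (\<Sum>j\<in>A. W j powr (1 - p) * a j powr p)"
proof -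
  define B where "B = {j\<in>A. a j > 0}"
  have B: "finite B" "B \<subseteq> A" using A by (auto simp: B_def)
  have sumB: "(\<Sum>j\<in>A. a j) = (\<Sum>j\<in>B. a j)"
    using A a by (intro sum.mono_neutral_right) (auto simp: B_def order.order_iff_strict)
  show ?thesis
  proof (cases "B = {}")
    case True
    then show ?thesis using sumB A a W by (auto intro!: mult_nonneg_nonneg sum_nonneg)
  next
    case False
    define T where "T = (\<Sum>j\<in>B. W j)"
    have T: "T > 0" using False B W unfolding T_def by (intro sum_pos) auto
    have TS: "T \<le> S" unfolding T_def using sum_mono2[OF A B(2), of W] W S by (auto simp: order_less_imp_le)
    have "(\<Sum>j\<in>B. (W j / T) *\<^sub>R (a j * T / W j)) powr p \<le> (\<Sum>j\<in>B. W j / T * (a j * T / W j) powr p)"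
    proof (rule convex_on_sum[OF B(1) False powr_convex])
      show "(\<Sum>j\<in>B. W j / T) = 1" using T by (simp add: sum_divide_distrib[symmetric] T_def)
    qed (use p T W B in \<open>auto simp: B_def intro!: divide_nonneg_pos less_imp_le\<close>)
    also have "(\<Sum>j\<in>B. (W j / T) *\<^sub>R (a j * T / W j)) = (\<Sum>j\<in>B. a j)"
    proof (intro sum.cong refl)
      fix j assume "j \<in> B"
      then have "W j > 0" using W B by auto
      then show "(W j / T) *\<^sub>R (a j * T / W j) = a j" using T by simp
    qed
    also have "(\<Sum>j\<in>B. W j / T * (a j * T / W j) powr p) = (\<Sum>j\<in>B. T powr (p - 1) * (W j powr (1 - p) * a j powr p))"
    proof (intro sum.cong refl)
      fix j assume j: "j \<in> B"
      then have Wj: "W j > 0" "a j > 0" using W B by (auto simp: B_def)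
      then have "W j / T * (a j * T / W j) powr p = (T powr p / T powr 1) * (W j powr 1 / W j powr p * a j powr p)"
        using T by (simp add: powr_mult powr_divide)
      then show "W j / T * (a j * T / W j) powr p = T powr (p - 1) * (W j powr (1 - p) * a j powr p)"
        by (simp only: powr_diff)
    qed
    also have "\<dots> = T powr (p - 1) * (\<Sum>j\<in>B. W j powr (1 - p) * a j powr p)" by (simp add: sum_distrib_left)
    also have "\<dots> \<le> S powr (p - 1) * (\<Sum>j\<in>A. W j powr (1 - p) * a j powr p)"
      using T TS p A B by (intro mult_mono powr_mono2 sum_mono2) (auto intro!: sum_nonneg)
    finally show ?thesis by (simp add: sumB)
  qed
qed

section \<open>Maximal functions of families of dominated kernels\<close>

definition conv :: "('a::euclidean_space \<Rightarrow> real) \<Rightarrow> ('a \<Rightarrow> real) \<Rightarrow> 'a \<Rightarrow> real" where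
  "conv u f x = (LINT y|lborel. u (x - y) * f y)"

text \<open>The translation is moved onto \<open>f\<close>, and of the kernel only its size enters.
  This is the source of the bounds by the variation of \<open>f\<close>.\<close>

lemma nn_integral_abs_diff_le_nconv:
  fixes f :: "'a::euclidean_space \<Rightarrow> real"
  assumes int: "\<And>x. integrable lborel (\<lambda>y. k (x - y) * f y)"
    and [measurable]: "k \<in> borel_measurable borel" "f \<in> borel_measurable borel"
    and k: "\<And>x. ennreal \<bar>k x\<bar> \<le> \<Phi> x"
  shows "ennreal \<bar>conv k f (x + v) - conv k f x\<bar> \<le> nconv \<Phi> (\<lambda>y. ennreal \<bar>f (y + v) - f y\<bar>) x"
proof -
  have "integrable (distr lborel borel ((+) v)) (\<lambda>y. k (x + v - y) * f y)"
    by (simp add: lborel_distr_plus int)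
  then have int': "integrable lborel (\<lambda>y. k (x - y) * f (y + v))"
    by (subst (asm) integrable_distr_eq) (auto simp: add.commute)
  have "conv k f (x + v) = (LINT y|distr lborel borel ((+) v). k (x + v - y) * f y)"
    by (simp add: conv_def lborel_distr_plus)
  also have "\<dots> = (LINT y|lborel. k (x - y) * f (y + v))"
    by (subst integral_distr) (auto simp: add.commute)
  finally have eq: "conv k f (x + v) - conv k f x = (LINT y|lborel. k (x - y) * (f (y + v) - f y))"
    unfolding conv_def right_diff_distrib by (simp add: int int')
  have int2: "integrable lborel (\<lambda>y. k (x - y) * (f (y + v) - f y))"
    unfolding right_diff_distrib by (simp add: int int')
  have "ennreal \<bar>conv k f (x + v) - conv k f x\<bar> \<le> (\<integral>\<^sup>+y. ennreal (norm (k (x - y) * (f (y + v) - f y))) \<partial>lborel)"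
    unfolding eq real_norm_def[symmetric] by (rule integral_norm_bound_ennreal[OF int2])
  also have "\<dots> \<le> nconv \<Phi> (\<lambda>y. ennreal \<bar>f (y + v) - f y\<bar>) x"
    unfolding nconv_def using k by (intro nn_integral_mono) (auto simp: abs_mult ennreal_mult' intro!: mult_right_mono)
  finally show ?thesis .
qed

text \<open>The counterpart with the translation on the kernel: of \<open>f\<close> only its size
  enters.\<close>

lemma abs_diff_le_nconv_kernel:
  fixes f :: "'a::euclidean_space \<Rightarrow> real"
  assumes int: "\<And>x. integrable lborel (\<lambda>y. k (x - y) * f y)"
    and [measurable]: "k \<in> borel_measurable borel" "f \<in> borel_measurable borel" "\<Psi> \<in> borel_measurable borel"
    and k: "\<And>x. ennreal \<bar>k (x + v) - k x\<bar> \<le> ennreal (norm v) * \<Psi> x"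
  shows "ennreal \<bar>conv k f (x + v) - conv k f x\<bar> \<le> ennreal (norm v) * nconv \<Psi> (\<lambda>y. ennreal \<bar>f y\<bar>) x"
proof -
  have eq: "conv k f (x + v) - conv k f x = (LINT y|lborel. (k (x + v - y) - k (x - y)) * f y)"
    unfolding conv_def left_diff_distrib by (simp add: int)
  have int2: "integrable lborel (\<lambda>y. (k (x + v - y) - k (x - y)) * f y)"
    unfolding left_diff_distrib by (simp add: int)
  have "ennreal \<bar>conv k f (x + v) - conv k f x\<bar> \<le> (\<integral>\<^sup>+y. ennreal (norm ((k (x + v - y) - k (x - y)) * f y)) \<partial>lborel)"
    unfolding eq real_norm_def[symmetric] by (rule integral_norm_bound_ennreal[OF int2])
  also have "\<dots> \<le> (\<integral>\<^sup>+y. ennreal (norm v) * (\<Psi> (x - y) * ennreal \<bar>f y\<bar>) \<partial>lborel)"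
  proof (intro nn_integral_mono)
    fix y
    have e: "x + v - y = x - y + v" by simp
    have "ennreal \<bar>k (x + v - y) - k (x - y)\<bar> \<le> ennreal (norm v) * \<Psi> (x - y)"
      unfolding e by (rule k)
    from mult_right_mono[OF this, of "ennreal \<bar>f y\<bar>"]
    show "ennreal (norm ((k (x + v - y) - k (x - y)) * f y)) \<le> ennreal (norm v) * (\<Psi> (x - y) * ennreal \<bar>f y\<bar>)"
      by (simp add: abs_mult ennreal_mult' mult.assoc)
  qed
  also have "\<dots> = ennreal (norm v) * nconv \<Psi> (\<lambda>y. ennreal \<bar>f y\<bar>) x"
    unfolding nconv_def by (rule nn_integral_cmult) measurable
  finally show ?thesis .
qed

text \<open>The common frame for both maximal functions. \<open>\<kappa> b\<close> is the dyadic
  scale of \<open>K b\<close>; many kernels may share a scale, and \<open>\<Phi> k\<close> and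
  \<open>\<Psi> k v\<close> dominate all of them and all their difference quotients with step
  \<open>v\<close>. For \<open>\<Psi>\<close> only an L1 bound is asked, and it may depend on
  \<open>v\<close>: the difference quotients of the indicator of a ball have no integrable majorant
  uniform in \<open>v\<close>.\<close>

locale kernel_family =
  fixes S :: "'b set" and K :: "'b \<Rightarrow> 'a::euclidean_space \<Rightarrow> real" and \<kappa> :: "'b \<Rightarrow> int" and w :: "'b \<Rightarrow> real"
    and \<Phi> :: "int \<Rightarrow> 'a \<Rightarrow> ennreal" and \<Psi> :: "int \<Rightarrow> 'a \<Rightarrow> 'a \<Rightarrow> ennreal" and c \<alpha> :: real
  assumes dim: "DIM('a) \<ge> 2" and \<alpha>: "0 < \<alpha>" "\<alpha> < 1" and c: "c > 0"
    and K_measurable [measurable]: "\<And>b. K b \<in> borel_measurable borel"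
    and \<Phi>_measurable [measurable]: "\<And>k. \<Phi> k \<in> borel_measurable borel"
    and \<Psi>_measurable [measurable]: "\<And>k v. \<Psi> k v \<in> borel_measurable borel"
    and w_nonneg: "\<And>b. b \<in> S \<Longrightarrow> 0 \<le> w b"
    and w_le: "\<And>b. b \<in> S \<Longrightarrow> w b \<le> c * (2 powi \<kappa> b) powr \<alpha>"
    and K_le: "\<And>b x. b \<in> S \<Longrightarrow> ennreal \<bar>K b x\<bar> \<le> \<Phi> (\<kappa> b) x"
    and K_diff_le: "\<And>b x v. b \<in> S \<Longrightarrow> ennreal \<bar>K b (x + v) - K b x\<bar> \<le> ennreal (norm v) * \<Psi> (\<kappa> b) v x"
    and \<Phi>_integral: "\<And>k. (\<integral>\<^sup>+x. \<Phi> k x \<partial>lborel) \<le> ennreal c"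
    and \<Phi>_le: "\<And>k x. \<Phi> k x \<le> ennreal (c / (2 powi k) ^ DIM('a))"
    and \<Psi>_integral: "\<And>k v. (\<integral>\<^sup>+x. \<Psi> k v x \<partial>lborel) \<le> ennreal (c / 2 powi k)"
begin

section \<open>Measurability and local integrability of the maximal function\<close>

definition maxf :: "('a \<Rightarrow> real) \<Rightarrow> 'a \<Rightarrow> ennreal" where
  "maxf f x = (SUP b\<in>S. ennreal (w b * \<bar>conv (K b) f x\<bar>))"

text \<open>Mean value 0 at infinity in quantitative form: the estimate of
  \<open>mean_at_infinity\<close> with \<open>c = 0\<close>.\<close>

definition vanishing_mean :: "('a \<Rightarrow> real) \<Rightarrow> real \<Rightarrow> bool" where
  "vanishing_mean f V \<longleftrightarrow> loc_int f \<and> translation_var f V \<and> V \<ge> 0 \<and>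
    (\<forall>x k. \<bar>ball_avg (2 powi k) f x\<bar> \<le> avg_const TYPE('a) * (2 powi k / (2 powi k) ^ DIM('a) * V))"

text \<open>At scale \<open>2 powi k\<close>, \<open>f\<close> is a uniformly small average plus a
  deviation with L1 norm at most \<open>2 powi k * V\<close>. The average is paired with the
  integral of \<open>\<Phi> k\<close>, the deviation with its height.\<close>

lemma nconv_bound:
  assumes "vanishing_mean f V"
  shows "nconv (\<Phi> k) (\<lambda>y. ennreal \<bar>f y\<bar>) x
    \<le> ennreal (c * (1 + avg_const TYPE('a)) * (2 powi k / (2 powi k) ^ DIM('a) * V))"
proof -
  have f: "loc_int f" "translation_var f V" "V \<ge> 0"
    and avg: "\<And>x k. \<bar>ball_avg (2 powi k) f x\<bar> \<le> avg_const TYPE('a) * (2 powi k / (2 powi k) ^ DIM('a) * V)"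
    using assms by (auto simp: vanishing_mean_def)
  have [measurable]: "f \<in> borel_measurable borel" using f by measurable
  have [measurable]: "ball_avg r f \<in> borel_measurable borel" for r
    unfolding ball_avg_def by measurable
  define r :: real where "r = 2 powi k"
  have r: "r > 0" by (simp add: r_def)
  define D where "D = avg_const TYPE('a)"
  have D: "D > 0" by (simp add: D_def avg_const_pos)
  have "nconv (\<Phi> k) (\<lambda>y. ennreal \<bar>f y\<bar>) x
    \<le> nconv (\<Phi> k) (\<lambda>y. ennreal \<bar>ball_avg r f y - f y\<bar> + ennreal (D * (r / r ^ DIM('a) * V))) x"
  proof (intro nconv_mono order_refl)
    fix y
    have "\<bar>f y\<bar> \<le> \<bar>ball_avg r f y - f y\<bar> + D * (r / r ^ DIM('a) * V)"
      using avg[of k y] by (simp add: r_def D_def)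
    then show "ennreal \<bar>f y\<bar> \<le> ennreal \<bar>ball_avg r f y - f y\<bar> + ennreal (D * (r / r ^ DIM('a) * V))"
      using r D f by (simp add: ennreal_plus[symmetric] ennreal_leI del: ennreal_plus)
  qed
  also have "\<dots> = nconv (\<Phi> k) (\<lambda>y. ennreal \<bar>ball_avg r f y - f y\<bar>) x + nconv (\<Phi> k) (\<lambda>y. ennreal (D * (r / r ^ DIM('a) * V))) x"
    by (rule nconv_add_right) measurable
  also have "\<dots> \<le> ennreal (c / r ^ DIM('a)) * ennreal (r * V) + ennreal c * ennreal (D * (r / r ^ DIM('a) * V))"
  proof (intro add_mono)
    have "nconv (\<Phi> k) (\<lambda>y. ennreal \<bar>ball_avg r f y - f y\<bar>) x
      \<le> ennreal (c / r ^ DIM('a)) * (\<integral>\<^sup>+y. ennreal \<bar>ball_avg r f y - f y\<bar> \<partial>lborel)"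
      unfolding r_def by (intro nconv_le_left \<Phi>_le) measurable
    also have "\<dots> \<le> ennreal (c / r ^ DIM('a)) * ennreal (r * V)"
      by (intro mult_left_mono nn_integral_ball_avg_diff f r) auto
    finally show "nconv (\<Phi> k) (\<lambda>y. ennreal \<bar>ball_avg r f y - f y\<bar>) x \<le> ennreal (c / r ^ DIM('a)) * ennreal (r * V)" .
    have "nconv (\<Phi> k) (\<lambda>y. ennreal (D * (r / r ^ DIM('a) * V))) x \<le> (\<integral>\<^sup>+x. \<Phi> k x \<partial>lborel) * ennreal (D * (r / r ^ DIM('a) * V))"
      by (intro nconv_le_right) auto
    also have "\<dots> \<le> ennreal c * ennreal (D * (r / r ^ DIM('a) * V))" by (intro mult_right_mono \<Phi>_integral) auto
    finally show "nconv (\<Phi> k) (\<lambda>y. ennreal (D * (r / r ^ DIM('a) * V))) x \<le> ennreal c * ennreal (D * (r / r ^ DIM('a) * V))" .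
  qed
  also have "\<dots> = ennreal (c / r ^ DIM('a) * (r * V) + c * (D * (r / r ^ DIM('a) * V)))"
    using c r D f by (simp add: ennreal_mult'[symmetric] ennreal_plus[symmetric] del: ennreal_plus)
  also have "c / r ^ DIM('a) * (r * V) + c * (D * (r / r ^ DIM('a) * V)) = c * (1 + D) * (r / r ^ DIM('a) * V)"
    by (simp add: algebra_simps add_divide_distrib)
  finally show ?thesis by (simp add: r_def D_def)
qed

text \<open>Stated for every \<open>g\<close> dominated by \<open>f\<close>, so that it also serves
  the truncations of \<open>f\<close>.\<close>

lemma integrable_kernel_mult:
  assumes f: "vanishing_mean f V" and b: "b \<in> S"
    and [measurable]: "g \<in> borel_measurable borel" and g: "\<And>y. \<bar>g y\<bar> \<le> \<bar>f y\<bar>"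
  shows "integrable lborel (\<lambda>y. K b (x - y) * g y)"
proof (rule integrableI_bounded)
  have "(\<integral>\<^sup>+y. ennreal (norm (K b (x - y) * g y)) \<partial>lborel) \<le> nconv (\<Phi> (\<kappa> b)) (\<lambda>y. ennreal \<bar>f y\<bar>) x"
    unfolding nconv_def using K_le[OF b] g
    by (intro nn_integral_mono) (auto simp: abs_mult ennreal_mult' intro!: mult_mono ennreal_leI)
  also have "\<dots> < \<infinity>" using nconv_bound[OF f, of "\<kappa> b" x] by (auto simp: top.extremum_strict intro: le_less_trans)
  finally show "(\<integral>\<^sup>+y. ennreal (norm (K b (x - y) * g y)) \<partial>lborel) < \<infinity>" .
qed measurable

lemma abs_conv_le:
  assumes f: "vanishing_mean f V" and b: "b \<in> S"
  shows "ennreal \<bar>conv (K b) f x\<bar> \<le> nconv (\<Phi> (\<kappa> b)) (\<lambda>y. ennreal \<bar>f y\<bar>) x"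
proof -
  have [measurable]: "f \<in> borel_measurable borel" using f by (auto simp: vanishing_mean_def)
  have "ennreal \<bar>conv (K b) f x\<bar> \<le> (\<integral>\<^sup>+y. ennreal (norm (K b (x - y) * f y)) \<partial>lborel)"
    unfolding conv_def real_norm_def[symmetric]
    by (intro integral_norm_bound_ennreal integrable_kernel_mult[OF f b]) auto
  also have "\<dots> \<le> nconv (\<Phi> (\<kappa> b)) (\<lambda>y. ennreal \<bar>f y\<bar>) x"
    unfolding nconv_def using K_le[OF b]
    by (intro nn_integral_mono) (auto simp: abs_mult ennreal_mult' intro!: mult_mono ennreal_leI)
  finally show ?thesis .
qed

text \<open>\<open>\<Phi>\<close> is bounded and the increments of \<open>f\<close> are small in L1,
  so the convolution is even Lipschitz.\<close>

lemma continuous_conv: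
  assumes f: "vanishing_mean f V" and b: "b \<in> S"
  shows "continuous_on UNIV (conv (K b) f)"
proof -
  have fm: "f \<in> borel_measurable borel" and V: "V \<ge> 0" and tv: "translation_var f V"
    using f by (auto simp: vanishing_mean_def)
  note [measurable] = fm
  define L where "L = c / (2 powi \<kappa> b) ^ DIM('a) * V"
  have L: "L \<ge> 0" using c V by (simp add: L_def)
  have lip: "\<bar>conv (K b) f (x + v) - conv (K b) f x\<bar> \<le> L * norm v" for x v
  proof -
    have "ennreal \<bar>conv (K b) f (x + v) - conv (K b) f x\<bar> \<le> nconv (\<Phi> (\<kappa> b)) (\<lambda>y. ennreal \<bar>f (y + v) - f y\<bar>) x"
      by (intro nn_integral_abs_diff_le_nconv integrable_kernel_mult[OF f b] K_le b) auto
    also have "\<dots> \<le> ennreal (c / (2 powi \<kappa> b) ^ DIM('a)) * (\<integral>\<^sup>+y. ennreal \<bar>f (y + v) - f y\<bar> \<partial>lborel)"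
      by (intro nconv_le_left \<Phi>_le) measurable
    also have "\<dots> \<le> ennreal (c / (2 powi \<kappa> b) ^ DIM('a)) * ennreal (norm v * V)"
      by (intro mult_left_mono translation_varD[OF tv]) auto
    also have "\<dots> = ennreal (L * norm v)"
      using c V by (simp add: ennreal_mult'[symmetric] L_def mult_ac)
    finally show ?thesis using L by (subst (asm) ennreal_le_iff) auto
  qed
  have "lipschitz_on L UNIV (conv (K b) f)"
  proof (rule lipschitz_onI[OF _ L])
    fix x y
    show "dist (conv (K b) f x) (conv (K b) f y) \<le> L * dist x y"
      using lip[of y "x - y"] by (simp add: dist_norm)
  qed
  then show ?thesis by (rule lipschitz_on_continuous_on)
qed

text \<open>\<open>S\<close> may be uncountable; but the superlevel sets are unions of open sets,
  that is, \<open>maxf f\<close> is lower semicontinuous.\<close>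

lemma borel_measurable_maxf:
  assumes f: "vanishing_mean f V"
  shows "maxf f \<in> borel_measurable borel"
proof (rule borel_measurableI_greater)
  fix y
  have "{x \<in> space borel. y < maxf f x} = (\<Union>b\<in>S. {x. y < ennreal (w b * \<bar>conv (K b) f x\<bar>)})"
    by (auto simp: maxf_def less_SUP_iff)
  moreover have "open {x. y < ennreal (w b * \<bar>conv (K b) f x\<bar>)}" if "b \<in> S" for b
    using continuous_conv[OF f that]
    by (intro open_Collect_less continuous_on_const continuous_on_ennreal continuous_intros)
  ultimately have "open {x \<in> space borel. y < maxf f x}" by (simp add: open_UN)
  then show "{x \<in> space borel. y < maxf f x} \<in> sets borel" by (rule borel_open)
qed

text \<open>Scales \<open>k \<ge> 0\<close> contribute a bounded amount, because
  \<open>r powr \<alpha> * (r / r ^ n) \<le> 1\<close> for \<open>r \<ge> 1\<close>. At smaller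
  scales \<open>f\<close> is split into its average over unit balls, which is bounded, and an
  integrable remainder \<open>h\<close>; the weights \<open>q ^ m\<close> with \<open>q < 1\<close>
  make the sum of the convolutions of \<open>h\<close> integrable.\<close>

lemma maxf_le_integrable:
  assumes f: "vanishing_mean f V"
  obtains A :: real and B where "A \<ge> 0" "B \<in> borel_measurable borel" "(\<integral>\<^sup>+x. B x \<partial>lborel) < \<infinity>"
    "\<And>x. maxf f x \<le> ennreal A + B x"
proof -
  have fm: "f \<in> borel_measurable borel" and V: "V \<ge> 0" and tv: "translation_var f V" and li: "loc_int f"
    and avg: "\<And>x k. \<bar>ball_avg (2 powi k) f x\<bar> \<le> avg_const TYPE('a) * (2 powi k / (2 powi k) ^ DIM('a) * V)"
    using f by (auto simp: vanishing_mean_def)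
  note [measurable] = fm
  have [measurable]: "ball_avg r f \<in> borel_measurable borel" for r
    unfolding ball_avg_def by measurable
  define D where "D = avg_const TYPE('a)"
  have D: "D > 0" by (simp add: D_def avg_const_pos)
  define h where "h y = ennreal \<bar>ball_avg 1 f y - f y\<bar>" for y
  have [measurable]: "h \<in> borel_measurable borel" unfolding h_def by measurable
  have hint: "(\<integral>\<^sup>+y. h y \<partial>lborel) \<le> ennreal V"
    unfolding h_def using nn_integral_ball_avg_diff[OF li tv, of 1] V by simp
  define A where "A = c * (c * (1 + D) * V)"
  define q where "q = 2 powr (- \<alpha>)"
  have q: "0 < q" "q < 1" using \<alpha> by (auto simp: q_def powr_less_one)
  define B where "B x = (\<Sum>m. ennreal (c * q ^ m) * nconv (\<Phi> (- int m)) h x)" for x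
  have [measurable]: "B \<in> borel_measurable borel" unfolding B_def by measurable
  have "(\<integral>\<^sup>+x. B x \<partial>lborel) = (\<Sum>m. \<integral>\<^sup>+x. ennreal (c * q ^ m) * nconv (\<Phi> (- int m)) h x \<partial>lborel)"
    unfolding B_def by (rule nn_integral_suminf) measurable
  also have "\<dots> \<le> (\<Sum>m. ennreal (c * q ^ m * (c * V)))"
  proof (intro suminf_le summableI)
    fix m
    have "(\<integral>\<^sup>+x. ennreal (c * q ^ m) * nconv (\<Phi> (- int m)) h x \<partial>lborel)
      = ennreal (c * q ^ m) * ((\<integral>\<^sup>+x. \<Phi> (- int m) x \<partial>lborel) * (\<integral>\<^sup>+y. h y \<partial>lborel))"
      by (simp add: nn_integral_cmult nn_integral_nconv)
    also have "\<dots> \<le> ennreal (c * q ^ m) * (ennreal c * ennreal V)"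
      by (intro mult_left_mono mult_mono \<Phi>_integral hint) auto
    also have "\<dots> = ennreal (c * q ^ m * (c * V))" using c q V by (simp add: ennreal_mult'[symmetric])
    finally show "(\<integral>\<^sup>+x. ennreal (c * q ^ m) * nconv (\<Phi> (- int m)) h x \<partial>lborel) \<le> ennreal (c * q ^ m * (c * V))" .
  qed
  also have "\<dots> = ennreal (\<Sum>m. c * q ^ m * (c * V))"
    using c q V by (intro suminf_ennreal2 summable_mult summable_mult2 summable_geometric) auto
  also have "\<dots> < \<infinity>" by simp
  finally have Bint: "(\<integral>\<^sup>+x. B x \<partial>lborel) < \<infinity>" .
  have main: "ennreal (w b * \<bar>conv (K b) f x\<bar>) \<le> ennreal A + B x" if b: "b \<in> S" for b x
  proof -
    define k where "k = \<kappa> b"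
    define r :: real where "r = 2 powi k"
    have r: "r > 0" by (simp add: r_def)
    have w: "ennreal (w b * \<bar>conv (K b) f x\<bar>) \<le> ennreal (c * r powr \<alpha>) * ennreal \<bar>conv (K b) f x\<bar>"
      using w_le[OF b] w_nonneg[OF b] c
      by (subst ennreal_mult'[symmetric]) (auto simp: r_def k_def intro!: ennreal_leI mult_right_mono)
    also have "\<dots> \<le> ennreal (c * r powr \<alpha>) * nconv (\<Phi> k) (\<lambda>y. ennreal \<bar>f y\<bar>) x"
      unfolding k_def by (intro mult_left_mono abs_conv_le[OF f b]) auto
    finally have le: "ennreal (w b * \<bar>conv (K b) f x\<bar>) \<le> ennreal (c * r powr \<alpha>) * nconv (\<Phi> k) (\<lambda>y. ennreal \<bar>f y\<bar>) x" .
    show ?thesis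
    proof (cases "k \<ge> 0")
      case True
      then have r1: "r \<ge> 1" by (simp add: r_def)
      have "r powr \<alpha> * (r / r ^ DIM('a)) \<le> 1"
      proof -
        have "r powr \<alpha> \<le> r powr 1" using r1 \<alpha> by (intro powr_mono) auto
        then have "r powr \<alpha> * r \<le> r ^ 2" using r by (simp add: power2_eq_square)
        also have "\<dots> \<le> r ^ DIM('a)" using r1 dim by (intro power_increasing) auto
        finally show ?thesis using r by simp
      qed
      then have "c * (c * (1 + D)) * V * (r powr \<alpha> * (r / r ^ DIM('a))) \<le> c * (c * (1 + D)) * V * 1"
        using c D V by (intro mult_left_mono) auto
      then have A: "c * r powr \<alpha> * (c * (1 + D) * (r / r ^ DIM('a) * V)) \<le> A"
        by (simp add: A_def mult_ac)
      have "ennreal (c * r powr \<alpha>) * nconv (\<Phi> k) (\<lambda>y. ennreal \<bar>f y\<bar>) x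
        \<le> ennreal (c * r powr \<alpha>) * ennreal (c * (1 + D) * (r / r ^ DIM('a) * V))"
        unfolding r_def D_def by (intro mult_left_mono nconv_bound[OF f]) auto
      also have "\<dots> = ennreal (c * r powr \<alpha> * (c * (1 + D) * (r / r ^ DIM('a) * V)))"
        using c r by (subst ennreal_mult'[symmetric]) auto
      also have "\<dots> \<le> ennreal A" by (intro ennreal_leI A)
      also have "\<dots> \<le> ennreal A + B x" by simp
      finally show ?thesis using le by (rule order_trans[rotated])
    next
      case False
      define m where "m = nat (- k)"
      have km: "k = - int m" using False by (simp add: m_def)
      have rq: "r powr \<alpha> = q ^ m"
        by (simp add: r_def km q_def power_int_minus powr_realpow[symmetric] powr_powr powr_minus[symmetric] mult.commute)
      have "nconv (\<Phi> k) (\<lambda>y. ennreal \<bar>f y\<bar>) x \<le> nconv (\<Phi> k) (\<lambda>y. h y + ennreal (D * V)) x"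
      proof (intro nconv_mono order_refl)
        fix y
        have "\<bar>f y\<bar> \<le> \<bar>ball_avg 1 f y - f y\<bar> + D * V" using avg[of 0 y] by (simp add: D_def)
        then show "ennreal \<bar>f y\<bar> \<le> h y + ennreal (D * V)"
          using D V by (simp add: h_def ennreal_plus[symmetric] ennreal_leI del: ennreal_plus)
      qed
      also have "\<dots> = nconv (\<Phi> k) h x + nconv (\<Phi> k) (\<lambda>y. ennreal (D * V)) x"
        by (rule nconv_add_right) measurable
      also have "nconv (\<Phi> k) (\<lambda>y. ennreal (D * V)) x \<le> (\<integral>\<^sup>+x. \<Phi> k x \<partial>lborel) * ennreal (D * V)"
        by (intro nconv_le_right) auto
      also have "\<dots> \<le> ennreal c * ennreal (D * V)" by (intro mult_right_mono \<Phi>_integral) auto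
      also have "\<dots> = ennreal (c * (D * V))" using c D V by (simp add: ennreal_mult')
      finally have "ennreal (c * r powr \<alpha>) * nconv (\<Phi> k) (\<lambda>y. ennreal \<bar>f y\<bar>) x
        \<le> ennreal (c * r powr \<alpha>) * (nconv (\<Phi> k) h x + ennreal (c * (D * V)))"
        by (intro mult_left_mono) (auto simp: add_left_mono)
      also have "\<dots> = ennreal (c * q ^ m) * nconv (\<Phi> (- int m)) h x + ennreal (c * q ^ m * (c * (D * V)))"
        using c q D V by (simp add: rq distrib_left ennreal_mult' km)
      also have "\<dots> \<le> B x + ennreal A"
      proof (intro add_mono)
        have "(\<Sum>i\<in>{m}. ennreal (c * q ^ i) * nconv (\<Phi> (- int i)) h x) \<le> B x"
          unfolding B_def by (intro sum_le_suminf) auto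
        then show "ennreal (c * q ^ m) * nconv (\<Phi> (- int m)) h x \<le> B x" by simp
        have "c * q ^ m * (c * (D * V)) \<le> c * 1 * (c * ((1 + D) * V))"
          using c D V q by (intro mult_mono power_le_one) auto
        then show "ennreal (c * q ^ m * (c * (D * V))) \<le> ennreal A"
          by (intro ennreal_leI) (simp add: A_def mult_ac)
      qed
      finally have "ennreal (c * r powr \<alpha>) * nconv (\<Phi> k) (\<lambda>y. ennreal \<bar>f y\<bar>) x \<le> ennreal A + B x"
        by (simp add: add.commute)
      then show ?thesis using le by (rule order_trans[rotated])
    qed
  qed
  show thesis
  proof (rule that)
    show "A \<ge> 0" using c D V by (simp add: A_def)
    show "maxf f x \<le> ennreal A + B x" for x unfolding maxf_def by (intro SUP_least main)
  qed (use Bint in auto)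
qed

text \<open>Write \<open>f = g + a\<close> with \<open>a\<close> the mean value at infinity. Then
  \<open>a\<close> times the integral of \<open>K (b m)\<close> equals
  \<open>conv (K (b m)) f x0 - conv (K (b m)) g x0\<close>. The first term is at most
  \<open>maxf f x0 / w (b m)\<close>, the second decays because \<open>g\<close> has mean value 0.
  Both tend to 0 while the integrals stay at least \<open>\<delta>\<close> in absolute value, so
  \<open>a = 0\<close>. This is where finiteness at a single point enters.\<close>

lemma vanishing_meanI:
  assumes f: "loc_int f" "translation_var f V" "V \<ge> 0" and fin: "maxf f x0 < \<infinity>" and \<delta>: "\<delta> > 0"
    and b: "\<And>m. b m \<in> S" "\<And>m. \<kappa> (b m) = int m" "\<And>m. w (b m) \<ge> \<delta> * 2 powr (\<alpha> * real m)"
    and Kint: "\<And>m. \<bar>LINT x|lborel. K (b m) x\<bar> \<ge> \<delta>"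
  shows "vanishing_mean f V"
proof -
  have fm [measurable]: "f \<in> borel_measurable borel" using f by measurable
  obtain a where a: "\<And>x k. \<bar>ball_avg (2 powi k) f x - a\<bar> \<le> avg_const TYPE('a) * (2 powi k / (2 powi k) ^ DIM('a) * V)"
    using mean_at_infinity[OF f dim] by metis
  define g where "g y = f y - a" for y
  have gm [measurable]: "g \<in> borel_measurable borel" unfolding g_def by measurable
  have gi: "loc_int g"
    unfolding loc_int_def
  proof
    fix r
    have "integrable lborel (\<lambda>y::'a. indicator (ball 0 r) y * a)" by (simp add: emeasure_vball)
    then have "integrable lborel (\<lambda>y. indicator (ball 0 r) y * f y - indicator (ball 0 r) y * a)"
      using f(1) by (intro Bochner_Integration.integrable_diff) (auto simp: loc_int_def)
    then show "integrable lborel (\<lambda>y. indicator (ball 0 r) y * g y)" by (simp add: g_def right_diff_distrib)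
  qed
  have gavg: "ball_avg (2 powi k) g x = ball_avg (2 powi k) f x - a" for k x
  proof -
    have "(LINT y|lborel. indicator (ball 0 (2 powi k)) y * g (x + y))
      = (LINT y|lborel. indicator (ball 0 (2 powi k)) y * f (x + y) - indicator (ball 0 (2 powi k)) y * a)"
      by (simp add: g_def right_diff_distrib)
    also have "\<dots> = (LINT y|lborel. indicator (ball 0 (2 powi k)) y * f (x + y)) - vball TYPE('a) (2 powi k) * a"
      by (subst Bochner_Integration.integral_diff) (auto simp: loc_int_translate[OF f(1)] emeasure_vball vball_def)
    finally have e: "(LINT y|lborel. indicator (ball 0 (2 powi k)) y * g (x + y))
      = (LINT y|lborel. indicator (ball 0 (2 powi k)) y * f (x + y)) - vball TYPE('a) (2 powi k) * a" .
    have "0 < vball TYPE('a) (2 powi k)" by (rule vball_pos) simp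
    then have "vball TYPE('a) (2 powi k) \<noteq> 0" by (rule less_imp_neq[symmetric])
    then show ?thesis unfolding ball_avg_def e diff_divide_distrib by simp
  qed
  have g: "vanishing_mean g V"
    unfolding vanishing_mean_def using f gi a gavg by (auto simp: translation_var_def g_def)
  obtain F0 where F0: "maxf f x0 = ennreal F0" "F0 \<ge> 0" using fin by (cases "maxf f x0") auto
  define D where "D = c * (1 + avg_const TYPE('a)) * V"
  have D0: "D \<ge> 0" using c f(3) avg_const_pos[where 'a='a] by (simp add: D_def)
  have bound: "\<bar>a\<bar> * \<delta> \<le> F0 / \<delta> * (2 powr (- \<alpha>)) ^ m + D * (1/2) ^ m" for m
  proof -
    define r :: real where "r = 2 powi (int m)"
    have r: "r \<ge> 1" "r = 2 ^ m" by (auto simp: r_def)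
    have Ki: "integrable lborel (K (b m))"
    proof (rule integrableI_bounded)
      have "(\<integral>\<^sup>+x. ennreal (norm (K (b m) x)) \<partial>lborel) \<le> (\<integral>\<^sup>+x. \<Phi> (\<kappa> (b m)) x \<partial>lborel)"
        using K_le[OF b(1)] by (intro nn_integral_mono) auto
      also have "\<dots> < \<infinity>" by (rule le_less_trans[OF \<Phi>_integral]) simp
      finally show "(\<integral>\<^sup>+x. ennreal (norm (K (b m) x)) \<partial>lborel) < \<infinity>" .
    qed measurable
    note Ki' = integral_kernel_reflect(1)[OF Ki, of x0] and Ke = integral_kernel_reflect(2)[OF Ki, of x0]
    have gK: "integrable lborel (\<lambda>y. K (b m) (x0 - y) * g y)"
      by (intro integrable_kernel_mult[OF g b(1)]) auto
    have "conv (K (b m)) f x0 = (LINT y|lborel. K (b m) (x0 - y) * g y + K (b m) (x0 - y) * a)"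
      by (simp add: conv_def g_def algebra_simps)
    also have "\<dots> = conv (K (b m)) g x0 + (LINT y|lborel. K (b m) y) * a"
      using gK Ki' by (simp add: conv_def Ke)
    finally have eq: "(LINT y|lborel. K (b m) y) * a = conv (K (b m)) f x0 - conv (K (b m)) g x0" by simp
    have 1: "\<bar>conv (K (b m)) f x0\<bar> \<le> F0 / \<delta> * (2 powr (- \<alpha>)) ^ m"
    proof -
      have "ennreal (w (b m) * \<bar>conv (K (b m)) f x0\<bar>) \<le> ennreal F0"
        unfolding F0(1)[symmetric] maxf_def by (intro SUP_upper b)
      then have "w (b m) * \<bar>conv (K (b m)) f x0\<bar> \<le> F0" using F0 by simp
      moreover have "\<delta> * 2 powr (\<alpha> * real m) * \<bar>conv (K (b m)) f x0\<bar> \<le> w (b m) * \<bar>conv (K (b m)) f x0\<bar>"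
        by (intro mult_right_mono b) auto
      ultimately have "\<delta> * 2 powr (\<alpha> * real m) * \<bar>conv (K (b m)) f x0\<bar> \<le> F0" by simp
      then have "\<bar>conv (K (b m)) f x0\<bar> \<le> F0 / (\<delta> * 2 powr (\<alpha> * real m))"
        using \<delta> by (simp add: pos_le_divide_eq mult.commute)
      also have "\<dots> = F0 / \<delta> * (2 powr (- \<alpha>)) ^ m"
      proof -
        have "(2 powr (- \<alpha>)) ^ m = 2 powr (- (\<alpha> * real m))"
          by (simp add: powr_realpow[symmetric] powr_powr)
        then show ?thesis by (simp add: powr_minus_divide)
      qed
      finally show ?thesis .
    qed
    have 2: "\<bar>conv (K (b m)) g x0\<bar> \<le> D * (1/2) ^ m"
    proof -
      have "ennreal \<bar>conv (K (b m)) g x0\<bar> \<le> ennreal (c * (1 + avg_const TYPE('a)) * (r / r ^ DIM('a) * V))"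
        using order_trans[OF abs_conv_le[OF g b(1)] nconv_bound[OF g]] unfolding b(2) r_def .
      then have "\<bar>conv (K (b m)) g x0\<bar> \<le> c * (1 + avg_const TYPE('a)) * (r / r ^ DIM('a) * V)"
        using c f(3) avg_const_pos[where 'a='a] r by (subst (asm) ennreal_le_iff) auto
      also have "\<dots> = D * (r / r ^ DIM('a))" by (simp add: D_def)
      also have "r / r ^ DIM('a) \<le> 1 / r"
      proof -
        have "r * r \<le> r ^ DIM('a)" using power_increasing[OF dim r(1)] by (simp add: power2_eq_square)
        then show ?thesis using r(1) by (simp add: divide_simps)
      qed
      finally show ?thesis using D0 r by (simp add: power_one_over mult_left_mono)
    qed
    have "\<bar>a\<bar> * \<delta> \<le> \<bar>a\<bar> * \<bar>LINT x|lborel. K (b m) x\<bar>" by (intro mult_left_mono Kint) auto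
    also have "\<dots> = \<bar>conv (K (b m)) f x0 - conv (K (b m)) g x0\<bar>" by (simp add: eq[symmetric] abs_mult)
    finally show ?thesis using 1 2 by linarith
  qed
  have "\<bar>a\<bar> * \<delta> \<le> 0"
  proof (rule LIMSEQ_le_const)
    have "2 powr (- \<alpha>) < 1" using \<alpha> by (simp add: powr_less_one)
    then show "(\<lambda>m. F0 / \<delta> * (2 powr (- \<alpha>)) ^ m + D * (1/2) ^ m) \<longlonglongrightarrow> 0"
      by (intro tendsto_add_zero tendsto_mult_right_zero LIMSEQ_realpow_zero) auto
  qed (use bound in auto)
  then have "a = 0" using \<delta> by (simp add: mult_le_0_iff)
  then have "g = f" by (simp add: g_def fun_eq_iff)
  with g show ?thesis by simp
qed

end

lemma translation_var_mono:
  "translation_var g V \<Longrightarrow> V \<le> W \<Longrightarrow> translation_var g W"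
  unfolding translation_var_def
  by (auto intro: order_trans intro!: ennreal_leI mult_left_mono)

lemma nn_integral_trunc_le_emeasure:
  fixes f :: "'a::euclidean_space \<Rightarrow> real"
  assumes [measurable]: "f \<in> borel_measurable borel"
  shows "(\<integral>\<^sup>+x. ennreal \<bar>trunc j (f x)\<bar> \<partial>lborel) \<le> ennreal (2 powi j) * emeasure lborel {x. \<bar>f x\<bar> \<ge> 2 powi j}"
proof -
  have "(\<integral>\<^sup>+x. ennreal \<bar>trunc j (f x)\<bar> \<partial>lborel) \<le> (\<integral>\<^sup>+x. ennreal (2 powi j) * indicator {x. \<bar>f x\<bar> \<ge> 2 powi j} x \<partial>lborel)"
    using abs_trunc_le[of j] trunc_eq_0[of _ j]
    by (intro nn_integral_mono) (auto simp: indicator_def not_le intro!: ennreal_leI)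
  also have "\<dots> = ennreal (2 powi j) * emeasure lborel {x. \<bar>f x\<bar> \<ge> 2 powi j}"
    by (rule nn_integral_cmult_indicator) measurable
  finally show ?thesis .
qed

section \<open>Difference quotients of the maximal function\<close>

context kernel_family
begin

lemma trunc_integrable:
  assumes f: "vanishing_mean f V"
  shows "integrable lborel (\<lambda>x. trunc j (f x))"
proof -
  have V: "V \<ge> 0" and tv: "translation_var f V" and li: "loc_int f"
    and avg: "\<And>x k. \<bar>ball_avg (2 powi k) f x\<bar> \<le> avg_const TYPE('a) * (2 powi k / (2 powi k) ^ DIM('a) * V)"
    using f by (auto simp: vanishing_mean_def)
  have [measurable]: "f \<in> borel_measurable borel" using tv by measurable
  \<comment> \<open>\<open>weak_type_sobolev\<close> asks for a positive variation bound, so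
    \<open>V + 1\<close> replaces \<open>V\<close>; only finiteness is wanted.\<close>
  have avg1: "\<bar>ball_avg (2 powi k) f x\<bar> \<le> avg_const TYPE('a) * (2 powi k / (2 powi k) ^ DIM('a) * (V + 1))" for x k
    by (rule order_trans[OF avg]) (intro mult_left_mono less_imp_le[OF avg_const_pos]; simp)
  have tv1: "translation_var f (V + 1)" by (rule translation_var_mono[OF tv]) simp
  have "emeasure lborel {x. \<bar>f x\<bar> \<ge> 2 powi j} < \<infinity>"
    by (rule le_less_trans[OF weak_type_sobolev[OF li tv1 _ dim _ avg1]]) (use V in auto)
  then have "(\<integral>\<^sup>+x. ennreal \<bar>trunc j (f x)\<bar> \<partial>lborel) < \<infinity>"
    by (intro le_less_trans[OF nn_integral_trunc_le_emeasure]) (auto simp: ennreal_mult_less_top)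
  then show ?thesis by (intro integrableI_bounded) auto
qed

text \<open>The constant of \<open>weak_type_sobolev\<close>; the last power of 2 accounts for
  writing the level \<open>2 powi (j - 1)\<close> in terms of \<open>2 powi j\<close>.\<close>

definition trunc_const :: real where
  "trunc_const = 4 * (2 * avg_const TYPE('a)) powr (1 / (real DIM('a) - 1)) * 2 powr (real DIM('a) / (real DIM('a) - 1))"

text \<open>\<open>trunc j (f x)\<close> is nonzero only where
  \<open>\<bar>f x\<bar> \<ge> 2 powi j\<close>, and there \<open>trunc (j - 1) (f x)\<close> has
  its full height \<open>2 powi (j - 1)\<close>. So the relevant set is a level set of the lower
  truncation, and its measure is bounded by the variation \<open>W\<close> of that truncation alone
  instead of the whole variation of \<open>f\<close>.\<close>

lemma nn_integral_trunc_le: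
  assumes f: "vanishing_mean f V" and W: "translation_var (\<lambda>x. trunc (j - 1) (f x)) W" "W > 0"
  shows "(\<integral>\<^sup>+x. ennreal \<bar>trunc j (f x)\<bar> \<partial>lborel)
    \<le> ennreal (trunc_const * 2 powi j * (W / 2 powi j) powr (real DIM('a) / (real DIM('a) - 1)))"
proof -
  have tv: "translation_var f V" using f by (auto simp: vanishing_mean_def)
  have [measurable]: "f \<in> borel_measurable borel" using tv by measurable
  define g where "g x = trunc (j - 1) (f x)" for x
  have gi: "integrable lborel g" unfolding g_def by (rule trunc_integrable[OF f])
  have gl: "loc_int g"
    unfolding loc_int_def using integrable_mult_indicator[OF _ gi] by auto
  have gW: "translation_var g W" using W(1) unfolding g_def[abs_def] .
  define e where "e = real DIM('a) / (real DIM('a) - 1)"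
  have Wl: "W / 2 powi (j - 1) = 2 * (W / 2 powi j)" using powi_Suc2[of "j - 1"] by simp
  have "emeasure lborel {x. \<bar>f x\<bar> \<ge> 2 powi j} \<le> emeasure lborel {x. \<bar>g x\<bar> \<ge> 2 powi (j - 1)}"
    using abs_trunc_large[of "j - 1"] unfolding g_def by (intro emeasure_mono) auto
  also have "\<dots> \<le> ennreal (4 * (2 * avg_const TYPE('a)) powr (1 / (real DIM('a) - 1)) * (W / 2 powi (j - 1)) powr e)"
    unfolding e_def using W(2)
    by (intro weak_type_sobolev[OF gl gW W(2) dim] mean_at_infinity_zero[OF gW gi _ dim]) auto
  also have "4 * (2 * avg_const TYPE('a)) powr (1 / (real DIM('a) - 1)) * (W / 2 powi (j - 1)) powr e
     = trunc_const * (W / 2 powi j) powr e"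
  proof -
    have "(2 * (W / 2 powi j)) powr e = 2 powr e * (W / 2 powi j) powr e"
      by (rule powr_mult)
    then show ?thesis unfolding Wl trunc_const_def e_def[symmetric] by (simp only: mult.assoc)
  qed
  finally have "ennreal (2 powi j) * emeasure lborel {x. \<bar>f x\<bar> \<ge> 2 powi j} \<le> ennreal (2 powi j) * ennreal (trunc_const * (W / 2 powi j) powr e)"
    by (rule mult_left_mono) simp
  also have "\<dots> = ennreal (trunc_const * 2 powi j * (W / 2 powi j) powr e)"
    by (subst ennreal_mult'[symmetric]) (auto simp: mult_ac)
  finally show ?thesis
    using order_trans[OF nn_integral_trunc_le_emeasure[of f j]] by (simp add: e_def)
qed

definition \<mu> :: "real" where "\<mu> = real DIM('a) / (real DIM('a) - \<alpha>)"

lemma \<mu>_gt_1: "\<mu> > 1"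
  using dim \<alpha> by (auto simp: \<mu>_def field_simps)

text \<open>The scaling identity that turns the weight \<open>(2 powi k) powr \<alpha>\<close>,
  raised to the power \<open>\<mu>\<close>, into the weight of
  \<open>mixed_norm_one_level\<close>.\<close>

lemma \<mu>_scaling: "\<alpha> * \<mu> = real DIM('a) * (\<mu> - 1)"
  using dim \<alpha> by (auto simp: \<mu>_def field_simps)

definition diff_const :: real where
  "diff_const = c powr \<mu> * mixed_const DIM('a) \<mu> c trunc_const"

lemma trunc_const_nonneg: "trunc_const \<ge> 0"
  by (simp add: trunc_const_def)

lemma mixed_const_nonneg: "mixed_const DIM('a) \<mu> c trunc_const \<ge> 0"
proof -
  have "real (DIM('a) - 1) * (\<mu> - 1) > 0" using dim \<mu>_gt_1 by simp
  then have "2 powr (- (real (DIM('a) - 1) * (\<mu> - 1))) \<le> 2 powr 0" by (intro powr_mono) auto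
  then show ?thesis unfolding mixed_const_def using trunc_const_nonneg
    by (intro mult_nonneg_nonneg divide_nonneg_nonneg) auto
qed

lemma diff_const_nonneg: "diff_const \<ge> 0"
  using mixed_const_nonneg by (simp add: diff_const_def)

text \<open>For each \<open>b\<close> the truncations are combined by Jensen's inequality, and the
  scale \<open>\<kappa> b\<close> becomes one term of a sum over all scales. The resulting bound
  \<open>P\<close> is the same for all \<open>b\<close>, hence it dominates the difference quotient
  of the supremum. \<open>\<epsilon>\<close> keeps the Jensen weights positive.\<close>

lemma maxf_difference_quotient_eps:
  assumes f: "vanishing_mean f V" and v: "v \<noteq> 0" and \<epsilon>: "\<epsilon> > 0"
  shows "(\<integral>\<^sup>+x. ennreal ((\<bar>enn2real (maxf f (x + v)) - enn2real (maxf f x)\<bar> / norm v) powr \<mu>) \<partial>lborel)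
    \<le> ennreal (diff_const * (2 * real DIM('a) * V + 4 * \<epsilon>) powr \<mu>)"
proof -
  have V: "V \<ge> 0" and tv: "translation_var f V" using f by (auto simp: vanishing_mean_def)
  have fm [measurable]: "f \<in> borel_measurable borel" using tv by measurable
  have nv: "norm v > 0" using v by simp
  obtain U where U: "\<And>j. U j \<ge> 0" "\<And>j. translation_var (\<lambda>x. trunc j (f x)) (U j)"
    "\<And>A. finite A \<Longrightarrow> (\<Sum>j\<in>A. U j) \<le> real DIM('a) * V"
    using trunc_variation[OF tv V] by metis
  \<comment> \<open>\<open>U j\<close> is the variation of the j-th truncation;
    \<open>U (j - 1)\<close> is there because the mass of that truncation is controlled by the level
    below; the summable term with \<open>\<epsilon>\<close> makes \<open>W j\<close>
    positive.\<close>
  define W where "W j = U j + U (j - 1) + \<epsilon> * (1/2) ^ nat \<bar>j\<bar>" for j :: int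
  have W: "W j > 0" "U j \<le> W j" "U (j - 1) \<le> W j" for j
    using U(1)[of j] U(1)[of "j - 1"] \<epsilon> by (auto simp: W_def intro!: add_nonneg_pos)
  \<comment> \<open>Each of the two sums of \<open>U\<close> is at most \<open>DIM('a) * V\<close>,
    and \<open>sum_geometric_int\<close> bounds the sum of \<open>(1/2) ^ nat \<bar>j\<bar>\<close>
    by 4.\<close>
  define T where "T = 2 * real DIM('a) * V + 4 * \<epsilon>"
  have WT: "(\<Sum>j\<in>A. W j) \<le> T" if "finite A" for A
  proof -
    have "(\<Sum>j\<in>A. U (j - 1)) = (\<Sum>j\<in>(\<lambda>j. j - 1) ` A. U j)" by (subst sum.reindex) (auto simp: inj_on_def)
    also have "\<dots> \<le> real DIM('a) * V" by (rule U(3)) (use that in auto)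
    finally have "(\<Sum>j\<in>A. U (j - 1)) \<le> real DIM('a) * V" .
    moreover have "(\<Sum>j\<in>A. (1/2::real) ^ nat \<bar>j\<bar>) \<le> 4" using sum_geometric_int[OF that, of "1/2" 0] by simp
    then have "\<epsilon> * (\<Sum>j\<in>A. (1/2::real) ^ nat \<bar>j\<bar>) \<le> \<epsilon> * 4" using \<epsilon> by (intro mult_left_mono) auto
    ultimately show ?thesis
      using U(3)[OF that] by (simp add: W_def T_def sum.distrib sum_distrib_left)
  qed
  have T: "T > 0" using V \<epsilon> by (simp add: T_def add_nonneg_pos)
  define fj where "fj j x = trunc j (f x)" for j x
  have fjm [measurable]: "fj j \<in> borel_measurable borel" for j unfolding fj_def by measurable
  define \<Delta> where "\<Delta> j y = ennreal \<bar>fj j (y + v) - fj j y\<bar>" for j y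
  have [measurable]: "\<Delta> j \<in> borel_measurable borel" for j unfolding \<Delta>_def by measurable
  have \<Delta>int: "(\<integral>\<^sup>+y. \<Delta> j y \<partial>lborel) \<le> ennreal (norm v * U j)" for j
    using translation_varD[OF U(2)[of j], of v] by (simp add: \<Delta>_def fj_def)
  define I where "I j = (LINT x|lborel. \<bar>fj j x\<bar>)" for j
  have fji: "integrable lborel (fj j)" for j unfolding fj_def by (rule trunc_integrable[OF f])
  have Ieq: "(\<integral>\<^sup>+x. ennreal \<bar>fj j x\<bar> \<partial>lborel) = ennreal (I j)" for j
    unfolding I_def using fji by (intro nn_integral_eq_integral) auto
  have I0: "I j \<ge> 0" for j by (simp add: I_def)
  have Ile: "I j \<le> trunc_const * 2 powi j * (W j / 2 powi j) powr (real DIM('a) / (real DIM('a) - 1))" for j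
  proof -
    have "ennreal (I j) \<le> ennreal (trunc_const * 2 powi j * (W j / 2 powi j) powr (real DIM('a) / (real DIM('a) - 1)))"
      unfolding Ieq[symmetric] fj_def
      by (intro nn_integral_trunc_le[OF f] translation_var_mono[OF U(2)] W)
    then show ?thesis using trunc_const_nonneg by (subst (asm) ennreal_le_iff) auto
  qed
  \<comment> \<open>Both dominations of the difference quotient are kept: the first gives
    \<open>u1\<close> and \<open>u2\<close> from the variation of the truncation, the second gives
    \<open>u3\<close> and \<open>u4\<close> from its mass and its height.\<close>
  define u where "u j k x = min (ennreal (1 / norm v) * nconv (\<Phi> k) (\<Delta> j) x) (nconv (\<Psi> k v) (\<lambda>y. ennreal \<bar>fj j y\<bar>) x)" for j k x
  have um [measurable]: "u j k \<in> borel_measurable borel" for j k unfolding u_def by measurable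
  have cancel: "ennreal (1 / norm v) * (ennreal a * ennreal (norm v * b)) = ennreal (a * b)" if "a \<ge> 0" "b \<ge> 0" for a b
    using nv that by (simp add: ennreal_mult'[symmetric])
  have u1: "(\<integral>\<^sup>+x. u j k x \<partial>lborel) \<le> ennreal (c * U j)" for j k
  proof -
    have "(\<integral>\<^sup>+x. u j k x \<partial>lborel) \<le> (\<integral>\<^sup>+x. ennreal (1 / norm v) * nconv (\<Phi> k) (\<Delta> j) x \<partial>lborel)"
      by (intro nn_integral_mono) (simp add: u_def)
    also have "\<dots> = ennreal (1 / norm v) * ((\<integral>\<^sup>+x. \<Phi> k x \<partial>lborel) * (\<integral>\<^sup>+y. \<Delta> j y \<partial>lborel))"
      by (simp add: nn_integral_cmult nn_integral_nconv)
    also have "\<dots> \<le> ennreal (1 / norm v) * (ennreal c * ennreal (norm v * U j))"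
      by (intro mult_left_mono mult_mono \<Phi>_integral \<Delta>int) auto
    also have "\<dots> = ennreal (c * U j)" using c U by (intro cancel) auto
    finally show ?thesis .
  qed
  have u2: "u j k x \<le> ennreal (c / (2 powi k) ^ DIM('a) * U j)" for j k x
  proof -
    have "u j k x \<le> ennreal (1 / norm v) * nconv (\<Phi> k) (\<Delta> j) x" by (simp add: u_def)
    also have "\<dots> \<le> ennreal (1 / norm v) * (ennreal (c / (2 powi k) ^ DIM('a)) * (\<integral>\<^sup>+y. \<Delta> j y \<partial>lborel))"
      by (intro mult_left_mono nconv_le_left \<Phi>_le) auto
    also have "\<dots> \<le> ennreal (1 / norm v) * (ennreal (c / (2 powi k) ^ DIM('a)) * ennreal (norm v * U j))"
      by (intro mult_left_mono \<Delta>int) auto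
    also have "\<dots> = ennreal (c / (2 powi k) ^ DIM('a) * U j)" using c U by (intro cancel) auto
    finally show ?thesis .
  qed
  have u3: "(\<integral>\<^sup>+x. u j k x \<partial>lborel) \<le> ennreal (c / 2 powi k * I j)" for j k
  proof -
    have "(\<integral>\<^sup>+x. u j k x \<partial>lborel) \<le> (\<integral>\<^sup>+x. nconv (\<Psi> k v) (\<lambda>y. ennreal \<bar>fj j y\<bar>) x \<partial>lborel)"
      by (intro nn_integral_mono) (simp add: u_def)
    also have "\<dots> = (\<integral>\<^sup>+x. \<Psi> k v x \<partial>lborel) * ennreal (I j)"
      by (subst nn_integral_nconv) (auto simp: Ieq)
    also have "\<dots> \<le> ennreal (c / 2 powi k) * ennreal (I j)" by (intro mult_right_mono \<Psi>_integral) auto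
    finally show ?thesis using c I0 by (simp add: ennreal_mult'[symmetric])
  qed
  have u4: "u j k x \<le> ennreal (c / 2 powi k * 2 powi j)" for j k x
  proof -
    have "u j k x \<le> nconv (\<Psi> k v) (\<lambda>y. ennreal \<bar>fj j y\<bar>) x" by (simp add: u_def)
    also have "\<dots> \<le> (\<integral>\<^sup>+x. \<Psi> k v x \<partial>lborel) * ennreal (2 powi j)"
      by (intro nconv_le_right) (auto simp: fj_def abs_trunc_le intro!: ennreal_leI)
    also have "\<dots> \<le> ennreal (c / 2 powi k) * ennreal (2 powi j)" by (intro mult_right_mono \<Psi>_integral) auto
    finally show ?thesis using c by (simp add: ennreal_mult'[symmetric])
  qed
  define M where "M = mixed_const DIM('a) \<mu> c trunc_const"
  have M: "M \<ge> 0" unfolding M_def by (rule mixed_const_nonneg)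
  define A where "A J = {- int J..<int J}" for J
  have Afin [simp]: "finite (A J)" for J by (simp add: A_def)
  have mixed: "(\<Sum>k\<in>A J. ennreal ((2 powi k) powr (real DIM('a) * (\<mu> - 1))) * (\<integral>\<^sup>+x. ennreal (enn2real (u j k x) powr \<mu>) \<partial>lborel))
     \<le> ennreal (M * W j powr \<mu>)" for j J
    unfolding M_def
    by (rule mixed_norm_one_level[where V="U j" and I="I j" and d="2 powi j" and u="u j"])
      (use dim \<mu>_gt_1 U W c trunc_const_nonneg I0 Ile u1 u2 u3 u4 in auto)
  define r where "r k = (2 powi k :: real) powr (real DIM('a) * (\<mu> - 1))" for k :: int
  \<comment> \<open>The right side of \<open>powr_sum_le_weighted\<close>, with the term for the
    scale \<open>\<kappa> b\<close> extended to a sum over a finite window of scales, which makes it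
    independent of \<open>b\<close>. The same window is used for the heights
    \<open>j\<close>.\<close>
  define Q where "Q J x = (\<Sum>k\<in>A J. \<Sum>j\<in>A J. ennreal (c powr \<mu> * T powr (\<mu> - 1) * W j powr (1 - \<mu>)) *
      (ennreal (r k) * ennreal (enn2real (u j k x) powr \<mu>)))" for J x
  have Qm [measurable]: "Q J \<in> borel_measurable borel" for J unfolding Q_def by measurable
  have Qint: "(\<integral>\<^sup>+x. Q J x \<partial>lborel) \<le> ennreal (diff_const * T powr \<mu>)" for J
  proof -
    have "(\<integral>\<^sup>+x. Q J x \<partial>lborel) = (\<Sum>k\<in>A J. \<Sum>j\<in>A J. ennreal (c powr \<mu> * T powr (\<mu> - 1) * W j powr (1 - \<mu>)) *
      (ennreal (r k) * (\<integral>\<^sup>+x. ennreal (enn2real (u j k x) powr \<mu>) \<partial>lborel)))"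
      unfolding Q_def by (simp add: nn_integral_sum nn_integral_cmult)
    also have "\<dots> = (\<Sum>j\<in>A J. ennreal (c powr \<mu> * T powr (\<mu> - 1) * W j powr (1 - \<mu>)) *
       (\<Sum>k\<in>A J. ennreal (r k) * (\<integral>\<^sup>+x. ennreal (enn2real (u j k x) powr \<mu>) \<partial>lborel)))"
      by (subst sum.swap) (simp add: sum_distrib_left)
    also have "\<dots> \<le> (\<Sum>j\<in>A J. ennreal (c powr \<mu> * T powr (\<mu> - 1) * W j powr (1 - \<mu>)) * ennreal (M * W j powr \<mu>))"
      unfolding r_def by (intro sum_mono mult_left_mono mixed) auto
    also have "\<dots> = (\<Sum>j\<in>A J. ennreal (c powr \<mu> * T powr (\<mu> - 1) * M * W j))"
    proof (intro sum.cong refl)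
      fix j
      have "W j powr (1 - \<mu>) * W j powr \<mu> = W j" unfolding powr_add[symmetric] using W(1)[of j] by simp
      have "c powr \<mu> * T powr (\<mu> - 1) * W j powr (1 - \<mu>) * (M * W j powr \<mu>)
          = c powr \<mu> * T powr (\<mu> - 1) * M * (W j powr (1 - \<mu>) * W j powr \<mu>)"
        by (simp only: mult_ac)
      also note \<open>W j powr (1 - \<mu>) * W j powr \<mu> = W j\<close>
      finally have e: "c powr \<mu> * T powr (\<mu> - 1) * W j powr (1 - \<mu>) * (M * W j powr \<mu>) = c powr \<mu> * T powr (\<mu> - 1) * M * W j" .
      show "ennreal (c powr \<mu> * T powr (\<mu> - 1) * W j powr (1 - \<mu>)) * ennreal (M * W j powr \<mu>) = ennreal (c powr \<mu> * T powr (\<mu> - 1) * M * W j)"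
        unfolding e[symmetric] using T by (intro ennreal_mult'[symmetric]) auto
    qed
    also have "\<dots> = ennreal (c powr \<mu> * T powr (\<mu> - 1) * M * (\<Sum>j\<in>A J. W j))"
      using M less_imp_le[OF W(1)] by (subst sum_ennreal) (auto simp: sum_distrib_left intro!: mult_nonneg_nonneg)
    also have "\<dots> \<le> ennreal (c powr \<mu> * T powr (\<mu> - 1) * M * T)"
      using M by (intro ennreal_leI mult_left_mono WT) auto
    also have "c powr \<mu> * T powr (\<mu> - 1) * M * T = diff_const * (T powr (\<mu> - 1) * T powr 1)"
      using T by (simp add: diff_const_def M_def)
    also have "T powr (\<mu> - 1) * T powr 1 = T powr \<mu>" unfolding powr_add[symmetric] by simp
    finally show ?thesis .
  qed
  have Qinc: "incseq Q"
  proof (intro incseq_SucI le_funI)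
    fix J x
    have "A J \<subseteq> A (Suc J)" by (auto simp: A_def)
    then show "Q J x \<le> Q (Suc J) x"
      unfolding Q_def by (intro order_trans[OF sum_mono[OF sum_mono2] sum_mono2]) auto
  qed
  define P where "P x = (SUP J. Q J x)" for x
  have Pint: "(\<integral>\<^sup>+x. P x \<partial>lborel) \<le> ennreal (diff_const * T powr \<mu>)"
    unfolding P_def by (subst nn_integral_monotone_convergence_SUP[OF Qinc]) (auto intro!: SUP_least Qint)
  have point: "ennreal ((w b * \<bar>conv (K b) f (x + v) - conv (K b) f x\<bar> / norm v) powr \<mu>) \<le> P x" if b: "b \<in> S" for b x
  proof -
    have fjle: "\<bar>fj j y\<bar> \<le> \<bar>f y\<bar>" for j y by (simp add: fj_def abs_trunc_le_self)
    have fji: "integrable lborel (\<lambda>y. K b (x - y) * fj j y)" for j x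
      by (intro integrable_kernel_mult[OF f b] fjle) auto
    define g where "g J y = (\<Sum>j\<in>A J. fj j y)" for J y
    have gm [measurable]: "g J \<in> borel_measurable borel" for J unfolding g_def by measurable
    have gconv: "conv (K b) (g J) x = (\<Sum>j\<in>A J. conv (K b) (fj j) x)" for J x
      unfolding conv_def g_def sum_distrib_left by (subst Bochner_Integration.integral_sum) (auto intro: fji)
    have glim: "(\<lambda>J. conv (K b) (g J) x) \<longlonglongrightarrow> conv (K b) f x" for x
      unfolding conv_def
    proof (rule integral_dominated_convergence[where w="\<lambda>y. \<bar>K b (x - y) * f y\<bar>"])
      show "integrable lborel (\<lambda>y. \<bar>K b (x - y) * f y\<bar>)"
        using integrable_kernel_mult[OF f b fm] by (intro integrable_abs) simp
      show "AE y in lborel. (\<lambda>J. K b (x - y) * g J y) \<longlonglongrightarrow> K b (x - y) * f y"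
        unfolding g_def fj_def A_def by (intro AE_I2 tendsto_mult tendsto_const sum_trunc_tendsto)
      \<comment> \<open>Comparison with \<open>trunc j 0 = 0\<close> bounds the partial sums of
        truncations by \<open>f\<close> itself, which supplies the dominating function.\<close>
      have "\<bar>g J y\<bar> \<le> \<bar>f y\<bar>" for J y
      proof -
        have "\<bar>g J y\<bar> \<le> (\<Sum>j\<in>A J. \<bar>trunc j (f y) - trunc j 0\<bar>)"
          unfolding g_def fj_def by (simp add: trunc_eq_0)
        also have "\<dots> \<le> \<bar>f y - 0\<bar>" by (rule sum_trunc_diff_le) simp
        finally show ?thesis by simp
      qed
      then show "AE y in lborel. norm (K b (x - y) * g J y) \<le> \<bar>K b (x - y) * f y\<bar>" for J
        by (intro AE_I2) (auto simp: abs_mult intro!: mult_left_mono)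
    qed auto
    have du: "\<bar>conv (K b) (fj j) (x + v) - conv (K b) (fj j) x\<bar> / norm v \<le> enn2real (u j (\<kappa> b) x)" for j
    proof -
      let ?d = "\<bar>conv (K b) (fj j) (x + v) - conv (K b) (fj j) x\<bar>"
      have 1: "ennreal ?d \<le> nconv (\<Phi> (\<kappa> b)) (\<Delta> j) x"
        unfolding \<Delta>_def by (intro nn_integral_abs_diff_le_nconv fji K_le b) auto
      have 2: "ennreal ?d \<le> ennreal (norm v) * nconv (\<Psi> (\<kappa> b) v) (\<lambda>y. ennreal \<bar>fj j y\<bar>) x"
        by (intro abs_diff_le_nconv_kernel fji K_diff_le b) auto
      have "ennreal (?d / norm v) = ennreal (1 / norm v) * ennreal ?d"
        using nv by (simp add: ennreal_mult'[symmetric])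
      moreover have "ennreal (1 / norm v) * (ennreal (norm v) * X) = X" for X
        using nv by (simp add: mult.assoc[symmetric] ennreal_mult'[symmetric])
      ultimately have "ennreal (?d / norm v) \<le> u j (\<kappa> b) x"
        unfolding u_def using mult_left_mono[OF 1, of "ennreal (1 / norm v)"] mult_left_mono[OF 2, of "ennreal (1 / norm v)"]
        by auto
      then have "enn2real (ennreal (?d / norm v)) \<le> enn2real (u j (\<kappa> b) x)"
        using u4[of j "\<kappa> b" x] by (intro enn2real_mono) (auto intro: le_less_trans)
      then show ?thesis by simp
    qed
    have fin: "ennreal ((w b * \<bar>conv (K b) (g J) (x + v) - conv (K b) (g J) x\<bar> / norm v) powr \<mu>) \<le> P x"
      if J: "\<kappa> b \<in> A J" for J
    proof -
      let ?u = "\<lambda>j. enn2real (u j (\<kappa> b) x)"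
      have "\<bar>conv (K b) (g J) (x + v) - conv (K b) (g J) x\<bar> / norm v
        \<le> (\<Sum>j\<in>A J. \<bar>conv (K b) (fj j) (x + v) - conv (K b) (fj j) x\<bar>) / norm v"
        unfolding gconv sum_subtractf[symmetric] by (intro divide_right_mono sum_abs) auto
      also have "\<dots> \<le> (\<Sum>j\<in>A J. ?u j)"
        unfolding sum_divide_distrib by (intro sum_mono du)
      finally have "w b * (\<bar>conv (K b) (g J) (x + v) - conv (K b) (g J) x\<bar> / norm v)
        \<le> (c * (2 powi \<kappa> b) powr \<alpha>) * (\<Sum>j\<in>A J. ?u j)"
        using c by (intro mult_mono w_le w_nonneg b) auto
      then have "(w b * \<bar>conv (K b) (g J) (x + v) - conv (K b) (g J) x\<bar> / norm v) powr \<mu>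
        \<le> ((c * (2 powi \<kappa> b) powr \<alpha>) * (\<Sum>j\<in>A J. ?u j)) powr \<mu>"
        using \<mu>_gt_1 w_nonneg[OF b] by (intro powr_mono2) auto
      also have "\<dots> = c powr \<mu> * r (\<kappa> b) * (\<Sum>j\<in>A J. ?u j) powr \<mu>"
        using c by (simp add: powr_mult powr_powr \<mu>_scaling r_def sum_nonneg)
      also have "\<dots> \<le> c powr \<mu> * r (\<kappa> b) * (T powr (\<mu> - 1) * (\<Sum>j\<in>A J. W j powr (1 - \<mu>) * ?u j powr \<mu>))"
        by (intro mult_left_mono powr_sum_le_weighted WT W \<mu>_gt_1) (auto simp: r_def)
      also have "\<dots> = (\<Sum>j\<in>A J. c powr \<mu> * T powr (\<mu> - 1) * W j powr (1 - \<mu>) * (r (\<kappa> b) * ?u j powr \<mu>))"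
        by (simp add: sum_distrib_left mult_ac)
      finally have "ennreal ((w b * \<bar>conv (K b) (g J) (x + v) - conv (K b) (g J) x\<bar> / norm v) powr \<mu>)
        \<le> ennreal (\<Sum>j\<in>A J. c powr \<mu> * T powr (\<mu> - 1) * W j powr (1 - \<mu>) * (r (\<kappa> b) * ?u j powr \<mu>))"
        by (rule ennreal_leI)
      also have "\<dots> = (\<Sum>j\<in>A J. ennreal (c powr \<mu> * T powr (\<mu> - 1) * W j powr (1 - \<mu>)) *
          (ennreal (r (\<kappa> b)) * ennreal (?u j powr \<mu>)))"
        by (subst sum_ennreal[symmetric]) (auto simp: ennreal_mult' r_def)
      also have "\<dots> = (\<Sum>k\<in>{\<kappa> b}. \<Sum>j\<in>A J. ennreal (c powr \<mu> * T powr (\<mu> - 1) * W j powr (1 - \<mu>)) *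
          (ennreal (r k) * ennreal (enn2real (u j k x) powr \<mu>)))" by simp
      also have "\<dots> \<le> Q J x" unfolding Q_def using J by (intro sum_mono2) auto
      also have "\<dots> \<le> P x" unfolding P_def by (rule SUP_upper) simp
      finally show ?thesis .
    qed
    show ?thesis
    proof (rule LIMSEQ_le_const2)
      have "(\<lambda>J. w b * \<bar>conv (K b) (g J) (x + v) - conv (K b) (g J) x\<bar> / norm v)
        \<longlonglongrightarrow> w b * \<bar>conv (K b) f (x + v) - conv (K b) f x\<bar> / norm v"
        using nv by (intro tendsto_intros glim) auto
      then show "(\<lambda>J. ennreal ((w b * \<bar>conv (K b) (g J) (x + v) - conv (K b) (g J) x\<bar> / norm v) powr \<mu>))
        \<longlonglongrightarrow> ennreal ((w b * \<bar>conv (K b) f (x + v) - conv (K b) f x\<bar> / norm v) powr \<mu>)"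
        using \<mu>_gt_1 w_nonneg[OF b] by (intro tendsto_ennrealI tendsto_powr2 tendsto_const) auto
      have "\<kappa> b \<in> A J" if "J \<ge> Suc (nat \<bar>\<kappa> b\<bar>)" for J using that by (auto simp: A_def)
      then show "\<exists>N. \<forall>J\<ge>N. ennreal ((w b * \<bar>conv (K b) (g J) (x + v) - conv (K b) (g J) x\<bar> / norm v) powr \<mu>) \<le> P x"
        using fin by blast
    qed
  qed
  have "ennreal ((\<bar>enn2real (maxf f (x + v)) - enn2real (maxf f x)\<bar> / norm v) powr \<mu>) \<le> P x" for x
  proof (cases "P x")
    case (real q)
    define s where "s = norm v * q powr (1 / \<mu>)"
    have s: "s \<ge> 0" by (simp add: s_def)
    have d: "w b * \<bar>conv (K b) f (x + v) - conv (K b) f x\<bar> \<le> s" if b: "b \<in> S" for b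
    proof -
      have "(w b * \<bar>conv (K b) f (x + v) - conv (K b) f x\<bar> / norm v) powr \<mu> \<le> q"
        using point[OF b, of x] real by (subst (asm) real(2)) (simp add: real(1))
      then have "((w b * \<bar>conv (K b) f (x + v) - conv (K b) f x\<bar> / norm v) powr \<mu>) powr (1 / \<mu>) \<le> q powr (1 / \<mu>)"
        using \<mu>_gt_1 by (intro powr_mono2) auto
      also have "((w b * \<bar>conv (K b) f (x + v) - conv (K b) f x\<bar> / norm v) powr \<mu>) powr (1 / \<mu>)
         = w b * \<bar>conv (K b) f (x + v) - conv (K b) f x\<bar> / norm v"
        using \<mu>_gt_1 w_nonneg[OF b] by (simp add: powr_powr)
      finally show ?thesis using nv by (simp add: s_def divide_le_eq mult.commute)
    qed
    have up: "maxf f y \<le> maxf f z + ennreal s"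
      if "\<And>b. b \<in> S \<Longrightarrow> w b * \<bar>conv (K b) f y - conv (K b) f z\<bar> \<le> s" for y z
      unfolding maxf_def[of f y]
    proof (rule SUP_least)
      fix b assume b: "b \<in> S"
      have "w b * \<bar>conv (K b) f y\<bar> \<le> w b * \<bar>conv (K b) f z\<bar> + w b * \<bar>conv (K b) f y - conv (K b) f z\<bar>"
        unfolding distrib_left[symmetric] by (intro mult_left_mono w_nonneg b) auto
      also have "\<dots> \<le> w b * \<bar>conv (K b) f z\<bar> + s" using that[OF b] by simp
      finally have "ennreal (w b * \<bar>conv (K b) f y\<bar>) \<le> ennreal (w b * \<bar>conv (K b) f z\<bar>) + ennreal s"
        using s w_nonneg[OF b] by (simp add: ennreal_plus[symmetric] ennreal_leI del: ennreal_plus)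
      also have "\<dots> \<le> maxf f z + ennreal s"
        unfolding maxf_def by (intro add_right_mono SUP_upper b)
      finally show "ennreal (w b * \<bar>conv (K b) f y\<bar>) \<le> maxf f z + ennreal s" .
    qed
    have 1: "maxf f (x + v) \<le> maxf f x + ennreal s" by (intro up d)
    have 2: "maxf f x \<le> maxf f (x + v) + ennreal s"
      using d by (intro up) (simp add: abs_minus_commute)
    \<comment> \<open>If one of the two values is infinite, so is the other, and
      \<open>enn2real\<close> sends both to 0.\<close>
    have "\<bar>enn2real (maxf f (x + v)) - enn2real (maxf f x)\<bar> \<le> s"
      using 1 2 s by (cases "maxf f x"; cases "maxf f (x + v)")
        (auto simp: ennreal_plus[symmetric] top_unique simp del: ennreal_plus)
    then have "\<bar>enn2real (maxf f (x + v)) - enn2real (maxf f x)\<bar> / norm v \<le> q powr (1 / \<mu>)"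
      using nv by (simp add: s_def divide_le_eq mult.commute)
    then have "(\<bar>enn2real (maxf f (x + v)) - enn2real (maxf f x)\<bar> / norm v) powr \<mu> \<le> (q powr (1 / \<mu>)) powr \<mu>"
      using \<mu>_gt_1 by (intro powr_mono2) auto
    also have "\<dots> = q" using \<mu>_gt_1 real by (simp add: powr_powr)
    finally show ?thesis unfolding real(2) by (rule ennreal_leI)
  qed simp
  then have "(\<integral>\<^sup>+x. ennreal ((\<bar>enn2real (maxf f (x + v)) - enn2real (maxf f x)\<bar> / norm v) powr \<mu>) \<partial>lborel)
    \<le> (\<integral>\<^sup>+x. P x \<partial>lborel)" by (intro nn_integral_mono)
  also note Pint
  finally show ?thesis by (simp add: T_def)
qed

lemma maxf_difference_quotient:
  assumes f: "vanishing_mean f V" and v: "v \<noteq> 0"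
  shows "(\<integral>\<^sup>+x. ennreal ((\<bar>enn2real (maxf f (x + v)) - enn2real (maxf f x)\<bar> / norm v) powr \<mu>) \<partial>lborel)
    \<le> ennreal (diff_const * (2 * real DIM('a) * V) powr \<mu>)"
proof (rule LIMSEQ_le_const)
  have V: "V \<ge> 0" using f by (simp add: vanishing_mean_def)
  have "(\<lambda>m. 2 * real DIM('a) * V + 4 * inverse (real (Suc m))) \<longlonglongrightarrow> 2 * real DIM('a) * V + 4 * 0"
    by (intro tendsto_intros LIMSEQ_inverse_real_of_nat)
  then show "(\<lambda>m. ennreal (diff_const * (2 * real DIM('a) * V + 4 * inverse (real (Suc m))) powr \<mu>))
    \<longlonglongrightarrow> ennreal (diff_const * (2 * real DIM('a) * V) powr \<mu>)"
    using \<mu>_gt_1 V by (intro tendsto_ennrealI tendsto_mult tendsto_powr2 tendsto_const) auto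
qed (use maxf_difference_quotient_eps[OF f v] in auto)

end

section \<open>Weak compactness by midpoint hulls\<close>

text \<open>For \<open>1 < p < 2\<close> the second derivative of
  \<open>\<bar>s\<bar> powr p\<close> is singular at 0. This substitute is smooth and comparable to
  it up to a factor and an additive constant, which is harmless on a finite measure space.\<close>

definition bracket :: "real \<Rightarrow> real \<Rightarrow> real" where
  "bracket p s = (1 + s\<^sup>2) powr (p / 2)"

lemma borel_measurable_bracket [measurable]: "bracket p \<in> borel_measurable borel"
  unfolding bracket_def by measurable

lemma bracket_pos: "bracket p s > 0"
proof -
  have "1 + s\<^sup>2 \<noteq> 0" using zero_le_power2[of s] by linarith
  then show ?thesis by (simp add: bracket_def)
qed

lemma abs_le_bracket: "p \<ge> 1 \<Longrightarrow> \<bar>s\<bar> \<le> bracket p s"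
proof -
  assume p: "p \<ge> 1"
  have "\<bar>s\<bar> = (s\<^sup>2) powr (1/2)" by (simp add: powr_half_sqrt)
  also have "\<dots> \<le> (1 + s\<^sup>2) powr (1/2)" by (intro powr_mono2) auto
  also have "\<dots> \<le> (1 + s\<^sup>2) powr (p/2)" using p by (intro powr_mono) auto
  finally show ?thesis by (simp add: bracket_def)
qed

lemma bracket_le: "0 < p \<Longrightarrow> p \<le> 2 \<Longrightarrow> bracket p s \<le> 2 * (1 + \<bar>s\<bar> powr p)"
proof -
  assume p: "0 < p" "p \<le> 2"
  define t where "t = max 1 \<bar>s\<bar>"
  have t: "t \<ge> 1" by (simp add: t_def)
  have "s\<^sup>2 \<le> t\<^sup>2" by (simp add: t_def abs_le_square_iff[symmetric])
  moreover have "1 \<le> t\<^sup>2" using t by simp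
  ultimately have "bracket p s \<le> (2 * t\<^sup>2) powr (p/2)"
    unfolding bracket_def using p by (intro powr_mono2) auto
  also have "\<dots> = 2 powr (p/2) * (t powr 2) powr (p/2)" using t by (simp add: powr_mult)
  also have "\<dots> = 2 powr (p/2) * t powr p" by (simp add: powr_powr)
  also have "2 powr (p/2) \<le> 2 powr 1" using p by (intro powr_mono) auto
  finally have "bracket p s \<le> 2 * t powr p" by (simp add: mult_right_mono)
  also have "t powr p \<le> 1 + \<bar>s\<bar> powr p" by (simp add: t_def max_def)
  finally show ?thesis by simp
qed

text \<open>Uniform convexity: the second derivative of the bracket is at least
  \<open>p (p - 1) (1 + s\<^sup>2)\<^bsup>p/2 - 1\<^esup>\<close>.\<close>

lemma bracket_midpoint_gap:
  assumes p: "1 < p" "p \<le> 2"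
  shows "p * (p - 1) / 8 * (a - b)\<^sup>2 * (1 + max (a\<^sup>2) (b\<^sup>2)) powr (p/2 - 1)
    \<le> (bracket p a + bracket p b) / 2 - bracket p ((a + b) / 2)"
proof -
  have main: "p * (p - 1) / 8 * (a - b)\<^sup>2 * (1 + max (a\<^sup>2) (b\<^sup>2)) powr (p/2 - 1)
    \<le> (bracket p a + bracket p b) / 2 - bracket p ((a + b) / 2)" if ab: "a \<le> b" for a b
  proof -
    define X where "X = max (a\<^sup>2) (b\<^sup>2)"
    define m where "m = p * (p - 1) * (1 + X) powr (p/2 - 1)"
    have pos: "1 + s\<^sup>2 > 0" for s :: real by (simp add: add_pos_nonneg)
    \<comment> \<open>On \<open>{a..b}\<close> the second derivative of the bracket is at least
      \<open>m\<close>, so subtracting \<open>m * s^2 / 2\<close> preserves convexity. Midpoint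
      convexity of the difference then yields the gap \<open>m * (a - b)^2 / 8\<close>.\<close>
    have "convex_on {a..b} (\<lambda>s. bracket p s - m * s\<^sup>2 / 2)"
    proof (rule f''_ge0_imp_convex)
      fix s assume s: "s \<in> {a..b}"
      show "((\<lambda>s. bracket p s - m * s\<^sup>2 / 2) has_real_derivative (p * s * (1 + s\<^sup>2) powr (p/2 - 1) - m * s)) (at s)"
        unfolding bracket_def using pos[of s] by (auto intro!: derivative_eq_intros)
      show "((\<lambda>s. p * s * (1 + s\<^sup>2) powr (p/2 - 1) - m * s) has_real_derivative
         (p * (1 + s\<^sup>2) powr (p/2 - 1) + p * s * ((p/2 - 1) * (1 + s\<^sup>2) powr (p/2 - 1 - 1) * (2 * s)) - m)) (at s)"
        using pos[of s] by (auto intro!: derivative_eq_intros)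
      have sX: "s\<^sup>2 \<le> X"
      proof (cases "s \<ge> 0")
        case True
        then have "s\<^sup>2 \<le> b\<^sup>2" using s by (intro power_mono) auto
        then show ?thesis by (simp add: X_def)
      next
        case False
        then have "(- s)\<^sup>2 \<le> (- a)\<^sup>2" using s by (intro power_mono) auto
        then show ?thesis by (simp add: X_def)
      qed
      define Y where "Y = 1 + s\<^sup>2"
      have Y: "Y \<ge> 1" by (simp add: Y_def)
      have e: "Y powr (p/2 - 1) = Y powr (p/2 - 1 - 1) * Y"
        using Y powr_add[of Y "p/2 - 1 - 1" 1] by simp
      have "m \<le> p * (p - 1) * Y powr (p/2 - 1)"
        unfolding m_def Y_def using p sX pos[of s] by (intro mult_left_mono powr_mono2') auto
      also have "\<dots> = p * Y powr (p/2 - 1 - 1) * ((p - 1) * Y)" unfolding e by simp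
      \<comment> \<open>As \<open>Y - s^2 = 1\<close>, the bracketed factors differ by exactly
        \<open>2 - p\<close>, which is nonnegative.\<close>
      also have "\<dots> \<le> p * Y powr (p/2 - 1 - 1) * (Y + (p - 2) * s\<^sup>2)"
        using p by (intro mult_left_mono) (auto simp: Y_def algebra_simps)
      also have "\<dots> = p * Y powr (p/2 - 1) + p * s * ((p/2 - 1) * Y powr (p/2 - 1 - 1) * (2 * s))"
        unfolding e by (simp add: algebra_simps power2_eq_square)
      finally show "0 \<le> p * (1 + s\<^sup>2) powr (p/2 - 1) + p * s * ((p/2 - 1) * (1 + s\<^sup>2) powr (p/2 - 1 - 1) * (2 * s)) - m"
        unfolding Y_def by simp
    qed auto
    from convex_onD[OF this, of "1/2" a b] ab
    have "bracket p ((a + b) / 2) - m * ((a + b) / 2)\<^sup>2 / 2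
      \<le> (bracket p a - m * a\<^sup>2 / 2) / 2 + (bracket p b - m * b\<^sup>2 / 2) / 2"
      by (simp add: add_divide_distrib)
    then have "bracket p ((a + b) / 2) - m * (((a + b) / 2)\<^sup>2 / 2)
      \<le> (bracket p a + bracket p b) / 2 - m * (a\<^sup>2 / 4 + b\<^sup>2 / 4)"
      by (simp add: field_simps)
    then have "m * (a\<^sup>2 / 4 + b\<^sup>2 / 4 - ((a + b) / 2)\<^sup>2 / 2) \<le> (bracket p a + bracket p b) / 2 - bracket p ((a + b) / 2)"
      by (simp add: right_diff_distrib)
    also have "a\<^sup>2 / 4 + b\<^sup>2 / 4 - ((a + b) / 2)\<^sup>2 / 2 = (a - b)\<^sup>2 / 8"
      by (simp add: power2_eq_square field_simps)
    finally show ?thesis by (simp add: m_def X_def mult_ac)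
  qed
  show ?thesis
  proof (cases "a \<le> b")
    case False
    then show ?thesis using main[of b a] by (simp add: max.commute add.commute power2_commute)
  qed (rule main)
qed

text \<open>The inequality of arithmetic and geometric means, with the weight
  \<open>q = Z powr (p/2 - 1)\<close>, gives
  \<open>\<bar>a - b\<bar> \<le> L/2 (a - b)^2 q + 1/(2 L q)\<close>. The first term is bounded by
  the convexity gap, the second by the brackets because \<open>1 - p/2 \<le> p/2\<close>. A large
  \<open>L\<close> makes the second term small, at the price of a small gap being required in the
  first.\<close>

lemma abs_diff_le_bracket_gap:
  assumes p: "1 < p" "p \<le> 2" and L: "L > 0"
  shows "\<bar>a - b\<bar> \<le> L / 2 * (8 / (p * (p - 1))) * ((bracket p a + bracket p b) / 2 - bracket p ((a + b) / 2))
    + 1 / (2 * L) * (bracket p a + bracket p b)"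
proof -
  define Z where "Z = 1 + max (a\<^sup>2) (b\<^sup>2)"
  have Z: "Z \<ge> 1" by (simp add: Z_def le_max_iff_disj)
  define q where "q = Z powr (p/2 - 1)"
  have q: "q > 0" using Z by (simp add: q_def)
  define k where "k = p * (p - 1)"
  have k: "k > 0" using p by (simp add: k_def)
  have "0 \<le> (L * \<bar>a - b\<bar> * q - 1)\<^sup>2 / (2 * L * q)" using L q by simp
  also have "\<dots> = L / 2 * ((a - b)\<^sup>2 * q) + 1 / (2 * L) * (1 / q) - \<bar>a - b\<bar>"
  proof -
    have ab: "(a - b)\<^sup>2 = \<bar>a - b\<bar>\<^sup>2" by simp
    show ?thesis unfolding ab using L q by (simp add: power2_eq_square field_simps)
  qed
  finally have 1: "\<bar>a - b\<bar> \<le> L / 2 * ((a - b)\<^sup>2 * q) + 1 / (2 * L) * (1 / q)" by simp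
  have "1 / q = Z powr (1 - p/2)" using Z by (simp add: q_def powr_diff)
  also have "\<dots> \<le> Z powr (p/2)" using p Z by (intro powr_mono) auto
  also have "\<dots> \<le> bracket p a + bracket p b"
    using bracket_pos[of p a] bracket_pos[of p b] unfolding Z_def bracket_def by (auto simp: max_def)
  finally have 2: "1 / (2 * L) * (1 / q) \<le> 1 / (2 * L) * (bracket p a + bracket p b)"
    using L by (intro mult_left_mono) auto
  have "k / 8 * ((a - b)\<^sup>2 * q) \<le> (bracket p a + bracket p b) / 2 - bracket p ((a + b) / 2)"
    using bracket_midpoint_gap[OF p, of a b] by (simp add: q_def Z_def k_def mult.assoc)
  then have "8 / k * (k / 8 * ((a - b)\<^sup>2 * q)) \<le> 8 / k * ((bracket p a + bracket p b) / 2 - bracket p ((a + b) / 2))"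
    using k by (intro mult_left_mono) auto
  then have "(a - b)\<^sup>2 * q \<le> 8 / k * ((bracket p a + bracket p b) / 2 - bracket p ((a + b) / 2))"
    using k by simp
  then have "L / 2 * ((a - b)\<^sup>2 * q) \<le> L / 2 * (8 / k * ((bracket p a + bracket p b) / 2 - bracket p ((a + b) / 2)))"
    using L by (intro mult_left_mono) auto
  with 1 2 show ?thesis unfolding k_def by (simp only: mult.assoc)
qed

text \<open>Closed under midpoints only, so it consists of dyadic convex combinations. The midpoint
  inequality is all that is applied to it, and bounds pass to the hull by induction.\<close>

inductive_set midhull :: "('a \<Rightarrow> real) set \<Rightarrow> ('a \<Rightarrow> real) set" for G where
  base: "g \<in> G \<Longrightarrow> g \<in> midhull G"
| mid: "f \<in> midhull G \<Longrightarrow> g \<in> midhull G \<Longrightarrow> (\<lambda>x. (f x + g x) / 2) \<in> midhull G"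

lemma midhull_mono: "G \<subseteq> H \<Longrightarrow> f \<in> midhull G \<Longrightarrow> f \<in> midhull H"
  by (rotate_tac, induction rule: midhull.induct) (auto intro: midhull.intros)

lemma midhull_measurable:
  "f \<in> midhull G \<Longrightarrow> (\<And>g. g \<in> G \<Longrightarrow> g \<in> borel_measurable M) \<Longrightarrow> f \<in> borel_measurable M"
  by (induction rule: midhull.induct) auto

lemma midhull_powr_le:
  assumes "f \<in> midhull G" and "\<And>g. g \<in> G \<Longrightarrow> g \<in> borel_measurable M" and p: "p > 1"
    and "\<And>g. g \<in> G \<Longrightarrow> (\<integral>\<^sup>+x. ennreal (\<bar>g x\<bar> powr p) \<partial>M) \<le> ennreal A"
  shows "(\<integral>\<^sup>+x. ennreal (\<bar>f x\<bar> powr p) \<partial>M) \<le> ennreal A"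
  using assms(1)
proof induction
  case (mid f g)
  have [measurable]: "f \<in> borel_measurable M" "g \<in> borel_measurable M"
    using mid midhull_measurable assms(2) by blast+
  have le: "\<bar>(a + b) / 2\<bar> powr p \<le> (\<bar>a\<bar> powr p + \<bar>b\<bar> powr p) / 2" for a b :: real
  proof -
    \<comment> \<open>Convexity of the p-th power at a midpoint, obtained from
      \<open>powr_sum_le_weighted\<close> over the two-element index type \<open>bool\<close> with
      both weights 1/2.\<close>
    have "\<bar>(a + b) / 2\<bar> powr p \<le> (\<Sum>t\<in>UNIV. (if t then \<bar>a\<bar> else \<bar>b\<bar>) / 2) powr p"
      using p by (intro powr_mono2) (auto simp: UNIV_bool abs_triangle_ineq add_divide_distrib[symmetric] divide_right_mono)
    also have "\<dots> \<le> 1 powr (p - 1) * (\<Sum>t\<in>UNIV. (1/2) powr (1 - p) * ((if t then \<bar>a\<bar> else \<bar>b\<bar>) / 2) powr p)"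
      using p by (intro powr_sum_le_weighted) (auto simp: UNIV_bool)
    also have "\<dots> = (\<Sum>t\<in>UNIV. (if t then \<bar>a\<bar> else \<bar>b\<bar>) powr p / 2)"
    proof -
      have e: "(1/2) powr (1 - p) * (u / 2) powr p = u powr p / 2" if "u \<ge> 0" for u :: real
        using that by (simp add: powr_divide powr_diff)
      show ?thesis unfolding powr_one_eq_one mult_1_left by (intro sum.cong refl e) auto
    qed
    finally show ?thesis by (simp add: UNIV_bool add_divide_distrib add.commute)
  qed
  have "(\<integral>\<^sup>+x. ennreal (\<bar>(f x + g x) / 2\<bar> powr p) \<partial>M)
    \<le> (\<integral>\<^sup>+x. ennreal (1/2) * (ennreal (\<bar>f x\<bar> powr p) + ennreal (\<bar>g x\<bar> powr p)) \<partial>M)"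
  proof (intro nn_integral_mono)
    fix x
    have "ennreal (\<bar>(f x + g x) / 2\<bar> powr p) \<le> ennreal (1/2 * (\<bar>f x\<bar> powr p + \<bar>g x\<bar> powr p))"
      using le[of "f x" "g x"] by (intro ennreal_leI) simp
    then show "ennreal (\<bar>(f x + g x) / 2\<bar> powr p) \<le> ennreal (1/2) * (ennreal (\<bar>f x\<bar> powr p) + ennreal (\<bar>g x\<bar> powr p))"
      by (subst (asm) ennreal_mult') auto
  qed
  also have "\<dots> = ennreal (1/2) * ((\<integral>\<^sup>+x. ennreal (\<bar>f x\<bar> powr p) \<partial>M) + (\<integral>\<^sup>+x. ennreal (\<bar>g x\<bar> powr p) \<partial>M))"
    by (simp add: nn_integral_cmult nn_integral_add)
  also have "\<dots> \<le> ennreal (1/2) * (ennreal A + ennreal A)"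
    by (intro mult_left_mono add_mono mid) auto
  also have "\<dots> = ennreal A"
  proof (cases "A \<ge> 0")
    case True
    have "ennreal (1/2) * (ennreal A + ennreal A) = ennreal (1/2) * ennreal (A + A)"
      using True by (simp only: ennreal_plus)
    also have "\<dots> = ennreal (1/2 * (A + A))" using True by (intro ennreal_mult'[symmetric]) simp
    finally show ?thesis by simp
  qed (simp add: ennreal_neg)
  finally show ?case .
qed (rule assms(4))

text \<open>Almost minimisers of a uniformly convex functional on the hulls of the tails form a Cauchy sequence.\<close>

lemma midhull_convergence:
  fixes g :: "nat \<Rightarrow> 'a \<Rightarrow> real"
  assumes M: "finite_measure M" and [measurable]: "\<And>m. g m \<in> borel_measurable M" and p: "1 < p" "p \<le> 2"
    and bound: "\<And>m. (\<integral>\<^sup>+x. ennreal (\<bar>g m x\<bar> powr p) \<partial>M) \<le> ennreal A" and A: "A \<ge> 0"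
  obtains s G where "\<And>N. s N \<in> midhull (g ` {N..})" "G \<in> borel_measurable M"
    "AE x in M. (\<lambda>N. s N x) \<longlonglongrightarrow> G x"
    "\<And>e. e > 0 \<Longrightarrow> \<forall>\<^sub>F N in sequentially. (\<integral>\<^sup>+x. ennreal \<bar>s N x - G x\<bar> \<partial>M) \<le> ennreal e"
proof -
  interpret finite_measure M by (rule M)
  define H where "H N = midhull (g ` {N..})" for N
  have Hmono: "f \<in> H N \<Longrightarrow> N' \<le> N \<Longrightarrow> f \<in> H N'" for f N N'
    unfolding H_def by (erule midhull_mono[rotated]) auto
  have Hm: "f \<in> borel_measurable M" if "f \<in> H N" for f N
    using that unfolding H_def by (rule midhull_measurable) auto
  have Hp: "(\<integral>\<^sup>+x. ennreal (\<bar>f x\<bar> powr p) \<partial>M) \<le> ennreal A" if "f \<in> H N" for f N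
    using that unfolding H_def by (rule midhull_powr_le) (use p bound in auto)
  have Hip: "integrable M (\<lambda>x. \<bar>f x\<bar> powr p)" if "f \<in> H N" for f N
    using Hm[OF that] Hp[OF that] by (intro integrableI_bounded) (auto intro: le_less_trans)
  have Hb: "integrable M (\<lambda>x. bracket p (f x))" if "f \<in> H N" for f N
  proof (rule Bochner_Integration.integrable_bound)
    show "integrable M (\<lambda>x. 2 * (1 + \<bar>f x\<bar> powr p))" using Hip[OF that] by simp
    show "(\<lambda>x. bracket p (f x)) \<in> borel_measurable M" using Hm[OF that] by measurable
    show "AE x in M. norm (bracket p (f x)) \<le> norm (2 * (1 + \<bar>f x\<bar> powr p))"
      using bracket_le[of p] bracket_pos[of p] p by (intro AE_I2) (auto simp: less_imp_le)
  qed
  have Hi: "integrable M f" if "f \<in> H N" for f N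
  proof (rule Bochner_Integration.integrable_bound[OF Hb[OF that] Hm[OF that]])
    show "AE x in M. norm (f x) \<le> norm (bracket p (f x))"
      using abs_le_bracket[of p] bracket_pos[of p] p by (intro AE_I2) (auto simp: less_imp_le)
  qed
  define J where "J f = (LINT x|M. bracket p (f x))" for f
  define B where "B = 2 * (measure M (space M) + A)"
  have J0: "J f \<ge> 0" for f unfolding J_def by (intro integral_nonneg_AE AE_I2 less_imp_le bracket_pos)
  have JB: "J f \<le> B" if "f \<in> H N" for f N
  proof -
    have "J f \<le> (LINT x|M. 2 * (1 + \<bar>f x\<bar> powr p))"
      unfolding J_def using bracket_le[of p] p by (intro integral_mono Hb[OF that]) (auto simp: Hip[OF that])
    also have "\<dots> = 2 * (measure M (space M) + (LINT x|M. \<bar>f x\<bar> powr p))"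
      using Hip[OF that] by simp
    also have "(LINT x|M. \<bar>f x\<bar> powr p) \<le> A"
      using Hp[OF that] A nn_integral_eq_integral[OF Hip[OF that]] by simp
    finally show ?thesis by (simp add: B_def)
  qed
  \<comment> \<open>The hulls of the tails shrink as \<open>N\<close> grows, so these infima
    increase; being bounded by \<open>B\<close>, they converge.\<close>
  define d where "d N = Inf (J ` H N)" for N
  have Hne: "H N \<noteq> {}" for N unfolding H_def using midhull.base[of "g N" "g ` {N..}"] by auto
  have bdd: "bdd_below (J ` H N)" for N using J0 by (intro bdd_belowI[of _ 0]) auto
  have dle: "d N \<le> J f" if "f \<in> H N" for f N unfolding d_def using that bdd by (intro cInf_lower) auto
  have dinc: "incseq d"
    unfolding d_def by (intro incseq_SucI cInf_superset_mono) (use Hne bdd Hmono in auto)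
  have dB: "d N \<le> B" for N using Hne[of N] dle JB by (meson all_not_in_conv order_trans)
  obtain D where D: "d \<longlonglongrightarrow> D" using incseq_convergent[OF dinc, of B] dB by blast
  have dD: "d N \<le> D" for N by (rule incseq_le[OF dinc D])
  have "\<exists>f. f \<in> H N \<and> J f < d N + 1 / Suc N" for N
  proof -
    have "Inf (J ` H N) < d N + 1 / Suc N" by (simp add: d_def)
    then show ?thesis using cInf_lessD[of "J ` H N"] Hne[of N] by auto
  qed
  then obtain h where h: "\<And>N. h N \<in> H N" "\<And>N. J (h N) < d N + 1 / Suc N" by metis
  define k where "k = 4 / (p * (p - 1))"
  have k: "k > 0" using p by (simp add: k_def)
  \<comment> \<open>The midpoint of \<open>h N\<close> and \<open>h N'\<close> lies in
    \<open>H N\<close>, so its \<open>J\<close> is at least \<open>d N\<close>, while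
    \<open>J (h N)\<close> and \<open>J (h N')\<close> exceed \<open>d N\<close> and
    \<open>D\<close> by at most \<open>1 / Suc N\<close>. This bounds the convexity gap; the term
    \<open>B / L\<close> comes from the brackets.\<close>
  have hdiff: "(LINT x|M. \<bar>h N x - h N' x\<bar>) \<le> L * k * ((D - d N) / 2 + 1 / Suc N) + B / L"
    if "N \<le> N'" "L > 0" for N N' L
  proof -
    have hN': "h N' \<in> H N" using Hmono[OF h(1) that(1)] .
    have mid: "(\<lambda>x. (h N x + h N' x) / 2) \<in> H N"
      using h(1)[of N] hN' unfolding H_def by (rule midhull.mid)
    note i = Hb[OF h(1)[of N]] Hb[OF hN'] Hb[OF mid]
    have "(LINT x|M. \<bar>h N x - h N' x\<bar>)
      \<le> (LINT x|M. L * k * ((bracket p (h N x) + bracket p (h N' x)) / 2 - bracket p ((h N x + h N' x) / 2))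
          + 1 / (2 * L) * (bracket p (h N x) + bracket p (h N' x)))"
    proof (rule integral_mono)
      show "integrable M (\<lambda>x. \<bar>h N x - h N' x\<bar>)" using Hi[OF h(1)] by simp
      show "\<bar>h N x - h N' x\<bar> \<le> L * k * ((bracket p (h N x) + bracket p (h N' x)) / 2 - bracket p ((h N x + h N' x) / 2))
          + 1 / (2 * L) * (bracket p (h N x) + bracket p (h N' x))" for x
      proof -
        have "L / 2 * (8 / (p * (p - 1))) = L * k" by (simp add: k_def)
        then show ?thesis using abs_diff_le_bracket_gap[OF p that(2), of "h N x" "h N' x"] by simp
      qed
    qed (use i in auto)
    also have "\<dots> = L * k * ((J (h N) + J (h N')) / 2 - J (\<lambda>x. (h N x + h N' x) / 2)) + 1 / (2 * L) * (J (h N) + J (h N'))"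
      unfolding J_def using i by simp
    also have "\<dots> \<le> L * k * ((D - d N) / 2 + 1 / Suc N) + 1 / (2 * L) * (B + B)"
    proof (intro add_mono mult_left_mono)
      define y where "y = J (\<lambda>x. (h N x + h N' x) / 2)"
      define a where "a = 1 / real (Suc N)"
      define a' where "a' = 1 / real (Suc N')"
      have "a' \<le> a" using that(1) unfolding a_def a'_def by (intro divide_left_mono) auto
      then show "(J (h N) + J (h N')) / 2 - J (\<lambda>x. (h N x + h N' x) / 2) \<le> (D - d N) / 2 + 1 / Suc N"
        using h(2)[of N] h(2)[of N'] dle[OF mid] dD[of N']
        unfolding y_def[symmetric] a_def[symmetric] a'_def[symmetric]
        by (simp add: field_simps)
    qed (use k that JB[OF h(1)] in auto)
    finally show ?thesis using that by simp
  qed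
  have cauchy: "\<exists>N. \<forall>i\<ge>N. \<forall>j\<ge>N. (LINT x|M. norm (h i x - h j x)) < e" if e: "e > 0" for e
  proof -
    \<comment> \<open>\<open>L\<close> is fixed first, to make \<open>B / L\<close> smaller than
      \<open>e\<close>; then \<open>N\<close> is taken large enough for the gap term, whose limit is
      0.\<close>
    define L where "L = 2 * (\<bar>B\<bar> + 1) / e"
    have L: "L > 0" using e by (simp add: L_def)
    have BL: "B / L < e / 2 + 0"
    proof -
      have "B * 2 < e * L" using e by (simp add: L_def)
      then show ?thesis using L by (simp add: field_simps)
    qed
    have "(\<lambda>N. L * k * ((D - d N) / 2 + 1 / Suc N) + B / L) \<longlonglongrightarrow> L * k * ((D - D) / 2 + 0) + B / L"
      by (intro tendsto_intros D LIMSEQ_inverse_real_of_nat[unfolded inverse_eq_divide]) (use L in auto)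
    then have "\<forall>\<^sub>F N in sequentially. L * k * ((D - d N) / 2 + 1 / Suc N) + B / L < e"
    proof (rule order_tendstoD(2))
      have "B / L < e" using BL e by linarith
      then show "L * k * ((D - D) / 2 + 0) + B / L < e" by simp
    qed
    then obtain N where N: "\<And>i. i \<ge> N \<Longrightarrow> L * k * ((D - d i) / 2 + 1 / Suc i) + B / L < e"
      by (auto simp: eventually_sequentially)
    show ?thesis
    proof (intro exI allI impI)
      fix i j assume ij: "i \<ge> N" "j \<ge> N"
      show "(LINT x|M. norm (h i x - h j x)) < e"
      proof (cases "i \<le> j")
        case True
        then show ?thesis using hdiff[OF True L] N[OF ij(1)] by simp
      next
        case False
        then show ?thesis using hdiff[of j i, OF _ L] N[OF ij(2)] by (simp add: abs_minus_commute)
      qed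
    qed
  qed
  obtain r where r: "strict_mono r" "AE x in M. Cauchy (\<lambda>i. h (r i) x)"
    by (rule cauchy_L1_AE_cauchy_subseq[OF Hi[OF h(1)] cauchy])
  define G where "G x = lim (\<lambda>i. h (r i) x)" for x
  have hm [measurable]: "h i \<in> borel_measurable M" for i by (rule Hm[OF h(1)])
  have Gm [measurable]: "G \<in> borel_measurable M"
    unfolding G_def by (rule borel_measurable_lim_metric) simp
  have Glim: "AE x in M. (\<lambda>i. h (r i) x) \<longlonglongrightarrow> G x"
    using r(2) by eventually_elim (simp add: G_def Cauchy_convergent_iff convergent_LIMSEQ_iff)
  show thesis
  proof (rule that)
    show "h (r N) \<in> midhull (g ` {N..})" for N
      using Hmono[OF h(1) seq_suble[OF r(1)]] by (simp add: H_def)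
    show "AE x in M. (\<lambda>N. h (r N) x) \<longlonglongrightarrow> G x" by (rule Glim)
    fix e :: real assume e: "e > 0"
    obtain N where N: "\<And>i j. i \<ge> N \<Longrightarrow> j \<ge> N \<Longrightarrow> (LINT x|M. norm (h i x - h j x)) < e"
      using cauchy[OF e] by blast
    \<comment> \<open>Fatou's lemma: convergence almost everywhere of a subsequence that is Cauchy
      in L1 becomes convergence in L1.\<close>
    have "(\<integral>\<^sup>+x. ennreal \<bar>h (r i) x - G x\<bar> \<partial>M) \<le> ennreal e" if i: "i \<ge> N" for i
    proof -
      have "(\<integral>\<^sup>+x. ennreal \<bar>h (r i) x - G x\<bar> \<partial>M) = (\<integral>\<^sup>+x. liminf (\<lambda>j. ennreal \<bar>h (r i) x - h (r j) x\<bar>) \<partial>M)"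
      proof (rule nn_integral_cong_AE)
        show "AE x in M. ennreal \<bar>h (r i) x - G x\<bar> = liminf (\<lambda>j. ennreal \<bar>h (r i) x - h (r j) x\<bar>)"
          using Glim
        proof eventually_elim
          case (elim x)
          then have "(\<lambda>j. ennreal \<bar>h (r i) x - h (r j) x\<bar>) \<longlonglongrightarrow> ennreal \<bar>h (r i) x - G x\<bar>"
            by (intro tendsto_ennrealI tendsto_intros)
          then show ?case by (intro lim_imp_Liminf[symmetric]) auto
        qed
      qed
      also have "\<dots> \<le> liminf (\<lambda>j. \<integral>\<^sup>+x. ennreal \<bar>h (r i) x - h (r j) x\<bar> \<partial>M)"
        by (rule nn_integral_liminf) measurable
      also have "\<dots> \<le> ennreal e"
      proof (rule Liminf_le)
        show "\<forall>\<^sub>F j in sequentially. (\<integral>\<^sup>+x. ennreal \<bar>h (r i) x - h (r j) x\<bar> \<partial>M) \<le> ennreal e"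
          unfolding eventually_sequentially
        proof (intro exI allI impI)
          fix j assume "j \<ge> N"
          then have "(LINT x|M. norm (h (r i) x - h (r j) x)) < e"
            using i seq_suble[OF r(1)] by (intro N) (meson order_trans)+
          moreover have "(\<integral>\<^sup>+x. ennreal \<bar>h (r i) x - h (r j) x\<bar> \<partial>M) = ennreal (LINT x|M. \<bar>h (r i) x - h (r j) x\<bar>)"
            using Hi[OF h(1)] by (intro nn_integral_eq_integral) auto
          ultimately show "(\<integral>\<^sup>+x. ennreal \<bar>h (r i) x - h (r j) x\<bar> \<partial>M) \<le> ennreal e"
            by (simp add: ennreal_leI)
        qed
      qed auto
      finally show ?thesis .
    qed
    then show "\<forall>\<^sub>F N in sequentially. (\<integral>\<^sup>+x. ennreal \<bar>h (r N) x - G x\<bar> \<partial>M) \<le> ennreal e"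
      by (auto simp: eventually_sequentially)
  qed measurable
qed

section \<open>Weak derivatives from bounded difference quotients\<close>

text \<open>With \<open>r = 2\<^sup>k\<close>, this is comparable to \<open>r\<^bsup>-n\<^esup> (1 + \<bar>x\<bar> / r)\<^bsup>-n-1\<^esup>\<close>, but its integral needs only volumes of balls.\<close>

definition majorant :: "int \<Rightarrow> 'a::euclidean_space \<Rightarrow> ennreal" where
  "majorant k x = (\<Sum>m. ennreal ((1/2) ^ (m * Suc DIM('a)) / (2 powi k) ^ DIM('a)) * indicator (ball 0 (2 ^ m * 2 powi k)) x)"

lemma borel_measurable_majorant [measurable]: "majorant k \<in> borel_measurable borel"
  unfolding majorant_def by measurable

lemma suminf_half_power: "(\<Sum>m. ennreal ((1/2) ^ m * b)) = ennreal (2 * b)" if "b \<ge> 0"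
proof -
  have "(\<lambda>m. (1/2::real) ^ m * b) sums (2 * b)"
    using sums_mult2[OF geometric_sums[of "1/2::real"], of b] by simp
  then show ?thesis using that by (subst suminf_ennreal2) (auto simp: sums_iff)
qed

text \<open>The m-th ball has \<open>(2 ^ m * r) ^ n\<close> times the volume of the unit ball, so
  the m-th term contributes \<open>(1/2) ^ m\<close> times that volume, whatever the scale.\<close>

lemma nn_integral_majorant:
  "(\<integral>\<^sup>+x. majorant k (x::'a::euclidean_space) \<partial>lborel) = ennreal (2 * vball TYPE('a) 1)"
proof -
  let ?n = "DIM('a)"
  define r :: real where "r = 2 powi k"
  have r: "r > 0" by (simp add: r_def)
  have "(\<integral>\<^sup>+x. majorant k (x::'a) \<partial>lborel)
    = (\<Sum>m. \<integral>\<^sup>+x. ennreal ((1/2) ^ (m * Suc ?n) / r ^ ?n) * indicator (ball (0::'a) (2 ^ m * r)) x \<partial>lborel)"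
    unfolding majorant_def r_def by (rule nn_integral_suminf) measurable
  also have "\<dots> = (\<Sum>m. ennreal ((1/2) ^ m * vball TYPE('a) 1))"
  proof (intro suminf_cong)
    fix m
    have "(1/2::real) ^ (m * Suc ?n) / r ^ ?n * ((2 ^ m * r) ^ ?n * vball TYPE('a) 1) = (1/2) ^ m * vball TYPE('a) 1"
    proof -
      have "(1/2::real) ^ (m * Suc ?n) = (1/2) ^ m * (1/2) ^ (m * ?n)" by (simp add: power_add)
      moreover have "(2 ^ m * r) ^ ?n = 2 ^ (m * ?n) * r ^ ?n" by (simp add: power_mult_distrib power_mult)
      moreover have "(1/2::real) ^ (m * ?n) * 2 ^ (m * ?n) = 1" by (simp add: power_mult_distrib[symmetric])
      ultimately show ?thesis using r by (simp add: field_simps)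
    qed
    moreover have "(\<integral>\<^sup>+x. ennreal ((1/2) ^ (m * Suc ?n) / r ^ ?n) * indicator (ball (0::'a) (2 ^ m * r)) x \<partial>lborel)
      = ennreal ((1/2) ^ (m * Suc ?n) / r ^ ?n * ((2 ^ m * r) ^ ?n * vball TYPE('a) 1))"
    proof -
      have em: "emeasure lborel (ball (0::'a) (2 ^ m * r)) = ennreal ((2 ^ m * r) ^ ?n * vball TYPE('a) 1)"
        using r vball_scale[of "2 ^ m * r", where 'a='a] by (simp add: emeasure_vball)
      show ?thesis
        using r by (subst nn_integral_cmult_indicator, simp, subst em, intro ennreal_mult'[symmetric]) simp
    qed
    ultimately show "(\<integral>\<^sup>+x. ennreal ((1/2) ^ (m * Suc ?n) / r ^ ?n) * indicator (ball (0::'a) (2 ^ m * r)) x \<partial>lborel)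
      = ennreal ((1/2) ^ m * vball TYPE('a) 1)" by simp
  qed
  also have "\<dots> = ennreal (2 * vball TYPE('a) 1)" by (intro suminf_half_power) simp
  finally show ?thesis .
qed

lemma majorant_le: "majorant k (x::'a::euclidean_space) \<le> ennreal (2 / (2 powi k) ^ DIM('a))"
proof -
  have "majorant k x \<le> (\<Sum>m. ennreal ((1/2) ^ m * (1 / (2 powi k) ^ DIM('a))))"
    unfolding majorant_def
  proof (intro suminf_le summableI)
    fix m
    have "(1/2::real) ^ (m * Suc DIM('a)) \<le> (1/2) ^ m" by (intro power_decreasing) auto
    then have "(1/2) ^ (m * Suc DIM('a)) / (2 powi k) ^ DIM('a) \<le> (1/2::real) ^ m * (1 / (2 powi k) ^ DIM('a))"
      by (simp add: divide_right_mono)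
    then show "ennreal ((1/2) ^ (m * Suc DIM('a)) / (2 powi k) ^ DIM('a)) * indicator (ball 0 (2 ^ m * 2 powi k)) x
      \<le> ennreal ((1/2) ^ m * (1 / (2 powi k) ^ DIM('a)))"
      by (auto simp: indicator_def intro!: ennreal_leI)
  qed
  also have "\<dots> = ennreal (2 * (1 / (2 powi k) ^ DIM('a)))" by (intro suminf_half_power) simp
  finally show ?thesis by simp
qed

lemma majorant_ge:
  assumes "norm (x::'a::euclidean_space) < 2 ^ m * 2 powi k"
  shows "ennreal ((1/2) ^ (m * Suc DIM('a)) / (2 powi k) ^ DIM('a)) \<le> majorant k x"
proof -
  define f where "f i = ennreal ((1/2) ^ (i * Suc DIM('a)) / (2 powi k) ^ DIM('a)) * indicator (ball 0 (2 ^ i * 2 powi k)) x" for i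
  have "sum f {m} \<le> suminf f" by (intro sum_le_suminf) auto
  moreover have "sum f {m} = ennreal ((1/2) ^ (m * Suc DIM('a)) / (2 powi k) ^ DIM('a))"
    using assms by (simp add: f_def)
  moreover have "suminf f = majorant k x" unfolding majorant_def f_def ..
  ultimately show ?thesis by (simp only:)
qed

section \<open>Pairing difference quotients with test functions\<close>

lemma loc_int_mult_bounded:
  fixes h :: "'a::euclidean_space \<Rightarrow> real"
  assumes h: "loc_int h" and [measurable]: "h \<in> borel_measurable borel" "\<phi> \<in> borel_measurable borel"
    and C: "\<And>x. \<bar>\<phi> x\<bar> \<le> C" and R: "\<And>x. norm x \<ge> R \<Longrightarrow> \<phi> x = 0"
  shows "integrable lborel (\<lambda>x. h x * \<phi> x)"
proof (rule Bochner_Integration.integrable_bound)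
  show "integrable lborel (\<lambda>x. C * (indicator (ball 0 R) x * h x))"
    using h by (intro integrable_mult_right) (simp add: loc_int_def)
  show "AE x in lborel. norm (h x * \<phi> x) \<le> norm (C * (indicator (ball 0 R) x * h x))"
  proof (intro AE_I2)
    fix x
    have C0: "C \<ge> 0" using C[of 0] by linarith
    show "norm (h x * \<phi> x) \<le> norm (C * (indicator (ball 0 R) x * h x))"
    proof (cases "norm x < R")
      case True
      have "\<bar>h x\<bar> * \<bar>\<phi> x\<bar> \<le> \<bar>h x\<bar> * C" by (intro mult_left_mono C) auto
      then show ?thesis using True C0 by (simp add: abs_mult mult.commute)
    next
      case False
      then show ?thesis using R[of x] by simp
    qed
  qed
qed measurable

lemma bounded_compact_support:
  fixes \<psi> :: "'a::euclidean_space \<Rightarrow> real"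
  assumes "continuous_on UNIV \<psi>" "\<And>x. norm x \<ge> R \<Longrightarrow> \<psi> x = 0"
  obtains C where "C \<ge> 0" "\<And>x. \<bar>\<psi> x\<bar> \<le> C"
proof -
  have "bounded (\<psi> ` cball 0 R)"
    by (intro compact_imp_bounded compact_continuous_image continuous_on_subset[OF assms(1)]) auto
  then obtain C where C: "\<forall>x\<in>cball 0 R. norm (\<psi> x) \<le> C" by (auto simp: bounded_iff)
  have "\<bar>\<psi> x\<bar> \<le> \<bar>C\<bar>" for x
    using assms(2)[of x] C[rule_format, of x] by (cases "norm x \<ge> R") auto
  then show thesis using that[of "\<bar>C\<bar>"] by auto
qed

lemma difference_quotient_tendsto:
  fixes \<psi> :: "'a::euclidean_space \<Rightarrow> real"
  assumes d: "\<And>x. ((\<lambda>t. \<psi> (x + t *\<^sub>R e)) has_real_derivative \<psi>' x) (at 0)"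
  shows "(\<lambda>m. 2 ^ m * (\<psi> (x - (1 / 2 ^ m) *\<^sub>R e) - \<psi> x)) \<longlonglongrightarrow> - \<psi>' x"
    and "(\<And>x. \<bar>\<psi>' x\<bar> \<le> C) \<Longrightarrow> \<bar>2 ^ m * (\<psi> (x - (1 / 2 ^ m) *\<^sub>R e) - \<psi> x)\<bar> \<le> C"
proof -
  have "((\<lambda>t. (\<psi> (x + t *\<^sub>R e) - \<psi> x) / t) \<longlongrightarrow> \<psi>' x) (at 0)"
    using d[of x] unfolding DERIV_def by simp
  moreover have "filterlim (\<lambda>m. - ((1/2::real) ^ m)) (at 0) sequentially"
    unfolding filterlim_at
  proof (intro conjI)
    have "(\<lambda>m. - ((1/2::real) ^ m)) \<longlonglongrightarrow> - 0"
      by (intro tendsto_minus LIMSEQ_realpow_zero) auto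
    then show "(\<lambda>m. - ((1/2::real) ^ m)) \<longlonglongrightarrow> 0" by simp
  qed auto
  ultimately have "(\<lambda>m. (\<psi> (x + (- ((1/2::real) ^ m)) *\<^sub>R e) - \<psi> x) / (- ((1/2::real) ^ m))) \<longlonglongrightarrow> \<psi>' x"
    by (rule filterlim_compose)
  from tendsto_minus[OF this]
  show "(\<lambda>m. 2 ^ m * (\<psi> (x - (1 / 2 ^ m) *\<^sub>R e) - \<psi> x)) \<longlonglongrightarrow> - \<psi>' x"
    by (simp add: power_one_over field_simps)
next
  assume C: "\<And>x. \<bar>\<psi>' x\<bar> \<le> C"
  define \<phi> where "\<phi> t = \<psi> (x + t *\<^sub>R e)" for t
  have D: "DERIV \<phi> t :> \<psi>' (x + t *\<^sub>R e)" for t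
  proof -
    have "DERIV (\<lambda>s. \<phi> (s + t)) 0 :> \<psi>' (x + t *\<^sub>R e)"
      using d[of "x + t *\<^sub>R e"] by (simp add: \<phi>_def scaleR_add_left ac_simps)
    then show ?thesis using DERIV_shift[of \<phi> _ 0 t] by simp
  qed
  define h :: real where "h = 1 / 2 ^ m"
  have h: "h > 0" by (simp add: h_def)
  obtain z where "\<phi> 0 - \<phi> (- h) = (0 - (- h)) * \<psi>' (x + z *\<^sub>R e)"
    using MVT2[of "- h" 0 \<phi> "\<lambda>t. \<psi>' (x + t *\<^sub>R e)"] h D by auto
  then have "\<psi> (x - h *\<^sub>R e) - \<psi> x = - h * \<psi>' (x + z *\<^sub>R e)" by (simp add: \<phi>_def)
  then have "2 ^ m * (\<psi> (x - h *\<^sub>R e) - \<psi> x) = - \<psi>' (x + z *\<^sub>R e)" by (simp add: h_def)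
  then show "\<bar>2 ^ m * (\<psi> (x - (1 / 2 ^ m) *\<^sub>R e) - \<psi> x)\<bar> \<le> C" using C by (simp add: h_def)
qed

text \<open>Discrete integration by parts: a change of variables moves the difference quotient from
  \<open>F\<close> to \<open>\<psi>\<close>, where it converges boundedly with support in a fixed
  ball.\<close>

lemma difference_quotient_weak_limit:
  fixes F :: "'a::euclidean_space \<Rightarrow> real"
  assumes F: "loc_int F" "F \<in> borel_measurable borel"
    and d: "\<And>x. ((\<lambda>t. \<psi> (x + t *\<^sub>R e)) has_real_derivative \<psi>' x) (at 0)"
    and c: "continuous_on UNIV \<psi>" "continuous_on UNIV \<psi>'"
    and R: "\<And>x. norm x \<ge> R \<Longrightarrow> \<psi> x = 0" "\<And>x. norm x \<ge> R \<Longrightarrow> \<psi>' x = 0"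
  shows "integrable lborel (\<lambda>x. (2 ^ m * (F (x + (1 / 2 ^ m) *\<^sub>R e) - F x)) * \<psi> x)"
    and "(\<lambda>m. LINT x|lborel. (2 ^ m * (F (x + (1 / 2 ^ m) *\<^sub>R e) - F x)) * \<psi> x) \<longlonglongrightarrow> - (LINT x|lborel. F x * \<psi>' x)"
proof -
  note [measurable] = F(2) borel_measurable_continuous_onI[OF c(1)] borel_measurable_continuous_onI[OF c(2)]
  obtain C where C: "C \<ge> 0" "\<And>x. \<bar>\<psi> x\<bar> \<le> C" using bounded_compact_support[OF c(1) R(1)] by metis
  obtain C' where C': "C' \<ge> 0" "\<And>x. \<bar>\<psi>' x\<bar> \<le> C'" using bounded_compact_support[OF c(2) R(2)] by metis
  have i1: "integrable lborel (\<lambda>x. F (x + v) * \<psi> x)" for v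
    by (rule loc_int_mult_bounded[OF loc_int_shift[OF F(1)] _ _ C(2) R(1)]) measurable
  have i0: "integrable lborel (\<lambda>x. F x * \<psi> x)" using i1[of 0] by simp
  have "(\<lambda>x. (2 ^ m * (F (x + (1 / 2 ^ m) *\<^sub>R e) - F x)) * \<psi> x)
    = (\<lambda>x. 2 ^ m * (F (x + (1 / 2 ^ m) *\<^sub>R e) * \<psi> x - F x * \<psi> x))" for m
    by (simp add: fun_eq_iff algebra_simps)
  note eq = this
  show "integrable lborel (\<lambda>x. (2 ^ m * (F (x + (1 / 2 ^ m) *\<^sub>R e) - F x)) * \<psi> x)"
    unfolding eq using i1 i0 by simp
  note shift = integral_shift_mult[OF F(2) borel_measurable_continuous_onI[OF c(1)] i1]
  have "(LINT x|lborel. (2 ^ m * (F (x + (1 / 2 ^ m) *\<^sub>R e) - F x)) * \<psi> x)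
    = (LINT x|lborel. F x * (2 ^ m * (\<psi> (x - (1 / 2 ^ m) *\<^sub>R e) - \<psi> x)))" for m
  proof -
    have "(LINT x|lborel. (2 ^ m * (F (x + (1 / 2 ^ m) *\<^sub>R e) - F x)) * \<psi> x)
      = 2 ^ m * ((LINT x|lborel. F (x + (1 / 2 ^ m) *\<^sub>R e) * \<psi> x) - (LINT x|lborel. F x * \<psi> x))"
      unfolding eq using i1 i0 by simp
    also have "\<dots> = (LINT x|lborel. 2 ^ m * (F x * \<psi> (x - (1 / 2 ^ m) *\<^sub>R e) - F x * \<psi> x))"
      using shift(1,2)[of "(1 / 2 ^ m) *\<^sub>R e"] i0 by simp
    also have "\<dots> = (LINT x|lborel. F x * (2 ^ m * (\<psi> (x - (1 / 2 ^ m) *\<^sub>R e) - \<psi> x)))"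
      by (simp add: algebra_simps)
    finally show ?thesis .
  qed
  moreover have "(\<lambda>m. LINT x|lborel. F x * (2 ^ m * (\<psi> (x - (1 / 2 ^ m) *\<^sub>R e) - \<psi> x))) \<longlonglongrightarrow> (LINT x|lborel. F x * (- \<psi>' x))"
  proof (rule integral_dominated_convergence[where w="\<lambda>x. C' * \<bar>indicator (ball 0 (R + norm e)) x * F x\<bar>"])
    show "integrable lborel (\<lambda>x. C' * \<bar>indicator (ball 0 (R + norm e)) x * F x\<bar>)"
      using F(1) unfolding loc_int_def by (intro integrable_mult_right integrable_abs) auto
    show "AE x in lborel. (\<lambda>m. F x * (2 ^ m * (\<psi> (x - (1 / 2 ^ m) *\<^sub>R e) - \<psi> x))) \<longlonglongrightarrow> F x * (- \<psi>' x)"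
      by (intro AE_I2 tendsto_mult tendsto_const difference_quotient_tendsto(1)[OF d])
    show "AE x in lborel. norm (F x * (2 ^ m * (\<psi> (x - (1 / 2 ^ m) *\<^sub>R e) - \<psi> x))) \<le> C' * \<bar>indicator (ball 0 (R + norm e)) x * F x\<bar>" for m
    proof (intro AE_I2)
      fix x
      show "norm (F x * (2 ^ m * (\<psi> (x - (1 / 2 ^ m) *\<^sub>R e) - \<psi> x))) \<le> C' * \<bar>indicator (ball 0 (R + norm e)) x * F x\<bar>"
      proof (cases "norm x < R + norm e")
        case True
        have "\<bar>F x\<bar> * \<bar>2 ^ m * (\<psi> (x - (1 / 2 ^ m) *\<^sub>R e) - \<psi> x)\<bar> \<le> \<bar>F x\<bar> * C'"
          by (intro mult_left_mono difference_quotient_tendsto(2)[OF d C'(2)]) auto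
        then show ?thesis using True by (simp add: abs_mult mult.commute)
      next
        case False
        have "norm ((1 / 2 ^ m) *\<^sub>R e) \<le> norm e"
          by (simp add: divide_le_eq mult_le_cancel_left1)
        moreover have "norm x \<le> norm (x - (1 / 2 ^ m) *\<^sub>R e) + norm ((1 / 2 ^ m) *\<^sub>R e)"
          using norm_triangle_ineq[of "x - (1 / 2 ^ m) *\<^sub>R e" "(1 / 2 ^ m) *\<^sub>R e"] by simp
        ultimately have "norm (x - (1 / 2 ^ m) *\<^sub>R e) \<ge> R" using False by linarith
        moreover have "norm x \<ge> R" using False norm_ge_zero[of e] by linarith
        ultimately show ?thesis using R(1) False by simp
      qed
    qed
  qed measurable
  ultimately show "(\<lambda>m. LINT x|lborel. (2 ^ m * (F (x + (1 / 2 ^ m) *\<^sub>R e) - F x)) * \<psi> x) \<longlonglongrightarrow> - (LINT x|lborel. F x * \<psi>' x)"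
    by simp
qed

text \<open>The pairings of the quotients with a test function converge, and hulls of tails inherit
  the limit because an interval about it is closed under midpoints. Strong convergence of elements
  of these hulls then identifies their limit \<open>G\<close> as the weak derivative.\<close>

lemma weak_derivative_of_bounded_quotients:
  fixes F :: "'a::euclidean_space \<Rightarrow> real" and e :: 'a
  assumes F: "loc_int F" and Fm [measurable]: "F \<in> borel_measurable borel" and p: "1 < p" "p \<le> 2" and A: "A \<ge> 0"
    and bound: "\<And>m::nat. (\<integral>\<^sup>+x. ennreal (\<bar>2 ^ m * (F (x + (1 / 2 ^ m) *\<^sub>R e) - F x)\<bar> powr p) \<partial>lborel) \<le> ennreal A"
  obtains G where "G \<in> borel_measurable borel" "(\<integral>\<^sup>+x. ennreal (\<bar>G x\<bar> powr p) \<partial>lborel) \<le> ennreal A"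
    "\<And>\<psi> \<psi>' R. (\<And>x. ((\<lambda>t. \<psi> (x + t *\<^sub>R e)) has_real_derivative \<psi>' x) (at 0)) \<Longrightarrow>
       continuous_on UNIV \<psi> \<Longrightarrow> continuous_on UNIV \<psi>' \<Longrightarrow>
       (\<And>x. norm x \<ge> R \<Longrightarrow> \<psi> x = 0) \<Longrightarrow> (\<And>x. norm x \<ge> R \<Longrightarrow> \<psi>' x = 0) \<Longrightarrow>
       (LINT x|lborel. F x * \<psi>' x) = - (LINT x|lborel. G x * \<psi> x)"
proof -
  define g where "g m x = 2 ^ m * (F (x + (1 / 2 ^ m) *\<^sub>R e) - F x)" for m x
  have gm [measurable]: "g m \<in> borel_measurable borel" for m unfolding g_def by measurable
  \<comment> \<open>\<open>midhull_convergence\<close> asks for a finite measure. The density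
    \<open>majorant 0\<close> is integrable; it is positive everywhere, so limits almost everywhere
    transfer back to \<open>lborel\<close>; and it is bounded below on every ball.\<close>
  define M :: "'a measure" where "M = density lborel (majorant 0)"
  have setsM [measurable_cong]: "sets M = sets borel" by (simp add: M_def)
  have Mfin: "finite_measure M"
    by (rule finite_measureI) (simp add: M_def emeasure_density nn_integral_majorant)
  have nnM: "(\<integral>\<^sup>+x. h x \<partial>M) = (\<integral>\<^sup>+x. majorant 0 x * h x \<partial>lborel)" if "h \<in> borel_measurable borel" for h
    using that unfolding M_def by (subst nn_integral_density) auto
  have boundM: "(\<integral>\<^sup>+x. ennreal (\<bar>g m x\<bar> powr p) \<partial>M) \<le> ennreal (2 * A)" for m
  proof -
    have "(\<integral>\<^sup>+x. ennreal (\<bar>g m x\<bar> powr p) \<partial>M) \<le> (\<integral>\<^sup>+x. ennreal 2 * ennreal (\<bar>g m x\<bar> powr p) \<partial>lborel)"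
      using majorant_le[of 0] by (subst nnM) (auto intro!: nn_integral_mono mult_right_mono)
    also have "\<dots> = ennreal 2 * (\<integral>\<^sup>+x. ennreal (\<bar>g m x\<bar> powr p) \<partial>lborel)"
      by (rule nn_integral_cmult) measurable
    also have "\<dots> \<le> ennreal 2 * ennreal A"
      using bound[of m] by (intro mult_left_mono) (auto simp: g_def)
    also have "\<dots> = ennreal (2 * A)" using A by (intro ennreal_mult'[symmetric]) simp
    finally show ?thesis .
  qed
  obtain s G where s: "\<And>N. s N \<in> midhull (g ` {N..})" and GM: "G \<in> borel_measurable M"
    and lim: "AE x in M. (\<lambda>N. s N x) \<longlonglongrightarrow> G x"
    and L1: "\<And>e. e > 0 \<Longrightarrow> \<forall>\<^sub>F N in sequentially. (\<integral>\<^sup>+x. ennreal \<bar>s N x - G x\<bar> \<partial>M) \<le> ennreal e"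
    by (rule midhull_convergence[where g=g and A="2 * A", OF Mfin _ p boundM]) (use A in auto)
  have Gm [measurable]: "G \<in> borel_measurable borel" using GM setsM by (simp cong: measurable_cong_sets)
  have sm [measurable]: "s N \<in> borel_measurable borel" for N
    by (rule midhull_measurable[OF s]) auto
  have sp: "(\<integral>\<^sup>+x. ennreal (\<bar>s N x\<bar> powr p) \<partial>lborel) \<le> ennreal A" for N
    by (rule midhull_powr_le[OF s]) (use p bound in \<open>auto simp: g_def\<close>)
  have pos: "majorant 0 x > 0" for x :: 'a
  proof -
    obtain m where m: "norm x < 2 ^ m" using real_arch_pow[of 2] by auto
    have "0 < ennreal ((1/2) ^ (m * Suc DIM('a)) / (2 powi 0) ^ DIM('a))" by simp
    also have "\<dots> \<le> majorant 0 x" using m by (intro majorant_ge) simp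
    finally show ?thesis .
  qed
  have lim': "AE x in lborel. (\<lambda>N. s N x) \<longlonglongrightarrow> G x"
    using lim pos unfolding M_def by (subst (asm) AE_density) auto
  have "(\<integral>\<^sup>+x. ennreal (\<bar>G x\<bar> powr p) \<partial>lborel) = (\<integral>\<^sup>+x. liminf (\<lambda>N. ennreal (\<bar>s N x\<bar> powr p)) \<partial>lborel)"
  proof (rule nn_integral_cong_AE)
    show "AE x in lborel. ennreal (\<bar>G x\<bar> powr p) = liminf (\<lambda>N. ennreal (\<bar>s N x\<bar> powr p))"
      using lim'
    proof eventually_elim
      case (elim x)
      then have "(\<lambda>N. ennreal (\<bar>s N x\<bar> powr p)) \<longlonglongrightarrow> ennreal (\<bar>G x\<bar> powr p)"
        using p by (intro tendsto_ennrealI tendsto_powr2 tendsto_rabs tendsto_const) auto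
      then show ?case by (intro lim_imp_Liminf[symmetric]) auto
    qed
  qed
  also have "\<dots> \<le> liminf (\<lambda>N. \<integral>\<^sup>+x. ennreal (\<bar>s N x\<bar> powr p) \<partial>lborel)"
    by (rule nn_integral_liminf) measurable
  also have "\<dots> \<le> ennreal A" by (rule Liminf_le) (auto simp: sp)
  finally have Gp: "(\<integral>\<^sup>+x. ennreal (\<bar>G x\<bar> powr p) \<partial>lborel) \<le> ennreal A" .
  show thesis
  proof (rule that[OF Gm Gp])
    fix \<psi> \<psi>' :: "'a \<Rightarrow> real" and R
    assume d: "\<And>x. ((\<lambda>t. \<psi> (x + t *\<^sub>R e)) has_real_derivative \<psi>' x) (at 0)"
      and c: "continuous_on UNIV \<psi>" "continuous_on UNIV \<psi>'"
      and R: "\<And>x. norm x \<ge> R \<Longrightarrow> \<psi> x = 0" "\<And>x. norm x \<ge> R \<Longrightarrow> \<psi>' x = 0"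
    note [measurable] = borel_measurable_continuous_onI[OF c(1)]
    note dq = difference_quotient_weak_limit[OF F Fm d c R]
    define l where "l = - (LINT x|lborel. F x * \<psi>' x)"
    obtain C where C: "C \<ge> 0" "\<And>x. \<bar>\<psi> x\<bar> \<le> C" using bounded_compact_support[OF c(1) R(1)] by metis
    obtain m where m: "R < 2 ^ m" using real_arch_pow[of 2] by auto
    \<comment> \<open>A lower bound of \<open>majorant 0\<close> on the ball of radius
      \<open>R\<close>, outside which \<open>\<psi>\<close> vanishes. It converts L1 convergence in
      \<open>M\<close> into convergence of the pairings.\<close>
    define \<kappa> :: real where "\<kappa> = (1/2) ^ (m * Suc DIM('a))"
    have \<kappa>: "\<kappa> > 0" by (simp add: \<kappa>_def)
    have hull: "integrable lborel (\<lambda>x. f x * \<psi> x) \<and> \<bar>(LINT x|lborel. f x * \<psi> x) - l\<bar> \<le> \<epsilon>"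
      if f: "f \<in> midhull (g ` {N..})" and N: "\<And>i. i \<ge> N \<Longrightarrow> \<bar>(LINT x|lborel. g i x * \<psi> x) - l\<bar> \<le> \<epsilon>" for f N \<epsilon>
      using f
    proof induction
      case (base f)
      then show ?case using dq(1) N by (auto simp: g_def)
    next
      case (mid f h)
      have "(\<lambda>x. (f x + h x) / 2 * \<psi> x) = (\<lambda>x. (f x * \<psi> x + h x * \<psi> x) / 2)"
        by (simp add: fun_eq_iff field_simps)
      moreover have "integrable lborel (\<lambda>x. f x * \<psi> x)" "integrable lborel (\<lambda>x. h x * \<psi> x)"
        and b: "\<bar>(LINT x|lborel. f x * \<psi> x) - l\<bar> \<le> \<epsilon>" "\<bar>(LINT x|lborel. h x * \<psi> x) - l\<bar> \<le> \<epsilon>"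
        using mid by auto
      moreover have "\<bar>((LINT x|lborel. f x * \<psi> x) + (LINT x|lborel. h x * \<psi> x)) / 2 - l\<bar> \<le> \<epsilon>"
        using b unfolding abs_le_iff by (simp add: field_simps)
      ultimately show ?case by simp
    qed
    \<comment> \<open>For \<open>N = 0\<close> a bound on the whole convergent sequence of pairings
      is enough to draw integrability from \<open>hull\<close>.\<close>
    have si: "integrable lborel (\<lambda>x. s N x * \<psi> x)" for N
    proof -
      have "s N \<in> midhull (g ` {0..})" using midhull_mono[OF _ s[of N], of "g ` {0..}"] by auto
      moreover have "convergent (\<lambda>i. LINT x|lborel. g i x * \<psi> x)"
        using dq(2) unfolding g_def by (auto simp: convergent_def)
      then have "Bseq (\<lambda>i. (LINT x|lborel. g i x * \<psi> x) - l)"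
        by (intro convergent_imp_Bseq convergent_diff convergent_const)
      then obtain B where "\<And>i. \<bar>(LINT x|lborel. g i x * \<psi> x) - l\<bar> \<le> B" by (auto simp: Bseq_def)
      ultimately show ?thesis using hull by blast
    qed
    have glim: "(\<lambda>i. LINT x|lborel. g i x * \<psi> x) \<longlonglongrightarrow> l"
      unfolding g_def l_def by (rule dq(2))
    have slim: "(\<lambda>N. LINT x|lborel. s N x * \<psi> x) \<longlonglongrightarrow> l"
      unfolding LIMSEQ_iff
    proof (intro allI impI)
      fix \<epsilon> :: real assume "\<epsilon> > 0"
      then obtain N where N: "\<And>i. i \<ge> N \<Longrightarrow> \<bar>(LINT x|lborel. g i x * \<psi> x) - l\<bar> < \<epsilon> / 2"
        using LIMSEQ_D[OF glim, of "\<epsilon> / 2"] by auto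
      have "\<bar>(LINT x|lborel. s i x * \<psi> x) - l\<bar> < \<epsilon>" if "i \<ge> N" for i
      proof -
        have "\<bar>(LINT x|lborel. s i x * \<psi> x) - l\<bar> \<le> \<epsilon> / 2"
          using hull[OF s[of i], of "\<epsilon> / 2"] N that by (meson less_imp_le order_trans)
        then show ?thesis using \<open>\<epsilon> > 0\<close> by linarith
      qed
      then show "\<exists>N. \<forall>i\<ge>N. norm ((LINT x|lborel. s i x * \<psi> x) - l) < \<epsilon>" by auto
    qed
    have diff: "\<forall>\<^sub>F N in sequentially. (\<integral>\<^sup>+x. ennreal \<bar>(s N x - G x) * \<psi> x\<bar> \<partial>lborel) \<le> ennreal \<epsilon>" if "\<epsilon> > 0" for \<epsilon>
    proof -
      have "\<epsilon> * \<kappa> / (C + 1) > 0" using that \<kappa> C by (simp add: add_nonneg_pos)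
      from L1[OF this] show ?thesis
      proof eventually_elim
        case (elim N)
        have "(\<integral>\<^sup>+x. ennreal \<bar>(s N x - G x) * \<psi> x\<bar> \<partial>lborel)
          \<le> (\<integral>\<^sup>+x. ennreal ((C + 1) / \<kappa>) * (majorant 0 x * ennreal \<bar>s N x - G x\<bar>) \<partial>lborel)"
        proof (intro nn_integral_mono)
          fix x
          show "ennreal \<bar>(s N x - G x) * \<psi> x\<bar> \<le> ennreal ((C + 1) / \<kappa>) * (majorant 0 x * ennreal \<bar>s N x - G x\<bar>)"
          proof (cases "norm x < R")
            case True
            have "ennreal \<bar>(s N x - G x) * \<psi> x\<bar> \<le> ennreal ((C + 1) * \<bar>s N x - G x\<bar>)"
            proof (rule ennreal_leI)
              have "\<bar>\<psi> x\<bar> * \<bar>s N x - G x\<bar> \<le> (C + 1) * \<bar>s N x - G x\<bar>"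
                using C(2)[of x] by (intro mult_right_mono) auto
              then show "\<bar>(s N x - G x) * \<psi> x\<bar> \<le> (C + 1) * \<bar>s N x - G x\<bar>"
                by (simp only: abs_mult mult.commute)
            qed
            also have "\<dots> = ennreal ((C + 1) / \<kappa>) * (ennreal \<kappa> * ennreal \<bar>s N x - G x\<bar>)"
              using C \<kappa> by (simp add: ennreal_mult'[symmetric])
            also have "ennreal \<kappa> \<le> majorant 0 x"
              using majorant_ge[of x m 0] True m by (simp add: \<kappa>_def)
            finally show ?thesis by (simp add: mult_left_mono mult_right_mono)
          qed (simp add: R)
        qed
        also have "\<dots> = ennreal ((C + 1) / \<kappa>) * (\<integral>\<^sup>+x. ennreal \<bar>s N x - G x\<bar> \<partial>M)"
          by (subst nn_integral_cmult) (auto simp: nnM)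
        also have "\<dots> \<le> ennreal ((C + 1) / \<kappa>) * ennreal (\<epsilon> * \<kappa> / (C + 1))" by (intro mult_left_mono elim) auto
        also have "\<dots> = ennreal ((C + 1) / \<kappa> * (\<epsilon> * \<kappa> / (C + 1)))"
          using C \<kappa> that by (intro ennreal_mult'[symmetric]) auto
        also have "(C + 1) / \<kappa> * (\<epsilon> * \<kappa> / (C + 1)) = \<epsilon>" using C \<kappa> by simp
        finally show ?case .
      qed
    qed
    have Gi: "integrable lborel (\<lambda>x. G x * \<psi> x)"
    proof -
      obtain N where "(\<integral>\<^sup>+x. ennreal \<bar>(s N x - G x) * \<psi> x\<bar> \<partial>lborel) \<le> ennreal 1"
        using diff[of 1] by (auto simp: eventually_sequentially)
      then have "(\<integral>\<^sup>+x. ennreal \<bar>(s N x - G x) * \<psi> x\<bar> \<partial>lborel) < \<infinity>" by (rule le_less_trans) simp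
      then have "integrable lborel (\<lambda>x. (s N x - G x) * \<psi> x)" by (intro integrableI_bounded) auto
      from Bochner_Integration.integrable_diff[OF si[of N] this] show ?thesis by (simp add: algebra_simps)
    qed
    have "(\<lambda>N. LINT x|lborel. s N x * \<psi> x) \<longlonglongrightarrow> (LINT x|lborel. G x * \<psi> x)"
      unfolding LIMSEQ_iff
    proof (intro allI impI)
      fix \<epsilon> :: real assume \<epsilon>: "\<epsilon> > 0"
      obtain N where N: "\<And>i. i \<ge> N \<Longrightarrow> (\<integral>\<^sup>+x. ennreal \<bar>(s i x - G x) * \<psi> x\<bar> \<partial>lborel) \<le> ennreal (\<epsilon> / 2)"
        using diff[of "\<epsilon> / 2"] \<epsilon> by (auto simp: eventually_sequentially)
      have "\<bar>(LINT x|lborel. s i x * \<psi> x) - (LINT x|lborel. G x * \<psi> x)\<bar> < \<epsilon>" if "i \<ge> N" for i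
      proof -
        have int: "integrable lborel (\<lambda>x. (s i x - G x) * \<psi> x)"
          using Bochner_Integration.integrable_diff[OF si[of i] Gi] by (simp add: left_diff_distrib)
        have eq: "(LINT x|lborel. s i x * \<psi> x) - (LINT x|lborel. G x * \<psi> x) = (LINT x|lborel. (s i x - G x) * \<psi> x)"
          using si Gi by (simp add: left_diff_distrib)
        have "ennreal \<bar>(LINT x|lborel. s i x * \<psi> x) - (LINT x|lborel. G x * \<psi> x)\<bar>
          \<le> (\<integral>\<^sup>+x. ennreal \<bar>(s i x - G x) * \<psi> x\<bar> \<partial>lborel)"
          unfolding eq real_norm_def[symmetric] by (rule integral_norm_bound_ennreal[OF int])
        also have "\<dots> \<le> ennreal (\<epsilon> / 2)" by (rule N[OF that])
        finally have "\<bar>(LINT x|lborel. s i x * \<psi> x) - (LINT x|lborel. G x * \<psi> x)\<bar> \<le> \<epsilon> / 2"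
          using \<epsilon> by (subst (asm) ennreal_le_iff) auto
        then show ?thesis using \<epsilon> by simp
      qed
      then show "\<exists>N. \<forall>i\<ge>N. norm ((LINT x|lborel. s i x * \<psi> x) - (LINT x|lborel. G x * \<psi> x)) < \<epsilon>" by auto
    qed
    with slim have "l = (LINT x|lborel. G x * \<psi> x)" by (rule LIMSEQ_unique)
    then show "(LINT x|lborel. F x * \<psi>' x) = - (LINT x|lborel. G x * \<psi> x)" by (simp add: l_def)
  qed
qed

section \<open>The BV seminorm controls translations\<close>

definition C1_deriv :: "('a::euclidean_space \<Rightarrow> real) \<Rightarrow> ('a \<Rightarrow> 'a \<Rightarrow>\<^sub>L real) \<Rightarrow> bool" where
  "C1_deriv u u' \<longleftrightarrow> (\<forall>x. (u has_derivative blinfun_apply (u' x)) (at x)) \<and> continuous_on UNIV u'"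

lemma C1_deriv_continuous: "C1_deriv u u' \<Longrightarrow> continuous_on UNIV u"
  unfolding C1_deriv_def by (meson continuous_at_imp_continuous_on has_derivative_continuous)

text \<open>Serves twice: with \<open>L y = y\<close> over a box in space for mollification, and
  with \<open>L t = t *\<^sub>R v\<close> over the unit interval for averages along a
  segment.\<close>

lemma C1_deriv_param_integral:
  fixes \<eta> :: "'a::euclidean_space \<Rightarrow> real" and s :: "'b::euclidean_space \<Rightarrow> real" and L :: "'b \<Rightarrow> 'a"
  assumes \<eta>: "C1_deriv \<eta> \<eta>'" and s: "continuous_on UNIV s" and L: "continuous_on UNIV L"
  shows "C1_deriv (\<lambda>x. integral (cbox a b) (\<lambda>y. s y * \<eta> (x - L y))) (\<lambda>x. integral (cbox a b) (\<lambda>y. s y *\<^sub>R \<eta>' (x - L y)))"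
proof -
  have c: "continuous_on UNIV \<eta>" "continuous_on UNIV \<eta>'"
    using \<eta> C1_deriv_continuous by (auto simp: C1_deriv_def)
  have cont: "continuous_on (UNIV \<times> cbox a b) (\<lambda>(x, t). s t *\<^sub>R \<eta>' (x - L t))"
    unfolding split_beta
    by (intro continuous_intros continuous_on_compose2[OF s] continuous_on_compose2[OF c(2)] continuous_on_compose2[OF L]) auto
  have "((\<lambda>x. integral (cbox a b) (\<lambda>y. s y * \<eta> (x - L y))) has_derivative
      blinfun_apply (integral (cbox a b) (\<lambda>y. s y *\<^sub>R \<eta>' (x - L y)))) (at x within UNIV)" for x
  proof (rule leibniz_rule[OF _ _ cont])
    fix x t
    have "(\<eta> has_derivative blinfun_apply (\<eta>' (x - L t))) (at (x - L t))"
      using \<eta> by (auto simp: C1_deriv_def)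
    then have "((\<lambda>x. \<eta> (x - L t)) has_derivative blinfun_apply (\<eta>' (x - L t))) (at x)"
      by (rule has_derivative_compose[rotated, where f="\<lambda>x. x - L t", simplified]) (auto intro!: derivative_eq_intros)
    then show "((\<lambda>x. s t * \<eta> (x - L t)) has_derivative blinfun_apply (s t *\<^sub>R \<eta>' (x - L t))) (at x within UNIV)"
      by (auto intro!: derivative_eq_intros simp: scaleR_blinfun.rep_eq)
    show "(\<lambda>y. s y * \<eta> (x - L y)) integrable_on cbox a b"
      by (intro integrable_continuous continuous_intros continuous_on_compose2[OF s] continuous_on_compose2[OF c(1)]
          continuous_on_compose2[OF L]) auto
  qed auto
  moreover have "continuous_on UNIV (\<lambda>x. integral (cbox a b) (\<lambda>y. s y *\<^sub>R \<eta>' (x - L y)))"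
    by (rule integral_continuous_on_param[OF cont])
  ultimately show ?thesis by (auto simp: C1_deriv_def)
qed

text \<open>A continuously differentiable mollifier supported in the ball of radius
  \<open>\<epsilon>\<close>, matching the regularity of the fields in \<open>C1c\<close>. It is
  normalised only where it is used, by division by its integral.\<close>

definition bump :: "real \<Rightarrow> 'a::euclidean_space \<Rightarrow> real" where
  "bump \<epsilon> x = (max 0 (\<epsilon>\<^sup>2 - x \<bullet> x))\<^sup>2"

lemma has_derivative_max_square:
  "((\<lambda>u::real. (max 0 u)\<^sup>2) has_real_derivative 2 * max 0 u) (at u)"
proof (cases "u = 0")
  case True
  have "((\<lambda>h::real. (max 0 h)\<^sup>2 / h) \<longlongrightarrow> 0) (at 0)"
  proof (rule Lim_null_comparison)
    show "\<forall>\<^sub>F h in at 0. norm ((max 0 h)\<^sup>2 / h) \<le> \<bar>h\<bar>"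
      by (auto simp: eventually_at_filter max_def power2_eq_square)
    show "((\<lambda>h::real. \<bar>h\<bar>) \<longlongrightarrow> 0) (at 0)" by (auto intro!: tendsto_eq_intros)
  qed
  then show ?thesis using True by (simp add: DERIV_def)
next
  case False
  show ?thesis
  proof (cases "u > 0")
    case True
    have "((\<lambda>u::real. u\<^sup>2) has_real_derivative 2 * max 0 u) (at u)"
      using True by (auto intro!: derivative_eq_intros)
    then show ?thesis
      by (rule DERIV_cong_ev[THEN iffD1, rotated -1])
        (use True in \<open>auto intro!: eventually_nhds_in_open[of "{0<..}", THEN eventually_mono]\<close>)
  next
    case u: False
    have "((\<lambda>u::real. 0) has_real_derivative 2 * max 0 u) (at u)"
      using u by (auto intro!: derivative_eq_intros)
    then show ?thesis
      by (rule DERIV_cong_ev[THEN iffD1, rotated -1])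
        (use u False in \<open>auto intro!: eventually_nhds_in_open[of "{..<0}", THEN eventually_mono]\<close>)
  qed
qed

lemma C1_deriv_bump:
  "C1_deriv (bump \<epsilon>) (\<lambda>x. (2 * max 0 (\<epsilon>\<^sup>2 - x \<bullet> x) * (- 2)) *\<^sub>R blinfun_inner_left x)"
  unfolding C1_deriv_def
proof (intro conjI allI)
  fix x :: 'a
  have "((\<lambda>u::real. (max 0 u)\<^sup>2) has_derivative (\<lambda>h. 2 * max 0 (\<epsilon>\<^sup>2 - x \<bullet> x) * h)) (at (\<epsilon>\<^sup>2 - x \<bullet> x))"
    using has_derivative_max_square[of "\<epsilon>\<^sup>2 - x \<bullet> x"] by (simp add: has_field_derivative_def)
  moreover have "((\<lambda>x. \<epsilon>\<^sup>2 - x \<bullet> x) has_derivative (\<lambda>h. - 2 * (x \<bullet> h))) (at x)"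
    by (auto intro!: derivative_eq_intros simp: inner_commute)
  ultimately have "((\<lambda>x. (max 0 (\<epsilon>\<^sup>2 - x \<bullet> x))\<^sup>2) has_derivative (\<lambda>h. 2 * max 0 (\<epsilon>\<^sup>2 - x \<bullet> x) * (- 2 * (x \<bullet> h)))) (at x)"
    by (rule has_derivative_compose[rotated])
  then show "(bump \<epsilon> has_derivative blinfun_apply ((2 * max 0 (\<epsilon>\<^sup>2 - x \<bullet> x) * (- 2)) *\<^sub>R blinfun_inner_left x)) (at x)"
    unfolding bump_def[abs_def]
    by (rule has_derivative_eq_rhs) (auto simp: fun_eq_iff blinfun.scaleR_left blinfun.minus_left inner_commute)
  show "continuous_on UNIV (\<lambda>x::'a. (2 * max 0 (\<epsilon>\<^sup>2 - x \<bullet> x) * (- 2)) *\<^sub>R blinfun_inner_left x)"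
    by (intro continuous_intros bounded_linear.continuous_on[OF bounded_linear_blinfun_inner_left])
qed

lemma bump_nonneg: "bump \<epsilon> x \<ge> 0"
  by (simp add: bump_def)

lemma bump_eq_0: "\<epsilon> > 0 \<Longrightarrow> norm x \<ge> \<epsilon> \<Longrightarrow> bump \<epsilon> x = 0"
  using power_mono[of \<epsilon> "norm x" 2] by (simp add: bump_def power2_norm_eq_inner max_def)

lemma bump_le: "bump \<epsilon> x \<le> (\<epsilon>\<^sup>2)\<^sup>2"
  unfolding bump_def by (intro power_mono) auto

lemma borel_measurable_bump [measurable]: "bump \<epsilon> \<in> borel_measurable borel"
  by (rule borel_measurable_continuous_onI[OF C1_deriv_continuous[OF C1_deriv_bump]])

lemma bump_integral:
  assumes "\<epsilon> > 0"
  shows "integrable lborel (bump \<epsilon> :: 'a::euclidean_space \<Rightarrow> real)" "(LINT x|lborel. bump \<epsilon> (x::'a)) > 0"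
proof -
  have l: "loc_int (\<lambda>x::'a. 1)" by (simp add: loc_int_def emeasure_vball)
  have bnd: "\<bar>bump \<epsilon> x\<bar> \<le> (\<epsilon>\<^sup>2)\<^sup>2" for x :: 'a
    using bump_le[of \<epsilon> x] bump_nonneg[of \<epsilon> x] by linarith
  have "integrable lborel (\<lambda>x::'a. 1 * bump \<epsilon> x)"
    by (rule loc_int_mult_bounded[OF l _ _ bnd bump_eq_0[OF assms]]) auto
  then show i: "integrable lborel (bump \<epsilon> :: 'a \<Rightarrow> real)" by simp
  define q where "q = (3 * \<epsilon>\<^sup>2 / 4)\<^sup>2"
  have q: "q > 0" using assms by (simp add: q_def)
  have "0 < q * vball TYPE('a) (\<epsilon> / 2)" using q assms by simp
  also have "\<dots> = (LINT x|lborel. q * indicator (ball (0::'a) (\<epsilon>/2)) x)" by (simp add: vball_def)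
  also have "\<dots> \<le> (LINT x|lborel. bump \<epsilon> (x::'a))"
  proof (rule integral_mono[OF _ i])
    show "integrable lborel (\<lambda>x::'a. q * indicator (ball 0 (\<epsilon>/2)) x)" by (simp add: emeasure_vball)
    fix x :: 'a
    show "q * indicator (ball 0 (\<epsilon>/2)) x \<le> bump \<epsilon> x"
    proof (cases "norm x < \<epsilon> / 2")
      case True
      then have "(norm x)\<^sup>2 \<le> (\<epsilon>/2)\<^sup>2" by (intro power_mono) auto
      then have "3 * \<epsilon>\<^sup>2 / 4 \<le> \<epsilon>\<^sup>2 - x \<bullet> x"
        by (simp add: power2_norm_eq_inner power_divide)
      then have "3 * \<epsilon>\<^sup>2 / 4 \<le> max 0 (\<epsilon>\<^sup>2 - x \<bullet> x)" by (rule max.coboundedI2)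
      then have "q \<le> bump \<epsilon> x" unfolding q_def bump_def by (intro power_mono) auto
      then show ?thesis using True by simp
    qed (simp add: bump_nonneg)
  qed
  finally show "(LINT x|lborel. bump \<epsilon> (x::'a)) > 0" .
qed

lemma C1_approximation:
  fixes s :: "'a::euclidean_space \<Rightarrow> real"
  assumes s: "continuous_on UNIV s" and s1: "\<And>x. \<bar>s x\<bar> \<le> 1" and R: "\<And>x. norm x \<ge> R \<Longrightarrow> s x = 0"
  obtains \<psi> \<psi>' where "\<And>k::nat. C1_deriv (\<psi> k) (\<psi>' k)" "\<And>k x. \<bar>\<psi> k x\<bar> \<le> 1"
    "\<And>k x. norm x \<ge> R + 1 \<Longrightarrow> \<psi> k x = 0" "\<And>x. (\<lambda>k. \<psi> k x) \<longlonglongrightarrow> s x"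
proof -
  have sm [measurable]: "s \<in> borel_measurable borel" by (rule borel_measurable_continuous_onI[OF s])
  obtain a b :: 'a where ab: "cball 0 \<bar>R\<bar> \<subseteq> cbox a b"
    using bounded_subset_cbox_symmetric[OF bounded_cball] by metis
  define \<epsilon> where "\<epsilon> k = 1 / real (Suc k)" for k
  have \<epsilon>: "\<epsilon> k > 0" "\<epsilon> k \<le> 1" for k by (auto simp: \<epsilon>_def)
  define I where "I k = (LINT x|lborel. bump (\<epsilon> k) (x::'a))" for k
  have I: "I k > 0" for k unfolding I_def by (rule bump_integral[OF \<epsilon>(1)])
  note bi = bump_integral(1)[OF \<epsilon>(1)]
  \<comment> \<open>Written over a compact box containing the support of \<open>s\<close>, so that
    the parameter integral can be differentiated; \<open>eq\<close> identifies it with the integral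
    over the whole space.\<close>
  define \<psi> where "\<psi> k x = integral (cbox a b) (\<lambda>y. (s y / I k) * bump (\<epsilon> k) (x - y))" for k x
  have si: "integrable lborel (\<lambda>y. s y * bump (\<epsilon> k) (x - y))" for k x
  proof (rule Bochner_Integration.integrable_bound[OF integral_kernel_reflect(1)[OF bi]])
    show "AE y in lborel. norm (s y * bump (\<epsilon> k) (x - y)) \<le> norm (bump (\<epsilon> k) (x - y))"
      using s1 by (intro AE_I2) (simp add: abs_mult mult_left_le_one_le)
  qed measurable
  have eq: "\<psi> k x = (LINT y|lborel. s y * bump (\<epsilon> k) (x - y)) / I k" for k x
  proof -
    have z: "s y = 0" if "y \<notin> cbox a b" for y
    proof (rule R)
      have "y \<notin> cball 0 \<bar>R\<bar>" using that ab by blast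
      then show "norm y \<ge> R" by auto
    qed
    have "set_integrable lborel (cbox a b) (\<lambda>y. (s y / I k) * bump (\<epsilon> k) (x - y))"
      unfolding set_integrable_def using integrable_mult_indicator[OF _ integrable_divide[OF si[of k x], of "I k"], of "cbox a b"]
      by (simp add: mult.commute)
    then have "\<psi> k x = (LINT y:cbox a b|lborel. (s y / I k) * bump (\<epsilon> k) (x - y))"
      unfolding \<psi>_def by (rule set_borel_integral_eq_integral(2)[symmetric])
    also have "\<dots> = (LINT y|lborel. s y * bump (\<epsilon> k) (x - y) / I k)"
      unfolding set_lebesgue_integral_def by (intro Bochner_Integration.integral_cong) (auto simp: indicator_def z)
    finally show ?thesis by simp
  qed
  have "continuous_on UNIV (\<lambda>y. s y / I k)" for k
    using less_imp_neq[OF I[of k]] by (intro continuous_intros s) auto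
  then have C1: "\<exists>\<psi>'. C1_deriv (\<psi> k) \<psi>'" for k
    unfolding \<psi>_def[abs_def]
    by (intro exI) (rule C1_deriv_param_integral[where \<eta>="bump (\<epsilon> k)" and s="\<lambda>y. s y / I k" and L="\<lambda>y. y",
        OF C1_deriv_bump _ continuous_on_id])
  then obtain \<psi>' where \<psi>': "\<And>k. C1_deriv (\<psi> k) (\<psi>' k)" by metis
  \<comment> \<open>One estimate for three purposes: \<open>c = 0\<close>, \<open>e = 1\<close>
    gives the bound by 1; \<open>c = 0\<close>, \<open>e = 0\<close> gives the support;
    \<open>c = s x\<close> with small \<open>e\<close> gives the convergence.\<close>
  have dist: "\<bar>\<psi> k x - c\<bar> \<le> e" if "\<And>y. norm (x - y) < \<epsilon> k \<Longrightarrow> \<bar>s y - c\<bar> \<le> e" for k x c e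
  proof -
    have c: "integrable lborel (\<lambda>y. c * bump (\<epsilon> k) (x - y))" for c
      by (intro integrable_mult_right integral_kernel_reflect(1) bi)
    have Ie: "(LINT y|lborel. c * bump (\<epsilon> k) (x - y)) = c * I k" for c
      using integral_kernel_reflect(2)[OF bi[of k], of x] by (simp add: I_def)
    have "(\<psi> k x - c) * I k = (LINT y|lborel. s y * bump (\<epsilon> k) (x - y)) - c * I k"
      using I[of k] by (simp add: eq left_diff_distrib)
    also have "\<dots> = (LINT y|lborel. s y * bump (\<epsilon> k) (x - y) - c * bump (\<epsilon> k) (x - y))"
      unfolding Ie[symmetric] by (rule Bochner_Integration.integral_diff[symmetric]) (rule si c)+
    finally have eq2: "(\<psi> k x - c) * I k = (LINT y|lborel. s y * bump (\<epsilon> k) (x - y) - c * bump (\<epsilon> k) (x - y))" .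
    have "\<bar>\<psi> k x - c\<bar> * I k = \<bar>(\<psi> k x - c) * I k\<bar>"
      unfolding abs_mult by (simp add: abs_of_pos[OF I])
    then have "\<bar>\<psi> k x - c\<bar> * I k = \<bar>LINT y|lborel. s y * bump (\<epsilon> k) (x - y) - c * bump (\<epsilon> k) (x - y)\<bar>"
      unfolding eq2 .
    also have "\<dots> \<le> (LINT y|lborel. \<bar>s y * bump (\<epsilon> k) (x - y) - c * bump (\<epsilon> k) (x - y)\<bar>)"
      by (rule integral_abs_bound)
    also have "\<dots> \<le> (LINT y|lborel. e * bump (\<epsilon> k) (x - y))"
    proof (rule integral_mono)
      show "integrable lborel (\<lambda>y. \<bar>s y * bump (\<epsilon> k) (x - y) - c * bump (\<epsilon> k) (x - y)\<bar>)"
        using si[of k x] c by (intro integrable_abs Bochner_Integration.integrable_diff)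
      fix y
      show "\<bar>s y * bump (\<epsilon> k) (x - y) - c * bump (\<epsilon> k) (x - y)\<bar> \<le> e * bump (\<epsilon> k) (x - y)"
      proof (cases "norm (x - y) < \<epsilon> k")
        case True
        have "\<bar>s y - c\<bar> * bump (\<epsilon> k) (x - y) \<le> e * bump (\<epsilon> k) (x - y)"
          by (intro mult_right_mono that True bump_nonneg)
        then show ?thesis by (simp add: left_diff_distrib[symmetric] abs_mult bump_nonneg)
      next
        case False
        then show ?thesis using bump_eq_0[OF \<epsilon>(1)[of k], of "x - y"] by simp
      qed
    qed (rule c)
    also have "\<dots> = e * I k" by (rule Ie)
    finally show ?thesis using I[of k] by simp
  qed
  show thesis
  proof (rule that)
    show "C1_deriv (\<psi> k) (\<psi>' k)" for k by (rule \<psi>')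
    show "\<bar>\<psi> k x\<bar> \<le> 1" for k x using dist[of x k 0 1] s1 by simp
    show "\<psi> k x = 0" if "norm x \<ge> R + 1" for k x
    proof -
      have "s y = 0" if "norm (x - y) < \<epsilon> k" for y
        using norm_triangle_ineq2[of x y] that \<open>norm x \<ge> R + 1\<close> \<epsilon>(2)[of k] by (intro R) linarith
      then show ?thesis using dist[of x k 0 0] by simp
    qed
    show "(\<lambda>k. \<psi> k x) \<longlonglongrightarrow> s x" for x
      unfolding LIMSEQ_iff
    proof (intro allI impI)
      fix r :: real assume r: "r > 0"
      have "isCont s x" using s by (simp add: continuous_on_eq_continuous_at)
      then obtain d where d: "d > 0" "\<And>y. dist y x < d \<Longrightarrow> dist (s y) (s x) < r / 2"
        using r unfolding continuous_at_eps_delta by (metis half_gt_zero)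
      have "\<epsilon> \<longlonglongrightarrow> 0" unfolding \<epsilon>_def by (rule LIMSEQ_inverse_real_of_nat[unfolded inverse_eq_divide])
      then obtain N where N: "\<And>k. k \<ge> N \<Longrightarrow> \<epsilon> k < d"
        using d(1) by (auto simp: LIMSEQ_iff dest!: spec[of _ d]) (metis abs_less_iff)
      have "norm (\<psi> k x - s x) < r" if "k \<ge> N" for k
      proof -
        have "\<bar>\<psi> k x - s x\<bar> \<le> r / 2"
        proof (rule dist)
          fix y assume "norm (x - y) < \<epsilon> k"
          then have "dist y x < d" using N[OF that] by (simp add: dist_norm norm_minus_commute)
          then show "\<bar>s y - s x\<bar> \<le> r / 2" using d(2) by (auto simp: dist_real_def intro: less_imp_le)
        qed
        then show ?thesis using r by simp
      qed
      then show "\<exists>N. \<forall>k\<ge>N. norm (\<psi> k x - s x) < r" by blast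
    qed
  qed
qed

text \<open>The test field is \<open>v / \<bar>v\<bar>\<close> times the average of \<open>\<psi>\<close> along the segment from \<open>x - v\<close> to \<open>x\<close>.\<close>

lemma segment_test_field:
  fixes \<psi> :: "real^'n \<Rightarrow> real" and v :: "real^'n"
  assumes \<psi>: "C1_deriv \<psi> \<psi>'" and b: "\<And>x. \<bar>\<psi> x\<bar> \<le> 1" and R: "\<And>x. norm x \<ge> R \<Longrightarrow> \<psi> x = 0" and v: "v \<noteq> 0"
  obtains g where "g \<in> C1c" "\<And>x. norm (g x) \<le> 1" "\<And>x. divergence g x = (\<psi> x - \<psi> (x - v)) / norm v"
proof -
  define \<Theta> where "\<Theta> x = integral (cbox 0 1) (\<lambda>t::real. 1 * \<psi> (x - t *\<^sub>R v))" for x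
  define \<Theta>' where "\<Theta>' x = integral (cbox 0 1) (\<lambda>t::real. 1 *\<^sub>R \<psi>' (x - t *\<^sub>R v))" for x
  have \<Theta>: "C1_deriv \<Theta> \<Theta>'"
    unfolding \<Theta>_def[abs_def] \<Theta>'_def[abs_def]
    by (rule C1_deriv_param_integral[OF \<psi>, of "\<lambda>t. 1" "\<lambda>t. t *\<^sub>R v"]) (auto intro!: continuous_intros)
  have c: "continuous_on UNIV \<psi>" "continuous_on UNIV \<psi>'"
    using \<psi> C1_deriv_continuous by (auto simp: C1_deriv_def)
  define u where "u = (1 / norm v) *\<^sub>R v"
  have u: "norm u = 1" using v by (simp add: u_def)
  define g where "g x = \<Theta> x *\<^sub>R u" for x
  have int: "(\<lambda>t::real. \<psi> (x - t *\<^sub>R v)) integrable_on cbox 0 1" for x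
    by (intro integrable_continuous continuous_on_compose2[OF c(1)] continuous_intros) auto
  have \<Theta>1: "\<bar>\<Theta> x\<bar> \<le> 1" for x
  proof -
    have "norm (integral (cbox 0 1) (\<lambda>t::real. \<psi> (x - t *\<^sub>R v))) \<le> integral (cbox 0 1) (\<lambda>t::real. 1)"
      by (rule integral_norm_bound_integral[OF int integrable_const]) (simp add: b)
    then show ?thesis by (simp add: \<Theta>_def)
  qed
  \<comment> \<open>Differentiating the segment average in the direction \<open>v\<close> integrates
    a derivative along the segment, so only the two end points remain.\<close>
  have \<Theta>v: "\<Theta>' x v = \<psi> x - \<psi> (x - v)" for x
  proof -
    have "(\<lambda>t::real. 1 *\<^sub>R \<psi>' (x - t *\<^sub>R v)) integrable_on cbox 0 1"
      by (intro integrable_continuous continuous_intros continuous_on_compose2[OF c(2)]) auto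
    then have "\<Theta>' x v = integral {0..1} (\<lambda>t::real. \<psi>' (x - t *\<^sub>R v) v)"
      unfolding \<Theta>'_def by (subst blinfun_apply_integral) (auto simp: cbox_interval)
    moreover have "((\<lambda>t::real. \<psi>' (x - t *\<^sub>R v) v) has_integral (- \<psi> (x - 1 *\<^sub>R v) - (- \<psi> (x - 0 *\<^sub>R v)))) {0..1}"
    proof (rule fundamental_theorem_of_calculus)
      fix t :: real
      have "(\<psi> has_derivative blinfun_apply (\<psi>' (x - t *\<^sub>R v))) (at (x - t *\<^sub>R v))"
        using \<psi> by (auto simp: C1_deriv_def)
      moreover have "((\<lambda>t. x - t *\<^sub>R v) has_derivative (\<lambda>h. - (h *\<^sub>R v))) (at t within {0..1})"
        by (auto intro!: derivative_eq_intros)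
      ultimately have "((\<lambda>t. \<psi> (x - t *\<^sub>R v)) has_derivative (\<lambda>h. \<psi>' (x - t *\<^sub>R v) (- (h *\<^sub>R v)))) (at t within {0..1})"
        by (rule has_derivative_compose[rotated])
      then have "((\<lambda>t. - \<psi> (x - t *\<^sub>R v)) has_derivative (\<lambda>h. h * \<psi>' (x - t *\<^sub>R v) v)) (at t within {0..1})"
        by (auto intro!: derivative_eq_intros simp: blinfun.minus_right blinfun.scaleR_right)
      then show "((\<lambda>t. - \<psi> (x - t *\<^sub>R v)) has_vector_derivative \<psi>' (x - t *\<^sub>R v) v) (at t within {0..1})"
        by (simp add: has_vector_derivative_def)
    qed simp
    ultimately show ?thesis by (simp add: integral_unique)
  qed
  have "g \<in> C1c"
    unfolding C1c_def
  proof (intro CollectI conjI exI allI)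
    show "(g has_derivative blinfun_apply (blinfun_scaleR_left u o\<^sub>L \<Theta>' x)) (at x)" for x
    proof -
      have "(\<Theta> has_derivative blinfun_apply (\<Theta>' x)) (at x)" using \<Theta> by (auto simp: C1_deriv_def)
      then show ?thesis unfolding g_def[abs_def] by (auto intro!: derivative_eq_intros)
    qed
    show "continuous_on UNIV (\<lambda>x. blinfun_scaleR_left u o\<^sub>L \<Theta>' x)"
      using \<Theta> unfolding C1_deriv_def by (intro continuous_intros) auto
    have "x \<in> cball 0 (R + norm v)" if "g x \<noteq> 0" for x
    proof (rule ccontr)
      assume "x \<notin> cball 0 (R + norm v)"
      then have "norm x > R + norm v" by simp
      then have "\<psi> (x - t *\<^sub>R v) = 0" if "t \<in> cbox 0 1" for t :: real
      proof -
        have "norm (t *\<^sub>R v) \<le> norm v" using that by (simp add: mult_left_le_one_le)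
        then show ?thesis using \<open>norm x > R + norm v\<close> norm_triangle_ineq2[of x "t *\<^sub>R v"] by (intro R) linarith
      qed
      then have "\<Theta> x = 0" unfolding \<Theta>_def using integral_cong[of "cbox 0 1" "\<lambda>t. 1 * \<psi> (x - t *\<^sub>R v)" "\<lambda>_. 0"] by simp
      then show False using that by (simp add: g_def)
    qed
    then have "closure {x. g x \<noteq> 0} \<subseteq> cball 0 (R + norm v)" by (intro closure_minimal) auto
    then show "compactly_supported g"
      unfolding compactly_supported_def by (meson bounded_cball bounded_subset closed_closure compact_eq_bounded_closed)
  qed
  moreover have "norm (g x) \<le> 1" for x using \<Theta>1[of x] u by (simp add: g_def)
  moreover have "divergence g x = (\<psi> x - \<psi> (x - v)) / norm v" for x
  proof -
    have "partial_deriv i (\<lambda>y. g y $ i) x = \<Theta>' x (u $ i *\<^sub>R axis i 1)" for i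
    proof -
      have "(\<Theta> has_derivative blinfun_apply (\<Theta>' x)) (at x)" using \<Theta> by (auto simp: C1_deriv_def)
      then have "((\<lambda>y. \<Theta> y * u $ i) has_derivative (\<lambda>h. \<Theta>' x h * u $ i)) (at x)"
        by (auto intro!: derivative_eq_intros)
      then have "((\<lambda>y. g y $ i) has_derivative (\<lambda>h. \<Theta>' x h * u $ i)) (at x)" by (simp add: g_def)
      from frechet_derivative_at[OF this] show ?thesis
        unfolding partial_deriv_def by (simp add: blinfun.scaleR_right mult.commute fun_eq_iff)
    qed
    then have "divergence g x = \<Theta>' x (\<Sum>i\<in>UNIV. u $ i *\<^sub>R axis i 1)"
      unfolding divergence_def by (simp add: blinfun.sum_right)
    also have "(\<Sum>i\<in>UNIV. u $ i *\<^sub>R axis i 1) = u"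
      using basis_expansion[of u] by (simp add: scalar_mult_eq_scaleR)
    finally show ?thesis by (simp add: u_def blinfun.scaleR_right \<Theta>v)
  qed
  ultimately show thesis by (rule that)
qed

section \<open>Duality between increments and test fields\<close>

lemma BV_test_bound:
  fixes f :: "real^'n \<Rightarrow> real"
  assumes f: "BV_seminorm f \<le> ennreal V" "V \<ge> 0" "g \<in> C1c" "\<And>x. norm (g x) \<le> 1"
  shows "(LINT x|lebesgue. f x * divergence g x) \<le> V"
proof -
  obtain g' where g': "\<And>x. (g has_derivative blinfun_apply (g' x)) (at x)" using f(3) by (auto simp: C1c_def)
  have "continuous_on UNIV g" using g' by (meson continuous_at_imp_continuous_on has_derivative_continuous)
  then have [measurable]: "g \<in> borel_measurable borel" by (rule borel_measurable_continuous_onI)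
  have "(\<lambda>x. ereal (norm (g x))) \<in> borel_measurable lebesgue"
    by (rule measurable_completion) simp
  then have "esssup lebesgue (\<lambda>x. ereal (norm (g x))) \<le> 1"
    using f(4) by (intro esssup_I) auto
  then have "ennreal (LINT x|lebesgue. f x * divergence g x) \<le> BV_seminorm f"
    unfolding BV_seminorm_def using f(3) by (intro SUP_upper) auto
  also note f(1)
  finally show ?thesis using f(2) by (simp add: ennreal_le_iff)
qed

text \<open>The test field belonging to \<open>- \<psi>\<close> has divergence
  \<open>(\<psi> (x - v) - \<psi> x) / norm v\<close>; a change of variables moves the translation
  onto \<open>f\<close>.\<close>

lemma translation_test_bound:
  fixes f :: "real^'n \<Rightarrow> real"
  assumes f: "loc_int f" "f \<in> borel_measurable borel" "BV_seminorm f \<le> ennreal V" "V \<ge> 0"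
    and \<psi>: "C1_deriv \<psi> \<psi>'" and b: "\<And>x. \<bar>\<psi> x\<bar> \<le> 1" and R: "\<And>x. norm x \<ge> R \<Longrightarrow> \<psi> x = 0"
  shows "(LINT x|lborel. (f (x + v) - f x) * \<psi> x) \<le> norm v * V"
proof (cases "v = 0")
  case False
  note [measurable] = f(2)
  have c: "continuous_on UNIV \<psi>" using \<psi> by (rule C1_deriv_continuous)
  have \<psi>m [measurable]: "\<psi> \<in> borel_measurable borel" by (rule borel_measurable_continuous_onI[OF c])
  have C1: "C1_deriv (\<lambda>x. - \<psi> x) (\<lambda>x. - \<psi>' x)"
    using \<psi> unfolding C1_deriv_def by (auto intro!: derivative_eq_intros continuous_intros simp: uminus_blinfun.rep_eq)
  obtain g where g: "g \<in> C1c" "\<And>x. norm (g x) \<le> 1" "\<And>x. divergence g x = (- \<psi> x - - \<psi> (x - v)) / norm v"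
    by (rule segment_test_field[OF C1 _ _ False, of R]) (use b R in auto)
  have i1: "integrable lborel (\<lambda>x. f (x + v) * \<psi> x)"
    by (rule loc_int_mult_bounded[OF loc_int_shift[OF f(1)] _ _ b R]) measurable
  have i0: "integrable lborel (\<lambda>x. f x * \<psi> x)"
    by (rule loc_int_mult_bounded[OF f(1) _ _ b R]) measurable
  note shift = integral_shift_mult[OF f(2) \<psi>m i1]
  have "(LINT x|lebesgue. f x * divergence g x) = (LINT x|lborel. f x * divergence g x)"
    by (rule integral_completion) (unfold g(3), measurable)
  also have "\<dots> = (LINT x|lborel. (f x * \<psi> (x - v) - f x * \<psi> x) / norm v)"
    by (intro Bochner_Integration.integral_cong) (auto simp: g(3) algebra_simps diff_divide_distrib)
  also have "\<dots> = ((LINT x|lborel. f (x + v) * \<psi> x) - (LINT x|lborel. f x * \<psi> x)) / norm v"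
    using shift i0 by simp
  also have "\<dots> = (LINT x|lborel. (f (x + v) - f x) * \<psi> x) / norm v"
    using i1 i0 by (simp add: left_diff_distrib)
  finally have "(LINT x|lborel. (f (x + v) - f x) * \<psi> x) / norm v \<le> V"
    using BV_test_bound[OF f(3,4) g(1,2)] by simp
  then show ?thesis using False by (simp add: divide_le_eq mult.commute)
qed simp

text \<open>The L1 norm of the increment \<open>h\<close> over a ball is its pairing with
  \<open>sgn h\<close>. The bound holds for continuously differentiable functions, passes to
  continuous ones by mollification, to the sign function by approximation almost everywhere, and to
  the whole space by monotone convergence.\<close>

lemma BV_translation_var:
  fixes f :: "real^'n \<Rightarrow> real"
  assumes f: "loc_int f" "f \<in> borel_measurable borel" "BV_seminorm f \<le> ennreal V" "V \<ge> 0"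
  shows "translation_var f V"
  unfolding translation_var_def
proof (intro conjI allI)
  note [measurable] = f(2)
  fix v :: "real^'n"
  define h where "h x = f (x + v) - f x" for x
  have hm [measurable]: "h \<in> borel_measurable borel" unfolding h_def by measurable
  have hl: "loc_int h"
    using loc_int_translate[OF f(1), of _ v] f(1)
    by (simp add: loc_int_def h_def right_diff_distrib add.commute)
  have cont: "(LINT x|lborel. h x * s x) \<le> norm v * V"
    if s: "continuous_on UNIV s" "\<And>x. \<bar>s x\<bar> \<le> 1" "\<And>x. norm x \<ge> R \<Longrightarrow> s x = 0" for s :: "real^'n \<Rightarrow> real" and R
  proof -
    show ?thesis
    proof (rule C1_approximation[of s R])
      fix \<psi> \<psi>' assume \<psi>: "\<And>k::nat. C1_deriv (\<psi> k) (\<psi>' k)" "\<And>k x. \<bar>\<psi> k x\<bar> \<le> 1"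
        "\<And>k x. norm x \<ge> R + 1 \<Longrightarrow> \<psi> k x = 0" "\<And>x. (\<lambda>k. \<psi> k x) \<longlonglongrightarrow> s x"
      have [measurable]: "\<psi> k \<in> borel_measurable borel" for k
        by (rule borel_measurable_continuous_onI[OF C1_deriv_continuous[OF \<psi>(1)]])
      have [measurable]: "s \<in> borel_measurable borel" by (rule borel_measurable_continuous_onI[OF s(1)])
      have "(\<lambda>k. LINT x|lborel. h x * \<psi> k x) \<longlonglongrightarrow> (LINT x|lborel. h x * s x)"
      proof (rule integral_dominated_convergence[where w="\<lambda>x. \<bar>indicator (ball 0 (R + 1)) x * h x\<bar>"])
        show "integrable lborel (\<lambda>x. \<bar>indicator (ball 0 (R + 1)) x * h x\<bar>)"
          using hl unfolding loc_int_def by (intro integrable_abs) auto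
        show "AE x in lborel. (\<lambda>k. h x * \<psi> k x) \<longlonglongrightarrow> h x * s x" by (intro AE_I2 tendsto_intros \<psi>)
        show "AE x in lborel. norm (h x * \<psi> k x) \<le> \<bar>indicator (ball 0 (R + 1)) x * h x\<bar>" for k
        proof (intro AE_I2)
          fix x
          show "norm (h x * \<psi> k x) \<le> \<bar>indicator (ball 0 (R + 1)) x * h x\<bar>"
            using \<psi>(2)[of k x] \<psi>(3)[of x k] by (cases "norm x < R + 1") (auto simp: abs_mult mult_left_le)
        qed
      qed measurable
      then show ?thesis
      proof (rule LIMSEQ_le_const2)
        show "\<exists>N. \<forall>k\<ge>N. (LINT x|lborel. h x * \<psi> k x) \<le> norm v * V"
          using translation_test_bound[OF f \<psi>(1) \<psi>(2) \<psi>(3)] by (auto simp: h_def)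
      qed
    qed (use s in auto)
  qed
  have ballb: "(\<integral>\<^sup>+x. indicator (ball 0 (real R)) x * ennreal \<bar>h x\<bar> \<partial>lborel) \<le> ennreal (norm v * V)" for R :: nat
  proof -
    define \<sigma> where "\<sigma> x = indicator (ball 0 (real R)) x * sgn (h x)" for x
    have \<sigma>m [measurable]: "\<sigma> \<in> borel_measurable borel" unfolding \<sigma>_def by measurable
    then have "\<sigma> \<in> borel_measurable lebesgue" by (intro measurable_completion) simp
    then have "\<sigma> measurable_on UNIV" by (subst measurable_on_iff_borel_measurable) auto
    then obtain N g where N: "negligible N" and g: "\<And>k. continuous_on UNIV (g k)"
      and glim: "\<And>x. x \<notin> N \<Longrightarrow> (\<lambda>k. g k x) \<longlonglongrightarrow> \<sigma> x"
      by (auto simp: measurable_on_def)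
    have AEN: "AE x in lborel. x \<notin> N"
      using AE_not_in[of N lebesgue] N by (simp add: negligible_iff_null_sets AE_completion_iff)
    define cut :: "real^'n \<Rightarrow> real" where "cut x = max 0 (min 1 (real R + 1 - norm x))" for x
    \<comment> \<open>Clamping to \<open>[-1, 1]\<close> and multiplying by a cutoff that equals 1
      on the ball of radius \<open>R\<close> makes \<open>g k\<close> admissible without changing
      the limit \<open>\<sigma>\<close>.\<close>
    define s where "s k x = max (- 1) (min 1 (g k x)) * cut x" for k x
    have sc: "continuous_on UNIV (s k)" for k
      unfolding s_def[abs_def] cut_def by (intro continuous_intros g)
    have cut1: "0 \<le> cut x" "cut x \<le> 1" for x by (auto simp: cut_def)
    have s1: "\<bar>s k x\<bar> \<le> 1" for k x
    proof -
      have "\<bar>max (- 1) (min 1 (g k x))\<bar> * cut x \<le> 1 * 1"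
        using cut1 by (intro mult_mono) (auto simp: abs_le_iff)
      then show ?thesis using cut1[of x] by (simp add: s_def abs_mult)
    qed
    have sR: "s k x = 0" if "norm x \<ge> real R + 1" for k x using that by (simp add: s_def cut_def)
    have slim: "(\<lambda>k. s k x) \<longlonglongrightarrow> \<sigma> x" if "x \<notin> N" for x
    proof -
      have "(\<lambda>k. s k x) \<longlonglongrightarrow> max (- 1) (min 1 (\<sigma> x)) * cut x"
        unfolding s_def by (intro tendsto_intros glim that)
      moreover have "max (- 1) (min 1 (\<sigma> x)) * cut x = \<sigma> x"
      proof -
        have "-1 \<le> \<sigma> x" "\<sigma> x \<le> 1" by (auto simp: \<sigma>_def indicator_def sgn_if)
        moreover have "\<sigma> x = 0 \<or> cut x = 1" by (auto simp: \<sigma>_def cut_def indicator_def)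
        ultimately show ?thesis by auto
      qed
      ultimately show ?thesis by simp
    qed
    have sm [measurable]: "s k \<in> borel_measurable borel" for k by (rule borel_measurable_continuous_onI[OF sc])
    have "(\<lambda>k. LINT x|lborel. h x * s k x) \<longlonglongrightarrow> (LINT x|lborel. h x * \<sigma> x)"
    proof (rule integral_dominated_convergence[where w="\<lambda>x. \<bar>indicator (ball 0 (real R + 1)) x * h x\<bar>"])
      show "integrable lborel (\<lambda>x. \<bar>indicator (ball 0 (real R + 1)) x * h x\<bar>)"
        using hl unfolding loc_int_def by (intro integrable_abs) auto
      show "AE x in lborel. (\<lambda>k. h x * s k x) \<longlonglongrightarrow> h x * \<sigma> x"
        using AEN by eventually_elim (intro tendsto_intros slim)
      show "AE x in lborel. norm (h x * s k x) \<le> \<bar>indicator (ball 0 (real R + 1)) x * h x\<bar>" for k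
      proof (intro AE_I2)
        fix x
        show "norm (h x * s k x) \<le> \<bar>indicator (ball 0 (real R + 1)) x * h x\<bar>"
          using s1[of k x] sR[of x k] by (cases "norm x < real R + 1") (auto simp: abs_mult mult_left_le)
      qed
    qed measurable
    then have le: "(LINT x|lborel. h x * \<sigma> x) \<le> norm v * V"
      by (rule LIMSEQ_le_const2) (use cont[OF sc s1 sR] in auto)
    have e: "h x * \<sigma> x = indicator (ball 0 (real R)) x * \<bar>h x\<bar>" for x
      by (auto simp: \<sigma>_def indicator_def abs_sgn)
    have i: "integrable lborel (\<lambda>x. indicator (ball 0 (real R)) x * \<bar>h x\<bar>)"
      using hl integrable_abs[of lborel "\<lambda>x. indicator (ball 0 (real R)) x * h x"]
      by (simp add: loc_int_def abs_mult)
    have "(\<integral>\<^sup>+x. indicator (ball 0 (real R)) x * ennreal \<bar>h x\<bar> \<partial>lborel) = (\<integral>\<^sup>+x. ennreal (indicator (ball 0 (real R)) x * \<bar>h x\<bar>) \<partial>lborel)"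
      by (intro nn_integral_cong) (auto simp: indicator_def)
    also have "\<dots> = ennreal (LINT x|lborel. indicator (ball 0 (real R)) x * \<bar>h x\<bar>)"
      by (intro nn_integral_eq_integral i) auto
    also have "\<dots> \<le> ennreal (norm v * V)" using le by (intro ennreal_leI) (simp add: e)
    finally show ?thesis .
  qed
  have "(\<integral>\<^sup>+x. ennreal \<bar>h x\<bar> \<partial>lborel) = (\<integral>\<^sup>+x. (SUP R. indicator (ball 0 (real R)) x * ennreal \<bar>h x\<bar>) \<partial>lborel)"
  proof (intro nn_integral_cong antisym)
    fix x :: "real^'n"
    obtain R :: nat where "norm x < real R" using reals_Archimedean2 by blast
    then have "ennreal \<bar>h x\<bar> = indicator (ball 0 (real R)) x * ennreal \<bar>h x\<bar>" by simp
    also have "\<dots> \<le> (SUP R. indicator (ball 0 (real R)) x * ennreal \<bar>h x\<bar>)" by (intro SUP_upper) simp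
    finally show "ennreal \<bar>h x\<bar> \<le> (SUP R. indicator (ball 0 (real R)) x * ennreal \<bar>h x\<bar>)" .
  qed (auto intro!: SUP_least simp: indicator_def)
  also have "\<dots> = (SUP R. \<integral>\<^sup>+x. indicator (ball 0 (real R)) x * ennreal \<bar>h x\<bar> \<partial>lborel)"
  proof (rule nn_integral_monotone_convergence_SUP)
    show "incseq (\<lambda>R x. indicator (ball (0::real^'n) (real R)) x * ennreal \<bar>h x\<bar>)"
      by (intro incseq_SucI le_funI) (auto simp: indicator_def)
  qed measurable
  also have "\<dots> \<le> ennreal (norm v * V)" by (intro SUP_least ballb)
  finally show "(\<integral>\<^sup>+x. ennreal \<bar>f (x + v) - f x\<bar> \<partial>lborel) \<le> ennreal (norm v * V)" by (simp add: h_def)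
qed (rule f)

section \<open>The weak gradient of a maximal function\<close>

lemma loc_int_imp_locally_integrable:
  fixes h :: "real^'n \<Rightarrow> 'b::euclidean_space"
  assumes [measurable]: "h \<in> borel_measurable borel" and h: "\<And>x. norm (h x) \<le> u x" and u: "loc_int u" "u \<in> borel_measurable borel"
  shows "locally_integrable h"
  unfolding locally_integrable_def set_integrable_def
proof (intro allI impI)
  fix K :: "(real^'n) set" assume K: "compact K"
  note [measurable] = u(2)
  obtain r where r: "K \<subseteq> ball 0 r" using compact_imp_bounded[OF K] bounded_subset_ballD by blast
  have Km [measurable]: "K \<in> sets borel" using K by (simp add: borel_closed compact_imp_closed)
  have "integrable lborel (\<lambda>x. indicator K x *\<^sub>R h x)"
  proof (rule Bochner_Integration.integrable_bound)
    show "integrable lborel (\<lambda>x. indicator (ball 0 r) x * u x)" using u(1) by (simp add: loc_int_def)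
    show "AE x in lborel. norm (indicator K x *\<^sub>R h x) \<le> norm (indicator (ball 0 r) x * u x)"
    proof (intro AE_I2)
      fix x
      show "norm (indicator K x *\<^sub>R h x) \<le> norm (indicator (ball 0 r) x * u x)"
        using r h[of x] by (cases "x \<in> K") auto
    qed
  qed measurable
  then show "integrable lebesgue (\<lambda>x. indicator K x *\<^sub>R h x)"
    by (subst integrable_completion) auto
qed

lemma compactly_supported_ball:
  fixes \<psi> :: "'a::euclidean_space \<Rightarrow> 'b::zero"
  assumes "compactly_supported \<psi>"
  obtains R where "\<And>x. norm x > R \<Longrightarrow> \<psi> x = 0"
proof -
  obtain R where R: "closure {x. \<psi> x \<noteq> 0} \<subseteq> ball 0 R"
    using bounded_subset_ballD[OF compact_imp_bounded[OF assms[unfolded compactly_supported_def]], of 0] by auto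
  have "\<psi> x = 0" if "norm x > R" for x
  proof (rule ccontr)
    assume "\<psi> x \<noteq> 0"
    then have "x \<in> closure {x. \<psi> x \<noteq> 0}" by (intro subsetD[OF closure_subset]) simp
    then have "x \<in> ball 0 R" by (rule subsetD[OF R])
    then show False using that by simp
  qed
  then show thesis by (rule that)
qed

lemma smooth_differentiable:
  assumes "smooth \<psi>"
  shows "\<psi> differentiable (at x)" "partial_deriv i \<psi> differentiable (at x)"
  using assms[unfolded smooth_def, rule_format, of "[]" x] assms[unfolded smooth_def, rule_format, of "[i]" x] by auto

lemma test_function_properties:
  fixes \<psi> :: "real^'n \<Rightarrow> real"
  assumes \<psi>: "smooth \<psi>" "compactly_supported \<psi>"
  obtains R where "continuous_on UNIV \<psi>" "continuous_on UNIV (partial_deriv i \<psi>)"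
    "\<And>x. ((\<lambda>t. \<psi> (x + t *\<^sub>R axis i 1)) has_real_derivative partial_deriv i \<psi> x) (at 0)"
    "\<And>x. norm x \<ge> R \<Longrightarrow> \<psi> x = 0" "\<And>x. norm x \<ge> R \<Longrightarrow> partial_deriv i \<psi> x = 0"
proof -
  obtain R where R: "\<And>x. norm x > R \<Longrightarrow> \<psi> x = 0" using compactly_supported_ball[OF \<psi>(2)] by blast
  note d = smooth_differentiable[OF \<psi>(1)]
  show thesis
  proof (rule that[of "R + 1"])
    show "continuous_on UNIV \<psi>" "continuous_on UNIV (partial_deriv i \<psi>)"
      using d by (meson continuous_at_imp_continuous_on differentiable_imp_continuous_within)+
    show "((\<lambda>t. \<psi> (x + t *\<^sub>R axis i 1)) has_real_derivative partial_deriv i \<psi> x) (at 0)" for x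
    proof -
      define D where "D = frechet_derivative \<psi> (at x)"
      have D: "(\<psi> has_derivative D) (at x)" unfolding D_def using d(1) frechet_derivative_works by blast
      then have "linear D" by (rule has_derivative_linear)
      have "(\<psi> has_derivative D) (at (x + 0 *\<^sub>R axis i 1))" using D by simp
      moreover have "((\<lambda>t::real. x + t *\<^sub>R axis i 1) has_derivative (\<lambda>h. h *\<^sub>R axis i 1)) (at 0)"
        by (auto intro!: derivative_eq_intros)
      ultimately have "((\<lambda>t. \<psi> (x + t *\<^sub>R axis i 1)) has_derivative (\<lambda>h. D (h *\<^sub>R axis i 1))) (at 0)"
        by (rule has_derivative_compose[rotated])
      then show ?thesis
        unfolding has_field_derivative_def partial_deriv_def D_def[symmetric]
        by (simp add: linear_scale[OF \<open>linear D\<close>] mult.commute[of _ "D (axis i 1)"])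
    qed
    show "\<psi> x = 0" if "norm x \<ge> R + 1" for x using that by (intro R) simp
    show "partial_deriv i \<psi> x = 0" if "norm x \<ge> R + 1" for x
    proof -
      have "open {x::real^'n. norm x > R}" by (intro open_Collect_less continuous_intros)
      then have "frechet_derivative \<psi> (at x) = frechet_derivative (\<lambda>_. 0) (at x)"
        using that R by (intro frechet_derivative_transform_within_open[OF d(1)]) auto
      then show ?thesis by (simp add: partial_deriv_def)
    qed
  qed
qed

lemma (in kernel_family) loc_int_maxf:
  assumes f: "vanishing_mean f V"
  shows "AE x in lborel. maxf f x < \<infinity>" "loc_int (\<lambda>x. enn2real (maxf f x))"
proof -
  note [measurable] = borel_measurable_maxf[OF f]
  obtain A B where A: "A \<ge> 0" and B [measurable]: "B \<in> borel_measurable borel" and Bi: "(\<integral>\<^sup>+x. B x \<partial>lborel) < \<infinity>"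
    and le: "\<And>x. maxf f x \<le> ennreal A + B x"
    using maxf_le_integrable[OF f] by metis
  have "AE x in lborel. B x \<noteq> \<infinity>" using Bi by (intro nn_integral_PInf_AE) auto
  then show "AE x in lborel. maxf f x < \<infinity>"
  proof eventually_elim
    case (elim x)
    have "ennreal A + B x < \<infinity>" using elim by (simp add: less_top[symmetric])
    with le[of x] show ?case by (rule le_less_trans)
  qed
  show "loc_int (\<lambda>x. enn2real (maxf f x))"
    unfolding loc_int_def
  proof (intro allI integrableI_bounded)
    fix r
    have "(\<integral>\<^sup>+x. ennreal (norm (indicator (ball 0 r) x * enn2real (maxf f x))) \<partial>lborel)
      \<le> (\<integral>\<^sup>+x. ennreal A * indicator (ball 0 r) x + B x \<partial>lborel)"
    proof (intro nn_integral_mono)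
      fix x
      show "ennreal (norm (indicator (ball 0 r) x * enn2real (maxf f x))) \<le> ennreal A * indicator (ball 0 r) x + B x"
      proof (cases "x \<in> ball 0 r")
        case True
        have "ennreal (enn2real (maxf f x)) \<le> maxf f x" by (cases "maxf f x") auto
        also note le[of x]
        finally show ?thesis using True by (simp add: abs_mult)
      qed simp
    qed
    also have "\<dots> = ennreal A * emeasure lborel (ball (0::'a) r) + (\<integral>\<^sup>+x. B x \<partial>lborel)"
      by (subst nn_integral_add) (auto simp: nn_integral_cmult_indicator)
    also have "\<dots> < \<infinity>" using Bi emeasure_lborel_ball_finite[of "0::'a" r] by (auto simp: ennreal_mult_less_top)
    finally show "(\<integral>\<^sup>+x. ennreal (norm (indicator (ball 0 r) x * enn2real (maxf f x))) \<partial>lborel) < \<infinity>" .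
  qed measurable
qed

text \<open>The additional data provide kernels at all scales \<open>2 ^ m\<close> whose weights
  grow and whose integrals stay away from 0. \<open>vanishing_meanI\<close> takes them as input to
  exclude a nonzero mean value at infinity.\<close>

locale kernel_family_vec =
  kernel_family S K \<kappa> w \<Phi> \<Psi> c \<alpha>
  for S :: "'b set" and K :: "'b \<Rightarrow> real^'n \<Rightarrow> real" and \<kappa> :: "'b \<Rightarrow> int" and w :: "'b \<Rightarrow> real"
    and \<Phi> :: "int \<Rightarrow> real^'n \<Rightarrow> ennreal" and \<Psi> :: "int \<Rightarrow> real^'n \<Rightarrow> real^'n \<Rightarrow> ennreal" and c \<alpha> :: real +
  fixes \<delta> :: real and b :: "nat \<Rightarrow> 'b"
  assumes \<delta>: "\<delta> > 0" and b: "\<And>m. b m \<in> S" "\<And>m. \<kappa> (b m) = int m" "\<And>m. w (b m) \<ge> \<delta> * 2 powr (\<alpha> * real m)"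
    and K_integral: "\<And>m. \<bar>LINT x|lborel. K (b m) x\<bar> \<ge> \<delta>"
begin

text \<open>The first \<open>CARD('n)\<close> comes from combining the partial derivatives, the
  factor \<open>2 * CARD('n)\<close> from the bound in
  \<open>maxf_difference_quotient\<close>.\<close>

definition grad_const :: real where
  "grad_const = real CARD('n) * diff_const powr (1 / \<mu>) * (2 * real CARD('n))"

lemma grad_const_nonneg: "grad_const \<ge> 0"
  by (simp add: grad_const_def)

text \<open>Places the exponent in the range of the bracket estimates:
  \<open>n / (n - \<alpha>) \<le> 2\<close> amounts to \<open>2 \<alpha> \<le> n\<close>.\<close>

lemma \<mu>_le_2: "\<mu> \<le> 2"
  using dim \<alpha> by (simp add: \<mu>_def divide_le_eq)

lemma maxf_weak_partial:
  assumes f: "vanishing_mean f V"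
  obtains G where "G \<in> borel_measurable borel"
    "(\<integral>\<^sup>+x. ennreal (\<bar>G x\<bar> powr \<mu>) \<partial>lborel) \<le> ennreal (diff_const * (2 * real CARD('n) * V) powr \<mu>)"
    "\<And>\<psi>. smooth \<psi> \<Longrightarrow> compactly_supported \<psi> \<Longrightarrow>
      (LINT x|lborel. enn2real (maxf f x) * partial_deriv i \<psi> x) = - (LINT x|lborel. G x * \<psi> x)"
proof -
  note [measurable] = borel_measurable_maxf[OF f]
  define F where "F x = enn2real (maxf f x)" for x
  have Fm [measurable]: "F \<in> borel_measurable borel" unfolding F_def by measurable
  have Fl: "loc_int F" unfolding F_def by (rule loc_int_maxf(2)[OF f])
  have bound: "(\<integral>\<^sup>+x. ennreal (\<bar>2 ^ m * (F (x + (1 / 2 ^ m) *\<^sub>R axis i 1) - F x)\<bar> powr \<mu>) \<partial>lborel)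
    \<le> ennreal (diff_const * (2 * real CARD('n) * V) powr \<mu>)" for m :: nat
  proof -
    define v :: "real^'n" where "v = (1 / 2 ^ m) *\<^sub>R axis i 1"
    have nv: "norm v = 1 / 2 ^ m" by (simp add: v_def norm_axis_1)
    have "v \<noteq> 0" using nv by auto
    have "\<bar>2 ^ m * (F (x + v) - F x)\<bar> = \<bar>F (x + v) - F x\<bar> / norm v" for x
      by (simp add: nv abs_mult)
    then show ?thesis using maxf_difference_quotient[OF f \<open>v \<noteq> 0\<close>] by (simp add: F_def v_def)
  qed
  obtain G where G: "G \<in> borel_measurable borel"
    "(\<integral>\<^sup>+x. ennreal (\<bar>G x\<bar> powr \<mu>) \<partial>lborel) \<le> ennreal (diff_const * (2 * real CARD('n) * V) powr \<mu>)"
    "\<And>\<psi> \<psi>' R. (\<And>x. ((\<lambda>t. \<psi> (x + t *\<^sub>R axis i 1)) has_real_derivative \<psi>' x) (at 0)) \<Longrightarrow>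
       continuous_on UNIV \<psi> \<Longrightarrow> continuous_on UNIV \<psi>' \<Longrightarrow>
       (\<And>x. norm x \<ge> R \<Longrightarrow> \<psi> x = 0) \<Longrightarrow> (\<And>x. norm x \<ge> R \<Longrightarrow> \<psi>' x = 0) \<Longrightarrow>
       (LINT x|lborel. F x * \<psi>' x) = - (LINT x|lborel. G x * \<psi> x)"
    by (rule weak_derivative_of_bounded_quotients[OF Fl Fm \<mu>_gt_1 \<mu>_le_2 _ bound]) (use diff_const_nonneg in auto)
  show thesis
  proof (rule that[OF G(1,2)])
    fix \<psi> :: "real^'n \<Rightarrow> real" assume \<psi>: "smooth \<psi>" "compactly_supported \<psi>"
    show "(LINT x|lborel. enn2real (maxf f x) * partial_deriv i \<psi> x) = - (LINT x|lborel. G x * \<psi> x)"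
    proof (rule test_function_properties[OF \<psi>, of i])
      fix R
      assume p: "continuous_on UNIV \<psi>" "continuous_on UNIV (partial_deriv i \<psi>)"
        "\<And>x. ((\<lambda>t. \<psi> (x + t *\<^sub>R axis i 1)) has_real_derivative partial_deriv i \<psi> x) (at 0)"
        "\<And>x. norm x \<ge> R \<Longrightarrow> \<psi> x = 0" "\<And>x. norm x \<ge> R \<Longrightarrow> partial_deriv i \<psi> x = 0"
      show ?thesis using G(3)[OF p(3,1,2,4,5)] by (simp add: F_def)
    qed
  qed
qed

lemma maxf_weak_gradient:
  assumes f: "vanishing_mean f V"
  obtains G where "has_weak_gradient (maxf f) G" "Lp_norm \<mu> G \<le> ennreal (grad_const * V)"
proof -
  note mm [measurable] = borel_measurable_maxf[OF f]
  have V: "V \<ge> 0" using f by (simp add: vanishing_mean_def)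
  define A where "A = diff_const * (2 * real CARD('n) * V) powr \<mu>"
  have A: "A \<ge> 0" using diff_const_nonneg by (simp add: A_def)
  have "\<forall>i. \<exists>g. g \<in> borel_measurable borel \<and> (\<integral>\<^sup>+x. ennreal (\<bar>g x\<bar> powr \<mu>) \<partial>lborel) \<le> ennreal A \<and>
    (\<forall>\<psi>. smooth \<psi> \<longrightarrow> compactly_supported \<psi> \<longrightarrow>
      (LINT x|lborel. enn2real (maxf f x) * partial_deriv i \<psi> x) = - (LINT x|lborel. g x * \<psi> x))"
  proof
    fix i
    show "\<exists>g. g \<in> borel_measurable borel \<and> (\<integral>\<^sup>+x. ennreal (\<bar>g x\<bar> powr \<mu>) \<partial>lborel) \<le> ennreal A \<and>
      (\<forall>\<psi>. smooth \<psi> \<longrightarrow> compactly_supported \<psi> \<longrightarrow>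
        (LINT x|lborel. enn2real (maxf f x) * partial_deriv i \<psi> x) = - (LINT x|lborel. g x * \<psi> x))"
      unfolding A_def by (rule maxf_weak_partial[OF f, of i]) blast
  qed
  from choice[OF this] obtain g where g: "\<forall>i. g i \<in> borel_measurable borel \<and> (\<integral>\<^sup>+x. ennreal (\<bar>g i x\<bar> powr \<mu>) \<partial>lborel) \<le> ennreal A \<and>
    (\<forall>\<psi>. smooth \<psi> \<longrightarrow> compactly_supported \<psi> \<longrightarrow>
      (LINT x|lborel. enn2real (maxf f x) * partial_deriv i \<psi> x) = - (LINT x|lborel. g i x * \<psi> x))" ..
  have gm [measurable]: "\<And>i. g i \<in> borel_measurable borel"
    and gp: "\<And>i. (\<integral>\<^sup>+x. ennreal (\<bar>g i x\<bar> powr \<mu>) \<partial>lborel) \<le> ennreal A"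
    and gw: "\<And>i \<psi>. smooth \<psi> \<Longrightarrow> compactly_supported \<psi> \<Longrightarrow>
      (LINT x|lborel. enn2real (maxf f x) * partial_deriv i \<psi> x) = - (LINT x|lborel. g i x * \<psi> x)"
    using g by auto
  define G :: "real^'n \<Rightarrow> real^'n" where "G x = (\<Sum>i\<in>UNIV. g i x *\<^sub>R axis i 1)" for x
  have Gm [measurable]: "G \<in> borel_measurable borel" unfolding G_def by measurable
  have Gi: "G x $ i = g i x" for x i
    unfolding G_def by (simp add: sum_component axis_def if_distrib cong: if_cong)
  have Gn: "norm (G x) \<le> (\<Sum>i\<in>UNIV. \<bar>g i x\<bar>)" for x
    using norm_le_l1_cart[of "G x"] by (simp add: Gi)
  have gl: "loc_int (g i)" for i
    unfolding loc_int_def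
  proof (intro allI integrableI_bounded)
    fix r
    have "(\<integral>\<^sup>+x. ennreal (norm (indicator (ball 0 r) x * g i x)) \<partial>lborel)
      \<le> (\<integral>\<^sup>+x. indicator (ball 0 r) x + ennreal (\<bar>g i x\<bar> powr \<mu>) \<partial>lborel)"
    proof (intro nn_integral_mono)
      fix x
      have "\<bar>t\<bar> \<le> 1 + \<bar>t\<bar> powr \<mu>" for t :: real
      proof (cases "\<bar>t\<bar> \<le> 1")
        case False
        then have "\<bar>t\<bar> powr 1 \<le> \<bar>t\<bar> powr \<mu>" using \<mu>_gt_1 by (intro powr_mono) auto
        then show ?thesis using False by simp
      qed (simp add: add_increasing2)
      then have "ennreal \<bar>g i x\<bar> \<le> ennreal (1 + \<bar>g i x\<bar> powr \<mu>)" by (intro ennreal_leI)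
      then show "ennreal (norm (indicator (ball 0 r) x * g i x)) \<le> indicator (ball 0 r) x + ennreal (\<bar>g i x\<bar> powr \<mu>)"
        by (cases "x \<in> ball 0 r") auto
    qed
    also have "\<dots> = emeasure lborel (ball (0::real^'n) r) + (\<integral>\<^sup>+x. ennreal (\<bar>g i x\<bar> powr \<mu>) \<partial>lborel)"
      by (subst nn_integral_add) auto
    also have "\<dots> < \<infinity>"
    proof -
      have "(\<integral>\<^sup>+x. ennreal (\<bar>g i x\<bar> powr \<mu>) \<partial>lborel) < \<infinity>" by (rule le_less_trans[OF gp]) simp
      then show ?thesis using emeasure_lborel_ball_finite[of "0::real^'n" r] by simp
    qed
    finally show "(\<integral>\<^sup>+x. ennreal (norm (indicator (ball 0 r) x * g i x)) \<partial>lborel) < \<infinity>" .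
  qed measurable
  have sl: "loc_int (\<lambda>x. \<Sum>i\<in>UNIV. \<bar>g i x\<bar>)"
    unfolding loc_int_def
  proof
    fix r
    have "integrable lborel (\<lambda>x. \<Sum>i\<in>UNIV. \<bar>indicator (ball 0 r) x * g i x\<bar>)"
      using gl unfolding loc_int_def by (intro Bochner_Integration.integrable_sum integrable_abs) auto
    then show "integrable lborel (\<lambda>x. indicator (ball 0 r) x * (\<Sum>i\<in>UNIV. \<bar>g i x\<bar>))"
      by (simp add: sum_distrib_left abs_mult)
  qed
  have grad: "has_weak_gradient (maxf f) G"
    unfolding has_weak_gradient_def
  proof (intro conjI allI impI)
    show "AE x in lebesgue. maxf f x < \<infinity>" by (rule AE_completion[OF loc_int_maxf(1)[OF f]])
    show "locally_integrable (\<lambda>x. enn2real (maxf f x))"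
      by (rule loc_int_imp_locally_integrable[OF _ _ loc_int_maxf(2)[OF f]]) auto
    show "locally_integrable G"
      by (rule loc_int_imp_locally_integrable[OF _ Gn sl]) auto
    fix \<psi> :: "real^'n \<Rightarrow> real" and i
    assume \<psi>: "smooth \<psi> \<and> compactly_supported \<psi>"
    have c: "continuous_on UNIV \<psi>" "continuous_on UNIV (partial_deriv i \<psi>)"
      using smooth_differentiable \<psi> by (meson continuous_at_imp_continuous_on differentiable_imp_continuous_within)+
    note [measurable] = borel_measurable_continuous_onI[OF c(1)] borel_measurable_continuous_onI[OF c(2)]
    have "(LINT x|lebesgue. enn2real (maxf f x) * partial_deriv i \<psi> x) = (LINT x|lborel. enn2real (maxf f x) * partial_deriv i \<psi> x)"
      by (rule integral_completion) measurable
    also have "\<dots> = - (LINT x|lborel. g i x * \<psi> x)" using gw \<psi> by simp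
    also have "(LINT x|lborel. g i x * \<psi> x) = (LINT x|lebesgue. g i x * \<psi> x)"
      by (rule integral_completion[symmetric]) measurable
    finally show "(LINT x|lebesgue. enn2real (maxf f x) * partial_deriv i \<psi> x) = - (LINT x|lebesgue. G x $ i * \<psi> x)"
      by (simp add: Gi)
  qed
  define N where "N = real CARD('n)"
  have N: "N > 0" by (simp add: N_def)
  have I: "(\<integral>\<^sup>+x. ennreal (norm (G x) powr \<mu>) \<partial>lebesgue) \<le> ennreal (N powr \<mu> * A)"
  proof -
    have "(\<integral>\<^sup>+x. ennreal (norm (G x) powr \<mu>) \<partial>lebesgue) = (\<integral>\<^sup>+x. ennreal (norm (G x) powr \<mu>) \<partial>lborel)"
      by (rule nn_integral_completion)
    also have "\<dots> \<le> (\<integral>\<^sup>+x. ennreal (N powr (\<mu> - 1)) * (\<Sum>i\<in>UNIV. ennreal (\<bar>g i x\<bar> powr \<mu>)) \<partial>lborel)"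
    proof (intro nn_integral_mono)
      fix x
      have "norm (G x) powr \<mu> \<le> (\<Sum>i\<in>UNIV. \<bar>g i x\<bar>) powr \<mu>" using Gn \<mu>_gt_1 by (intro powr_mono2) auto
      \<comment> \<open>\<open>powr_sum_le_weighted\<close> with all weights equal to 1, that is,
        Jensen's inequality for \<open>CARD('n)\<close> terms.\<close>
      also have "\<dots> \<le> N powr (\<mu> - 1) * (\<Sum>i\<in>UNIV. 1 powr (1 - \<mu>) * \<bar>g i x\<bar> powr \<mu>)"
        using \<mu>_gt_1 by (intro powr_sum_le_weighted) (auto simp: N_def)
      finally have "ennreal (norm (G x) powr \<mu>) \<le> ennreal (N powr (\<mu> - 1) * (\<Sum>i\<in>UNIV. \<bar>g i x\<bar> powr \<mu>))"
        by (intro ennreal_leI) simp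
      then show "ennreal (norm (G x) powr \<mu>) \<le> ennreal (N powr (\<mu> - 1)) * (\<Sum>i\<in>UNIV. ennreal (\<bar>g i x\<bar> powr \<mu>))"
        by (simp add: ennreal_mult' sum_ennreal)
    qed
    also have "\<dots> = ennreal (N powr (\<mu> - 1)) * (\<Sum>i\<in>UNIV. \<integral>\<^sup>+x. ennreal (\<bar>g i x\<bar> powr \<mu>) \<partial>lborel)"
      by (simp add: nn_integral_cmult nn_integral_sum del: sum_ennreal)
    also have "\<dots> \<le> ennreal (N powr (\<mu> - 1)) * (\<Sum>i\<in>(UNIV::'n set). ennreal A)"
      by (intro mult_left_mono sum_mono gp) auto
    also have "(\<Sum>i\<in>(UNIV::'n set). ennreal A) = ennreal (N * A)"
      using A by (subst sum_ennreal) (auto simp: N_def)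
    also have "ennreal (N powr (\<mu> - 1)) * ennreal (N * A) = ennreal (N powr (\<mu> - 1) * N powr 1 * A)"
      using A N by (subst ennreal_mult'[symmetric]) (auto simp: mult.assoc)
    also have "N powr (\<mu> - 1) * N powr 1 = N powr \<mu>" unfolding powr_add[symmetric] by simp
    finally show ?thesis .
  qed
  have "Lp_norm \<mu> G \<le> ennreal (grad_const * V)"
  proof -
    define J where "J = (\<integral>\<^sup>+x. ennreal (norm (G x) powr \<mu>) \<partial>lebesgue)"
    have J: "J \<le> ennreal (N powr \<mu> * A)" "J \<noteq> \<infinity>" using I by (auto simp: J_def top_unique)
    have "enn2real J \<le> N powr \<mu> * A" using J(1) A by (intro enn2real_leI) auto
    then have "enn2real J powr (1 / \<mu>) \<le> (N powr \<mu> * A) powr (1 / \<mu>)"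
      using \<mu>_gt_1 by (intro powr_mono2) auto
    also have "\<dots> = N * (diff_const powr (1 / \<mu>) * (2 * N * V))"
      using N V diff_const_nonneg \<mu>_gt_1 by (simp add: A_def powr_mult powr_powr N_def[symmetric])
    also have "\<dots> = grad_const * V" by (simp add: grad_const_def N_def)
    finally show ?thesis
      using J(2) unfolding Lp_norm_def J_def[symmetric] by (simp add: ennreal_leI)
  qed
  with grad show thesis by (rule that)
qed

end

section \<open>Borel representatives\<close>

text \<open>Functions in \<open>BV_dot\<close> are only Lebesgue measurable, while the arguments by
  translation and Fubini are made for Borel functions. As a limit of its restrictions to balls,
  \<open>f\<close> is Lebesgue measurable, and a Borel function equal to it almost everywhere
  inherits local integrability.\<close>

lemma locally_integrable_borel_representative:
  fixes f :: "real^'n \<Rightarrow> real"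
  assumes f: "locally_integrable f"
  obtains g where "g \<in> borel_measurable borel" "AE x in lebesgue. f x = g x" "loc_int g" "f \<in> borel_measurable lebesgue"
proof -
  have fi: "integrable lebesgue (\<lambda>x. indicator (cball 0 r) x *\<^sub>R f x)" for r
    by (rule f[unfolded locally_integrable_def set_integrable_def, rule_format, OF compact_cball])
  have fm: "f \<in> borel_measurable lebesgue"
  proof (rule borel_measurable_LIMSEQ_real)
    show "(\<lambda>k. indicator (cball 0 (real k)) x *\<^sub>R f x) \<longlonglongrightarrow> f x" for x
    proof (rule tendsto_eventually)
      obtain k where "norm x \<le> real k" using real_arch_simple by blast
      then show "\<forall>\<^sub>F k in sequentially. indicator (cball 0 (real k)) x *\<^sub>R f x = f x"
        unfolding eventually_sequentially by (intro exI[of _ k]) auto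
    qed
    show "(\<lambda>x. indicator (cball 0 (real k)) x *\<^sub>R f x) \<in> borel_measurable lebesgue" for k
      by (rule borel_measurable_integrable[OF fi])
  qed
  obtain g where g: "g \<in> borel_measurable lborel" "AE x in lborel. f x = g x"
    using completion_ex_borel_measurable_real[OF fm] by blast
  have gm [measurable]: "g \<in> borel_measurable borel" using g by simp
  have gA: "AE x in lebesgue. f x = g x" by (rule AE_completion[OF g(2)])
  have "integrable lborel (\<lambda>y. indicator (ball 0 r) y * g y)" for r
  proof -
    have [measurable]: "cball (0::real^'n) r \<in> sets borel" by simp
    have "integrable lebesgue (\<lambda>y. indicator (cball 0 r) y *\<^sub>R g y)"
    proof (rule integrable_cong_AE_imp[OF fi[of r]])
      show "(\<lambda>y. indicator (cball 0 r) y *\<^sub>R g y) \<in> borel_measurable lebesgue"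
        by (rule measurable_completion) measurable
      show "AE x in lebesgue. indicator (cball 0 r) x *\<^sub>R f x = indicator (cball 0 r) x *\<^sub>R g x"
        using gA by eventually_elim simp
    qed
    then have "integrable lborel (\<lambda>y. indicator (cball 0 r) y *\<^sub>R g y)"
      by (subst (asm) integrable_completion) auto
    from integrable_mult_indicator[OF _ this, of "ball 0 r"]
    have "integrable lborel (\<lambda>x. indicator (ball 0 r) x *\<^sub>R indicator (cball 0 r) x *\<^sub>R g x)" by simp
    also have "(\<lambda>x. indicator (ball 0 r) x *\<^sub>R indicator (cball 0 r) x *\<^sub>R g x) = (\<lambda>y. indicator (ball 0 r) y * g y)"
      by (auto simp: fun_eq_iff indicator_def)
    finally show ?thesis .
  qed
  then have "loc_int g" by (simp add: loc_int_def)
  then show thesis using that gm gA fm by blast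
qed

lemma divergence_measurable:
  fixes g :: "real^'n \<Rightarrow> real^'n"
  assumes "g \<in> C1c"
  shows "divergence g \<in> borel_measurable borel"
proof -
  obtain g' where g': "\<And>x. (g has_derivative blinfun_apply (g' x)) (at x)" "continuous_on UNIV g'"
    using assms by (auto simp: C1c_def)
  have "partial_deriv i (\<lambda>y. g y $ i) x = g' x (axis i 1) $ i" for i x
  proof -
    have "((\<lambda>y. g y $ i) has_derivative (\<lambda>h. g' x h $ i)) (at x)"
      using g'(1)[of x] by (rule bounded_linear.has_derivative[OF bounded_linear_vec_nth])
    from frechet_derivative_at[OF this] show ?thesis by (simp add: partial_deriv_def fun_eq_iff)
  qed
  then have "divergence g = (\<lambda>x. \<Sum>i\<in>UNIV. g' x (axis i 1) $ i)" by (simp add: divergence_def fun_eq_iff)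
  moreover have "continuous_on UNIV (\<lambda>x. \<Sum>i\<in>UNIV. g' x (axis i 1) $ i)"
    by (intro continuous_intros g'(2))
  ultimately show ?thesis by (simp add: borel_measurable_continuous_onI)
qed

lemma BV_seminorm_cong_AE:
  fixes f g :: "real^'n \<Rightarrow> real"
  assumes fg: "AE x in lebesgue. f x = g x" and [measurable]: "f \<in> borel_measurable lebesgue" "g \<in> borel_measurable lebesgue"
  shows "BV_seminorm f = BV_seminorm g"
  unfolding BV_seminorm_def
proof (intro SUP_cong refl)
  fix h :: "real^'n \<Rightarrow> real^'n" assume "h \<in> {g \<in> C1c. esssup lebesgue (\<lambda>x. ereal (norm (g x))) \<le> 1}"
  then have "divergence h \<in> borel_measurable borel" by (intro divergence_measurable) simp
  then have [measurable]: "divergence h \<in> borel_measurable lebesgue" by (intro measurable_completion) simp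
  have "(LINT x|lebesgue. f x * divergence h x) = (LINT x|lebesgue. g x * divergence h x)"
    using fg by (intro integral_cong_AE) auto
  then show "ennreal (LINT x|lebesgue. f x * divergence h x) = ennreal (LINT x|lebesgue. g x * divergence h x)" by simp
qed

context kernel_family_vec
begin

lemma BV_maximal_gradient:
  fixes f :: "real^'n \<Rightarrow> real"
  assumes f: "f \<in> BV_dot" and fin: "(SUP b\<in>S. ennreal (w b * \<bar>LINT y|lebesgue. K b (x0 - y) * f y\<bar>)) < \<infinity>"
  shows "\<exists>G. has_weak_gradient (\<lambda>x. SUP b\<in>S. ennreal (w b * \<bar>LINT y|lebesgue. K b (x - y) * f y\<bar>)) G
    \<and> Lp_norm \<mu> G \<le> ennreal grad_const * BV_seminorm f"
proof -
  have fl: "locally_integrable f" and fV: "BV_seminorm f < \<infinity>" using f by (auto simp: BV_dot_def)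
  obtain g where gm [measurable]: "g \<in> borel_measurable borel" and ae: "AE x in lebesgue. f x = g x"
    and gl: "loc_int g" and fm [measurable]: "f \<in> borel_measurable lebesgue"
    using locally_integrable_borel_representative[OF fl] by blast
  have gml [measurable]: "g \<in> borel_measurable lebesgue" by (intro measurable_completion) simp
  define V where "V = enn2real (BV_seminorm f)"
  have V: "V \<ge> 0" "BV_seminorm f = ennreal V" using fV by (auto simp: V_def less_top)
  have gV: "BV_seminorm g \<le> ennreal V" using BV_seminorm_cong_AE[OF ae fm gml] V by simp
  have tv: "translation_var g V" by (rule BV_translation_var[OF gl gm gV V(1)])
  \<comment> \<open>The integrals do not see null sets, so the maximal functions of \<open>f\<close>
    and \<open>g\<close> agree at every point, in particular at \<open>x0\<close>.\<close>
  have eq: "(SUP b\<in>S. ennreal (w b * \<bar>LINT y|lebesgue. K b (x - y) * f y\<bar>)) = maxf g x" for x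
    unfolding maxf_def
  proof (intro SUP_cong refl)
    fix b
    have [measurable]: "(\<lambda>y. K b (x - y)) \<in> borel_measurable lebesgue" by (intro measurable_completion) simp
    have "(LINT y|lebesgue. K b (x - y) * f y) = (LINT y|lebesgue. K b (x - y) * g y)"
      using ae by (intro integral_cong_AE) auto
    also have "\<dots> = conv (K b) g x" unfolding conv_def by (rule integral_completion) measurable
    finally show "ennreal (w b * \<bar>LINT y|lebesgue. K b (x - y) * f y\<bar>) = ennreal (w b * \<bar>conv (K b) g x\<bar>)" by simp
  qed
  have "vanishing_mean g V"
    by (rule vanishing_meanI[OF gl tv V(1) _ \<delta> b K_integral, of x0]) (use fin eq in simp)
  then obtain G where "has_weak_gradient (maxf g) G" "Lp_norm \<mu> G \<le> ennreal (grad_const * V)"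
    by (rule maxf_weak_gradient)
  then show ?thesis
    unfolding eq V(2) using grad_const_nonneg by (auto simp: ennreal_mult')
qed

end

section \<open>The lacunary maximal function\<close>

lemma power_diff_le:
  fixes a b :: real
  assumes "0 \<le> a" "a \<le> b"
  shows "b ^ n - a ^ n \<le> real n * (b - a) * b ^ (n - 1)"
proof (induction n)
  case (Suc n)
  have "b ^ Suc n - a ^ Suc n = b * (b ^ n - a ^ n) + a ^ n * (b - a)" by (simp add: algebra_simps)
  also have "\<dots> \<le> b * (real n * (b - a) * b ^ (n - 1)) + b ^ n * (b - a)"
    using assms Suc by (intro add_mono mult_left_mono mult_right_mono power_mono) auto
  also have "b * (real n * (b - a) * b ^ (n - 1)) = real n * (b - a) * b ^ n"
    by (cases n) auto
  finally show ?case by (simp add: algebra_simps)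
qed simp

text \<open>For \<open>norm v \<le> r\<close> the ball and its translate differ only inside an
  annulus of width \<open>2 * norm v\<close>, whose volume \<open>power_diff_le\<close> estimates;
  this gives \<open>DIM('a) * 2 ^ DIM('a)\<close>. For longer \<open>v\<close> twice the volume of
  the ball suffices, which gives the summand 2.\<close>

lemma nn_integral_ball_translate_diff:
  fixes v :: "'a::euclidean_space"
  assumes r: "r > 0"
  shows "(\<integral>\<^sup>+x. ennreal \<bar>indicator (ball 0 r) (x + v) - indicator (ball 0 r) (x::'a)\<bar> \<partial>lborel)
    \<le> ennreal (norm v * (real DIM('a) * 2 ^ DIM('a) + 2) / r * vball TYPE('a) r)"
proof -
  define n where "n = DIM('a)"
  define t where "t = norm v"
  have t: "t \<ge> 0" by (simp add: t_def)
  define u where "u = vball TYPE('a) 1"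
  have u: "u > 0" by (simp add: u_def)
  have vr: "vball TYPE('a) s = s ^ n * u" if "s \<ge> 0" for s using vball_scale[OF that, where 'a='a] by (simp add: n_def u_def)
  show ?thesis
  proof (cases "t \<le> r")
    case True
    have "(\<integral>\<^sup>+x. ennreal \<bar>indicator (ball 0 r) (x + v) - indicator (ball 0 r) (x::'a)\<bar> \<partial>lborel)
      \<le> (\<integral>\<^sup>+x. indicator (ball 0 (r + t) - ball 0 (r - t)) (x::'a) \<partial>lborel)"
    proof (intro nn_integral_mono)
      fix x :: 'a
      have "norm x \<le> norm (x + v) + t" "norm (x + v) \<le> norm x + t"
        using norm_triangle_ineq[of x v] norm_triangle_ineq4[of "x + v" v] by (auto simp: t_def)
      then show "ennreal \<bar>indicator (ball 0 r) (x + v) - indicator (ball 0 r) x\<bar> \<le> indicator (ball 0 (r + t) - ball 0 (r - t)) x"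
        using t by (auto simp: indicator_def)
    qed
    also have "\<dots> = emeasure lborel (ball (0::'a) (r + t) - ball 0 (r - t))" by simp
    also have "\<dots> = emeasure lborel (ball (0::'a) (r + t)) - emeasure lborel (ball (0::'a) (r - t))"
      using t by (intro emeasure_Diff) (auto simp: emeasure_vball)
    also have "\<dots> = ennreal ((r + t) ^ n * u - (r - t) ^ n * u)"
      using True t r u by (subst ennreal_minus[symmetric]) (auto simp: emeasure_vball vr)
    also have "\<dots> \<le> ennreal (t * (real n * 2 ^ n + 2) / r * vball TYPE('a) r)"
    proof (rule ennreal_leI)
      have n: "n > 0" by (simp add: n_def)
      have "(r + t) ^ n - (r - t) ^ n \<le> real n * ((r + t) - (r - t)) * (r + t) ^ (n - 1)"
        using True t by (intro power_diff_le) auto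
      also have "\<dots> \<le> real n * (2 * t) * (2 * r) ^ (n - 1)"
        using True t r by (intro mult_mono power_mono) auto
      also have "\<dots> = t * (real n * 2 ^ n) / r * r ^ n"
        using r n by (cases n) (auto simp: power_mult_distrib)
      also have "\<dots> \<le> t * (real n * 2 ^ n + 2) / r * r ^ n"
        using r t by (intro mult_right_mono divide_right_mono mult_left_mono) auto
      finally have "((r + t) ^ n - (r - t) ^ n) * u \<le> t * (real n * 2 ^ n + 2) / r * r ^ n * u"
        using u by (intro mult_right_mono) auto
      then show "(r + t) ^ n * u - (r - t) ^ n * u \<le> t * (real n * 2 ^ n + 2) / r * vball TYPE('a) r"
        using r by (simp add: vr left_diff_distrib mult.assoc)
    qed
    finally show ?thesis by (simp add: t_def n_def)
  next
    case False
    have "(\<integral>\<^sup>+x. ennreal \<bar>indicator (ball 0 r) (x + v) - indicator (ball 0 r) (x::'a)\<bar> \<partial>lborel)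
      \<le> (\<integral>\<^sup>+x. indicator (ball 0 r) (x + v) + indicator (ball 0 r) (x::'a) \<partial>lborel)"
      by (intro nn_integral_mono) (auto simp: indicator_def)
    also have "\<dots> = (\<integral>\<^sup>+x. indicator (ball 0 r) (x + v) \<partial>lborel) + (\<integral>\<^sup>+x. indicator (ball 0 r) (x::'a) \<partial>lborel)"
      by (rule nn_integral_add) measurable
    also have "(\<integral>\<^sup>+x. indicator (ball 0 r) (x + v) \<partial>lborel) = (\<integral>\<^sup>+x. indicator (ball 0 r) (x::'a) \<partial>lborel)"
      by (rule nn_integral_lborel_translate) measurable
    also have "(\<integral>\<^sup>+x. indicator (ball 0 r) (x::'a) \<partial>lborel) = ennreal (vball TYPE('a) r)"
      by (simp add: emeasure_vball)
    also have "ennreal (vball TYPE('a) r) + ennreal (vball TYPE('a) r) = ennreal (2 * vball TYPE('a) r)"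
      by (simp add: ennreal_plus[symmetric] del: ennreal_plus)
    also have "\<dots> \<le> ennreal (t * (real n * 2 ^ n + 2) / r * vball TYPE('a) r)"
    proof (intro ennreal_leI mult_right_mono)
      have "r * 2 \<le> t * (real n * 2 ^ n + 2)" using False r by (intro mult_mono) auto
      then show "2 \<le> t * (real n * 2 ^ n + 2) / r" using r by (simp add: pos_le_divide_eq mult.commute)
    qed simp
    finally show ?thesis by (simp add: t_def n_def)
  qed
qed

definition ball_kernel :: "int \<Rightarrow> 'a::euclidean_space \<Rightarrow> real" where
  "ball_kernel k x = indicator (ball 0 (2 powi k)) x / vball TYPE('a) (2 powi k)"

lemma borel_measurable_ball_kernel [measurable]: "ball_kernel k \<in> borel_measurable borel"
  unfolding ball_kernel_def by measurable

lemma ball_kernel_nonneg: "ball_kernel k x \<ge> 0"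
  by (simp add: ball_kernel_def)

lemma nn_integral_ball_kernel: "(\<integral>\<^sup>+x. ennreal (ball_kernel k (x::'a::euclidean_space)) \<partial>lborel) = 1"
proof -
  have v: "vball TYPE('a) (2 powi k) > 0" by (rule vball_pos) simp
  have "(\<integral>\<^sup>+x. ennreal (ball_kernel k (x::'a)) \<partial>lborel)
    = (\<integral>\<^sup>+x. ennreal (1 / vball TYPE('a) (2 powi k)) * indicator (ball (0::'a) (2 powi k)) x \<partial>lborel)"
    by (intro nn_integral_cong) (auto simp: ball_kernel_def indicator_def)
  also have "\<dots> = ennreal (1 / vball TYPE('a) (2 powi k)) * ennreal (vball TYPE('a) (2 powi k))"
    by (subst nn_integral_cmult_indicator) (auto simp: emeasure_vball)
  also have "\<dots> = ennreal (1 / vball TYPE('a) (2 powi k) * vball TYPE('a) (2 powi k))"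
    by (rule ennreal_mult'[symmetric]) simp
  finally show ?thesis using less_imp_neq[OF v] by simp
qed

text \<open>A sum of separate requirements: the first two summands serve the translation
  differences, the last one the height of the kernel.\<close>

definition ball_const :: "'a::euclidean_space itself \<Rightarrow> real" where
  "ball_const T = real DIM('a) * 2 ^ DIM('a) + 2 + 1 / vball T 1"

text \<open>Each scale carries a single kernel, so \<open>\<Phi>\<close> is the kernel itself and
  \<open>\<Psi>\<close> its difference quotient. For \<open>v = 0\<close> division by zero makes
  \<open>\<Psi>\<close> vanish, in accordance with the zero difference. The kernels have integral 1,
  whence \<open>\<delta> = 1\<close>.\<close>

lemma kernel_family_vec_ball:
  assumes n: "CARD('n::finite) \<ge> 2" and \<alpha>: "0 < \<alpha>" "\<alpha> < 1"
  shows "kernel_family_vec UNIV (ball_kernel :: int \<Rightarrow> real^'n \<Rightarrow> real) (\<lambda>k. k) (\<lambda>k. (2 powi k) powr \<alpha>)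
    (\<lambda>k x. ennreal (ball_kernel k x)) (\<lambda>k v x. ennreal (\<bar>ball_kernel k (x + v) - ball_kernel k x\<bar> / norm v))
    (ball_const TYPE(real^'n)) \<alpha> 1 int"
proof
  let ?c = "ball_const TYPE(real^'n)"
  let ?v = "\<lambda>k. vball TYPE(real^'n) (2 powi k)"
  have v: "?v k > 0" for k :: int by (rule vball_pos) simp
  have v1: "1 / vball TYPE(real^'n) 1 \<ge> 0" by simp
  have c: "?c \<ge> 1" "?c \<ge> 1 / vball TYPE(real^'n) 1" "?c \<ge> real CARD('n) * 2 ^ CARD('n) + 2"
    using v1 by (auto simp: ball_const_def add_nonneg_nonneg)
  show "DIM(real^'n) \<ge> 2" using n by simp
  show "0 < \<alpha>" "\<alpha> < 1" by (fact \<alpha>)+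
  show "?c > 0" using c(1) by simp
  show "(ball_kernel k :: real^'n \<Rightarrow> real) \<in> borel_measurable borel" for k by measurable
  show "(\<lambda>x::real^'n. ennreal (ball_kernel k x)) \<in> borel_measurable borel" for k by measurable
  show "(\<lambda>x::real^'n. ennreal (\<bar>ball_kernel k (x + v) - ball_kernel k x\<bar> / norm v)) \<in> borel_measurable borel" for k v
    by measurable
  show "0 \<le> (2 powi k) powr \<alpha>" for k :: int by simp
  show "(2 powi k) powr \<alpha> \<le> ?c * (2 powi k) powr \<alpha>" for k :: int
    using c(1) by (simp add: mult_le_cancel_right1)
  show "ennreal \<bar>ball_kernel k x\<bar> \<le> ennreal (ball_kernel k x)" for k and x :: "real^'n"
    by (simp add: ball_kernel_nonneg)
  show "ennreal \<bar>ball_kernel k (x + v) - ball_kernel k x\<bar> \<le> ennreal (norm v) * ennreal (\<bar>ball_kernel k (x + v) - ball_kernel k x\<bar> / norm v)"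
    for k and x v :: "real^'n"
    by (cases "v = 0") (auto simp: ennreal_mult'[symmetric])
  show "(\<integral>\<^sup>+x. ennreal (ball_kernel k (x::real^'n)) \<partial>lborel) \<le> ennreal ?c" for k
    unfolding nn_integral_ball_kernel using c(1) by simp
  show "ennreal (ball_kernel k x) \<le> ennreal (?c / (2 powi k) ^ DIM(real^'n))" for k and x :: "real^'n"
  proof (rule ennreal_leI)
    have "ball_kernel k x \<le> 1 / ?v k"
      using v[of k] by (simp add: ball_kernel_def indicator_def)
    also have "\<dots> = 1 / vball TYPE(real^'n) 1 / (2 powi k) ^ DIM(real^'n)"
      by (subst vball_scale) auto
    also have "\<dots> \<le> ?c / (2 powi k) ^ DIM(real^'n)" by (intro divide_right_mono c) auto
    finally show "ball_kernel k x \<le> ?c / (2 powi k) ^ DIM(real^'n)" .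
  qed
  show "(\<integral>\<^sup>+x. ennreal (\<bar>ball_kernel k (x + v) - ball_kernel k x\<bar> / norm v) \<partial>lborel) \<le> ennreal (?c / 2 powi k)" for k and v :: "real^'n"
  proof (cases "v = 0")
    case False
    let ?I = "indicator (ball 0 (2 powi k)) :: real^'n \<Rightarrow> real"
    have "(\<integral>\<^sup>+x. ennreal (\<bar>ball_kernel k (x + v) - ball_kernel k x\<bar> / norm v) \<partial>lborel)
      = (\<integral>\<^sup>+x. ennreal (1 / (?v k * norm v)) * ennreal \<bar>?I (x + v) - ?I x\<bar> \<partial>lborel)"
    proof (intro nn_integral_cong)
      fix x
      have "\<bar>ball_kernel k (x + v) - ball_kernel k x\<bar> / norm v = 1 / (?v k * norm v) * \<bar>?I (x + v) - ?I x\<bar>"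
        unfolding ball_kernel_def diff_divide_distrib[symmetric] abs_divide abs_of_pos[OF v] by simp
      then show "ennreal (\<bar>ball_kernel k (x + v) - ball_kernel k x\<bar> / norm v) = ennreal (1 / (?v k * norm v)) * ennreal \<bar>?I (x + v) - ?I x\<bar>"
        by (simp only:) (rule ennreal_mult', simp)
    qed
    also have "\<dots> = ennreal (1 / (?v k * norm v)) * (\<integral>\<^sup>+x. ennreal \<bar>?I (x + v) - ?I x\<bar> \<partial>lborel)"
      by (rule nn_integral_cmult) measurable
    also have "\<dots> \<le> ennreal (1 / (?v k * norm v)) * ennreal (norm v * (real DIM(real^'n) * 2 ^ DIM(real^'n) + 2) / 2 powi k * ?v k)"
      by (intro mult_left_mono nn_integral_ball_translate_diff) auto
    also have "\<dots> = ennreal (1 / (?v k * norm v) * (norm v * (real DIM(real^'n) * 2 ^ DIM(real^'n) + 2) / 2 powi k * ?v k))"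
      by (rule ennreal_mult'[symmetric]) (auto intro!: mult_nonneg_nonneg divide_nonneg_nonneg add_nonneg_nonneg)
    also have "1 / (?v k * norm v) * (norm v * (real DIM(real^'n) * 2 ^ DIM(real^'n) + 2) / 2 powi k * ?v k)
      = (real CARD('n) * 2 ^ CARD('n) + 2) / 2 powi k"
      using False less_imp_neq[OF v[of k]] by (simp add: divide_simps)
    also have "\<dots> \<le> ?c / 2 powi k" by (intro divide_right_mono c) auto
    finally show ?thesis by (simp add: ennreal_leI)
  qed simp
  show "(0::real) < 1" by simp
  show "int m \<in> UNIV" "int m = int m" for m by auto
  show "1 * 2 powr (\<alpha> * real m) \<le> (2 powi (int m)) powr \<alpha>" for m
    by (simp add: powr_realpow[symmetric] powr_powr mult.commute)
  show "1 \<le> \<bar>LINT x|lborel. ball_kernel (int m) (x::real^'n)\<bar>" for m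
  proof -
    have "(LINT x|lborel. ball_kernel (int m) (x::real^'n)) = enn2real (\<integral>\<^sup>+x. ennreal (ball_kernel (int m) (x::real^'n)) \<partial>lborel)"
      by (rule integral_eq_nn_integral) (auto simp: ball_kernel_nonneg)
    then show ?thesis by (simp add: nn_integral_ball_kernel)
  qed
qed

lemma lac_maximal_eq:
  fixes f :: "real^'n \<Rightarrow> real"
  shows "lac_maximal \<alpha> f x = (SUP k\<in>UNIV. ennreal ((2 powi k) powr \<alpha> * \<bar>LINT y|lebesgue. ball_kernel k (x - y) * f y\<bar>))"
  unfolding lac_maximal_def
proof (intro SUP_cong refl)
  fix k :: int
  define v where "v = vball TYPE(real^'n) (2 powi k)"
  have "(LINT y|lebesgue. ball_kernel k (x - y) * f y) = (LINT y|lebesgue. indicator (ball x (2 powi k)) y *\<^sub>R f y / v)"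
    by (intro Bochner_Integration.integral_cong) (auto simp: ball_kernel_def v_def indicator_def dist_norm norm_minus_commute)
  also have "\<dots> = (LINT y:ball x (2 powi k)|lebesgue. f y) / v"
    unfolding set_lebesgue_integral_def by simp
  finally have e: "(LINT y|lebesgue. ball_kernel k (x - y) * f y) = (LINT y:ball x (2 powi k)|lebesgue. f y) / v" .
  have "measure lebesgue (ball (0::real^'n) (2 powi k)) = v" by (simp add: v_def vball_def)
  moreover have "2 powr (\<alpha> * of_int k) = (2 powi k) powr \<alpha>"
  proof -
    have "(2::real) powi k = 2 powr (of_int k)" by (rule powr_real_of_int'[symmetric]) auto
    then show ?thesis by (simp add: powr_powr mult.commute)
  qed
  ultimately show "ennreal \<bar>2 powr (\<alpha> * of_int k) / measure lebesgue (ball (0::real^'n) (2 powi k)) * (LINT y:ball x (2 powi k)|lebesgue. f y)\<bar>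
    = ennreal ((2 powi k) powr \<alpha> * \<bar>LINT y|lebesgue. ball_kernel k (x - y) * f y\<bar>)"
    unfolding e by (simp add: abs_mult v_def)
qed

lemma lac_maximal_gradient:
  assumes n: "CARD('n::finite) \<ge> 2" and \<alpha>: "0 < \<alpha>" "\<alpha> < 1"
  shows "\<exists>C::real. C \<ge> 0 \<and> (\<forall>f \<in> (BV_dot :: (real^'n \<Rightarrow> real) set). (\<exists>x. lac_maximal \<alpha> f x < \<infinity>) \<longrightarrow>
    (\<exists>G. has_weak_gradient (lac_maximal \<alpha> f) G \<and>
      Lp_norm (real CARD('n) / (real CARD('n) - \<alpha>)) G \<le> ennreal C * BV_seminorm f))"
proof -
  interpret kernel_family_vec UNIV "ball_kernel :: int \<Rightarrow> real^'n \<Rightarrow> real" "\<lambda>k. k" "\<lambda>k. (2 powi k) powr \<alpha>"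
    "\<lambda>k x. ennreal (ball_kernel k x)" "\<lambda>k v x. ennreal (\<bar>ball_kernel k (x + v) - ball_kernel k x\<bar> / norm v)"
    "ball_const TYPE(real^'n)" \<alpha> 1 int
    by (rule kernel_family_vec_ball[OF n \<alpha>])
  have \<mu>: "\<mu> = real CARD('n) / (real CARD('n) - \<alpha>)" by (simp add: \<mu>_def)
  show ?thesis
  proof (intro exI[of _ grad_const] conjI ballI impI grad_const_nonneg)
    fix f :: "real^'n \<Rightarrow> real" assume f: "f \<in> BV_dot" and "\<exists>x. lac_maximal \<alpha> f x < \<infinity>"
    then obtain x0 where "lac_maximal \<alpha> f x0 < \<infinity>" by blast
    from BV_maximal_gradient[OF f this[unfolded lac_maximal_eq]]
    show "\<exists>G. has_weak_gradient (lac_maximal \<alpha> f) G \<and>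
      Lp_norm (real CARD('n) / (real CARD('n) - \<alpha>)) G \<le> ennreal grad_const * BV_seminorm f"
      unfolding lac_maximal_eq[abs_def] \<mu> .
  qed
qed

section \<open>The smooth maximal function\<close>

text \<open>Let \<open>m\<close> be least with \<open>norm x < 2 ^ m * r\<close>. For
  \<open>m \<le> 3\<close> the bound on \<open>u\<close> suffices, and
  \<open>8 ^ N = 2 ^ (3 * N)\<close> absorbs the loss. Otherwise
  \<open>norm x \<ge> 2 ^ (m - 1) * r\<close>; since \<open>z\<close> is within \<open>r\<close> of
  \<open>x\<close> and \<open>t \<le> 2 * r\<close>, the argument \<open>z /\<^sub>R t\<close> has
  norm at least \<open>2 ^ (m - 3)\<close>, where the decay of order \<open>DIM('a) + 1\<close>
  applies. The point \<open>z\<close> may differ from \<open>x\<close> to admit the intermediate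
  points of the mean value theorem.\<close>

lemma decay_le_majorant:
  fixes u :: "'a::euclidean_space \<Rightarrow> real"
  assumes C: "\<And>y. \<bar>u y\<bar> \<le> C" "\<And>y. norm y ^ Suc DIM('a) * \<bar>u y\<bar> \<le> C"
    and t: "2 powi k \<le> t" "t \<le> 2 * 2 powi k" and z: "norm (z - x) \<le> 2 powi k"
  shows "ennreal (\<bar>u (z /\<^sub>R t)\<bar> / t ^ DIM('a)) \<le> ennreal (8 ^ Suc DIM('a) * C) * majorant k x"
proof -
  define r :: real where "r = 2 powi k"
  have r: "r > 0" by (simp add: r_def)
  have tr: "r \<le> t" "t \<le> 2 * r" using t by (auto simp: r_def)
  then have t0: "t > 0" "r \<le> t" "t \<le> 2 * r" using r by linarith+
  define N where "N = Suc DIM('a)"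
  have C0: "C \<ge> 0" using C(1)[of 0] by linarith
  obtain m0 where "norm x / r < 2 ^ m0" using real_arch_pow[of 2] by auto
  then have ex: "\<exists>m. norm x < 2 ^ m * r" using r by (auto simp: divide_less_eq)
  define m where "m = (LEAST m. norm x < 2 ^ m * r)"
  have m: "norm x < 2 ^ m * r" unfolding m_def using ex by (rule LeastI_ex)
  have main: "\<bar>u (z /\<^sub>R t)\<bar> \<le> 8 ^ N * C * (1/2) ^ (m * N)"
  proof (cases "m \<le> 3")
    case True
    have "(2::real) ^ (m * N) \<le> 2 ^ (3 * N)" using True by (intro power_increasing) auto
    also have "\<dots> = 8 ^ N" by (simp add: power_mult)
    finally have "1 \<le> (8::real) ^ N * (1/2) ^ (m * N)" by (simp add: power_one_over)
    then have "C * 1 \<le> C * (8 ^ N * (1/2) ^ (m * N))" using C0 by (intro mult_left_mono)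
    then show ?thesis using C(1)[of "z /\<^sub>R t"] by (simp add: mult_ac)
  next
    case False
    then have "\<not> norm x < 2 ^ (m - 1) * r" using not_less_Least[of "m - 1" "\<lambda>m. norm x < 2 ^ m * r"] by (simp add: m_def)
    then have low: "2 ^ (m - 1) * r \<le> norm z + r"
      using z norm_triangle_ineq2[of x z] by (simp add: r_def norm_minus_commute)
    have e: "(2::real) ^ (m - 1) = 4 * 2 ^ (m - 3)" "(2::real) ^ m = 8 * 2 ^ (m - 3)"
    proof -
      have "m - 1 = 2 + (m - 3)" "m = 3 + (m - 3)" using False by auto
      then have "(2::real) ^ (m - 1) = 2 ^ (2 + (m - 3))" "(2::real) ^ m = 2 ^ (3 + (m - 3))" by simp_all
      then show "(2::real) ^ (m - 1) = 4 * 2 ^ (m - 3)" "(2::real) ^ m = 8 * 2 ^ (m - 3)" by (simp_all only: power_add) simp_all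
    qed
    define q :: real where "q = 2 ^ (m - 3)"
    have "1 * r \<le> q * r" using r by (intro mult_right_mono) (auto simp: q_def)
    moreover have "q * t \<le> q * (2 * r)" using t0 by (intro mult_left_mono) (auto simp: q_def)
    moreover have "4 * (q * r) \<le> norm z + r" using low unfolding e(1) q_def[symmetric] by (simp only: mult.assoc)
    ultimately have "q * t \<le> norm z" using r by linarith
    then have "2 ^ (m - 3) * t \<le> norm z" by (simp only: q_def)
    moreover have "norm (z /\<^sub>R t) = norm z / t" using t0 by (simp add: divide_inverse mult.commute)
    ultimately have "2 ^ (m - 3) \<le> norm (z /\<^sub>R t)" using t0 by (simp only: pos_le_divide_eq)
    then have "(2 ^ (m - 3)) ^ N \<le> norm (z /\<^sub>R t) ^ N" by (intro power_mono) auto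
    then have "(2 ^ (m - 3)) ^ N * \<bar>u (z /\<^sub>R t)\<bar> \<le> norm (z /\<^sub>R t) ^ N * \<bar>u (z /\<^sub>R t)\<bar>" by (intro mult_right_mono) auto
    also have "\<dots> \<le> C" using C(2) by (simp only: N_def)
    finally have 1: "(2 ^ (m - 3)) ^ N * \<bar>u (z /\<^sub>R t)\<bar> \<le> C" .
    have "(2::real) ^ (m * N) = 8 ^ N * (2 ^ (m - 3)) ^ N"
      unfolding power_mult e(2) by (simp only: power_mult_distrib)
    then have "2 ^ (m * N) * \<bar>u (z /\<^sub>R t)\<bar> \<le> 8 ^ N * C"
      using mult_left_mono[OF 1, of "8 ^ N"] by (simp add: mult.assoc)
    then show ?thesis by (simp add: power_one_over field_simps)
  qed
  have "\<bar>u (z /\<^sub>R t)\<bar> / t ^ DIM('a) \<le> \<bar>u (z /\<^sub>R t)\<bar> / r ^ DIM('a)"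
    using t0 r by (intro divide_left_mono power_mono mult_pos_pos) auto
  also have "\<dots> \<le> 8 ^ N * C * (1/2) ^ (m * N) / r ^ DIM('a)"
    using r by (intro divide_right_mono main) auto
  finally have "ennreal (\<bar>u (z /\<^sub>R t)\<bar> / t ^ DIM('a)) \<le> ennreal (8 ^ N * C * ((1/2) ^ (m * N) / r ^ DIM('a)))"
    by (intro ennreal_leI) simp
  also have "\<dots> = ennreal (8 ^ N * C) * ennreal ((1/2) ^ (m * N) / r ^ DIM('a))"
    using C0 by (intro ennreal_mult') simp
  also have "\<dots> \<le> ennreal (8 ^ N * C) * majorant k x"
    unfolding N_def r_def using m by (intro mult_left_mono majorant_ge) (auto simp: r_def)
  finally show ?thesis by (simp add: N_def)
qed

section \<open>Decay of Schwartz functions and of their dilates\<close>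

lemma schwartz_bound:
  assumes "schwartz \<phi>"
  obtains C where "\<And>x. \<bar>iter_partial is \<phi> x\<bar> \<le> C" "\<And>x. norm x ^ m * \<bar>iter_partial is \<phi> x\<bar> \<le> C"
proof -
  have b: "bounded (range (\<lambda>x. norm x ^ k * iter_partial is \<phi> x))" for k
    using assms by (simp add: schwartz_def)
  obtain C0 where C0: "\<forall>x. norm (norm x ^ 0 * iter_partial is \<phi> x) \<le> C0"
    using b[of 0] unfolding bounded_iff by blast
  obtain C1 where C1: "\<forall>x. norm (norm x ^ m * iter_partial is \<phi> x) \<le> C1"
    using b[of m] unfolding bounded_iff by blast
  show thesis
  proof (rule that[of "max C0 C1"])
    show "\<bar>iter_partial is \<phi> x\<bar> \<le> max C0 C1" for x using C0[rule_format, of x] by simp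
    show "norm x ^ m * \<bar>iter_partial is \<phi> x\<bar> \<le> max C0 C1" for x using C1[rule_format, of x] by (simp add: abs_mult)
  qed
qed

lemma schwartz_gradient_bound:
  fixes \<phi> :: "real^'n \<Rightarrow> real"
  assumes "schwartz \<phi>"
  obtains C where "\<And>x. \<bar>\<phi> x\<bar> \<le> C" "\<And>x. norm x ^ m * \<bar>\<phi> x\<bar> \<le> C"
    "\<And>x. (\<Sum>i\<in>UNIV. \<bar>partial_deriv i \<phi> x\<bar>) \<le> C" "\<And>x. norm x ^ m * (\<Sum>i\<in>UNIV. \<bar>partial_deriv i \<phi> x\<bar>) \<le> C"
proof -
  obtain C0 where C0: "\<And>x. \<bar>\<phi> x\<bar> \<le> C0" "\<And>x. norm x ^ m * \<bar>\<phi> x\<bar> \<le> C0"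
    using schwartz_bound[OF assms, of "[]" m] by auto
  have "\<forall>i. \<exists>C. (\<forall>x. \<bar>partial_deriv i \<phi> x\<bar> \<le> C) \<and> (\<forall>x. norm x ^ m * \<bar>partial_deriv i \<phi> x\<bar> \<le> C)"
  proof
    fix i
    show "\<exists>C. (\<forall>x. \<bar>partial_deriv i \<phi> x\<bar> \<le> C) \<and> (\<forall>x. norm x ^ m * \<bar>partial_deriv i \<phi> x\<bar> \<le> C)"
      by (rule schwartz_bound[OF assms, of "[i]" m]) auto
  qed
  from choice[OF this] obtain C where C: "\<forall>i. (\<forall>x. \<bar>partial_deriv i \<phi> x\<bar> \<le> C i) \<and> (\<forall>x. norm x ^ m * \<bar>partial_deriv i \<phi> x\<bar> \<le> C i)" ..
  define S where "S = (\<Sum>i\<in>UNIV. C i)"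
  have S1: "(\<Sum>i\<in>UNIV. \<bar>partial_deriv i \<phi> x\<bar>) \<le> S" for x unfolding S_def using C by (intro sum_mono) auto
  have S2: "norm x ^ m * (\<Sum>i\<in>UNIV. \<bar>partial_deriv i \<phi> x\<bar>) \<le> S" for x
    unfolding S_def sum_distrib_left using C by (intro sum_mono) auto
  show thesis
  proof (rule that[of "max C0 S"])
    show "\<bar>\<phi> x\<bar> \<le> max C0 S" for x using C0(1)[of x] by (rule max.coboundedI1)
    show "norm x ^ m * \<bar>\<phi> x\<bar> \<le> max C0 S" for x using C0(2)[of x] by (rule max.coboundedI1)
    show "(\<Sum>i\<in>UNIV. \<bar>partial_deriv i \<phi> x\<bar>) \<le> max C0 S" for x using S1[of x] by (rule max.coboundedI2)
    show "norm x ^ m * (\<Sum>i\<in>UNIV. \<bar>partial_deriv i \<phi> x\<bar>) \<le> max C0 S" for x using S2[of x] by (rule max.coboundedI2)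
  qed
qed

lemma mean_value_partial:
  fixes \<phi> :: "real^'n \<Rightarrow> real"
  assumes \<phi>: "\<And>x. \<phi> differentiable (at x)"
  obtains s where "0 < s" "s < 1" "\<bar>\<phi> (a + h) - \<phi> a\<bar> \<le> norm h * (\<Sum>i\<in>UNIV. \<bar>partial_deriv i \<phi> (a + s *\<^sub>R h)\<bar>)"
proof -
  define D where "D x = frechet_derivative \<phi> (at x)" for x
  have D: "(\<phi> has_derivative D x) (at x)" for x
    unfolding D_def using \<phi> frechet_derivative_works by blast
  have lin: "linear (D x)" for x using D by (rule has_derivative_linear)
  have d: "((\<lambda>s. \<phi> (a + s *\<^sub>R h)) has_real_derivative D (a + s *\<^sub>R h) h) (at s)" for s
  proof -
    have "((\<lambda>s::real. a + s *\<^sub>R h) has_derivative (\<lambda>t. t *\<^sub>R h)) (at s)"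
      by (auto intro!: derivative_eq_intros)
    then have "((\<lambda>s. \<phi> (a + s *\<^sub>R h)) has_derivative (\<lambda>t. D (a + s *\<^sub>R h) (t *\<^sub>R h))) (at s)"
      by (rule has_derivative_compose[OF _ D])
    then show ?thesis
      unfolding has_field_derivative_def by (simp add: linear_scale[OF lin] mult.commute[of _ "D (a + s *\<^sub>R h) h"])
  qed
  obtain s where s: "0 < s" "s < 1" "\<phi> (a + 1 *\<^sub>R h) - \<phi> (a + 0 *\<^sub>R h) = (1 - 0) * D (a + s *\<^sub>R h) h"
    using MVT2[of 0 1 "\<lambda>s. \<phi> (a + s *\<^sub>R h)" "\<lambda>s. D (a + s *\<^sub>R h) h"] d by auto
  have "D x h = (\<Sum>i\<in>UNIV. h $ i * partial_deriv i \<phi> x)" for x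
  proof -
    have "D x h = D x (\<Sum>i\<in>UNIV. h $ i *\<^sub>R axis i 1)"
      using basis_expansion[of h] by (simp add: scalar_mult_eq_scaleR)
    also have "\<dots> = (\<Sum>i\<in>UNIV. h $ i * D x (axis i 1))"
      by (simp add: linear_sum[OF lin] linear_scale[OF lin])
    finally show ?thesis by (simp add: partial_deriv_def D_def)
  qed
  then have "\<bar>D x h\<bar> \<le> (\<Sum>i\<in>UNIV. norm h * \<bar>partial_deriv i \<phi> x\<bar>)" for x
    by (auto simp: abs_mult intro!: order_trans[OF sum_abs] sum_mono mult_right_mono component_le_norm_cart)
  then show thesis using that[OF s(1,2)] s(3) by (simp add: sum_distrib_left)
qed

lemma dyadic_floor:
  fixes t :: real
  assumes "t > 0"
  shows "2 powi \<lfloor>log 2 t\<rfloor> \<le> t" "t \<le> 2 * 2 powi \<lfloor>log 2 t\<rfloor>"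
proof -
  have e: "2 powi k = 2 powr (real_of_int k)" for k by (rule powr_real_of_int'[symmetric]) auto
  have t: "2 powr (log 2 t) = t" using assms by simp
  have "2 powr (real_of_int \<lfloor>log 2 t\<rfloor>) \<le> 2 powr (log 2 t)" by (intro powr_mono) auto
  then show "2 powi \<lfloor>log 2 t\<rfloor> \<le> t" unfolding e t .
  have "2 powr (log 2 t) \<le> 2 powr (1 + real_of_int \<lfloor>log 2 t\<rfloor>)" by (intro powr_mono) linarith+
  also have "\<dots> = 2 * 2 powr (real_of_int \<lfloor>log 2 t\<rfloor>)" by (simp add: powr_add)
  finally show "t \<le> 2 * 2 powi \<lfloor>log 2 t\<rfloor>" unfolding e t .
qed

text \<open>For \<open>norm v \<le> 2 powi k\<close> the mean value theorem evaluates the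
  derivatives at a point within \<open>2 powi k\<close> of \<open>x\<close>. For longer
  \<open>v\<close> the two values are bounded separately and \<open>norm v / 2 powi k > 1\<close> is
  inserted; this case brings in the majorant at \<open>x + v\<close>.\<close>

lemma dilate_difference_le:
  fixes \<phi> :: "real^'n \<Rightarrow> real"
  assumes d: "\<And>x. \<phi> differentiable (at x)"
    and C: "\<And>x. \<bar>\<phi> x\<bar> \<le> C" "\<And>x. norm x ^ Suc CARD('n) * \<bar>\<phi> x\<bar> \<le> C"
      "\<And>x. (\<Sum>i\<in>UNIV. \<bar>partial_deriv i \<phi> x\<bar>) \<le> C" "\<And>x. norm x ^ Suc CARD('n) * (\<Sum>i\<in>UNIV. \<bar>partial_deriv i \<phi> x\<bar>) \<le> C"
    and t: "2 powi k \<le> t" "t \<le> 2 * 2 powi k"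
  shows "ennreal \<bar>dilate \<phi> t (x + v) - dilate \<phi> t x\<bar>
    \<le> ennreal (norm v) * (ennreal (8 ^ Suc CARD('n) * C / 2 powi k) * (majorant k x + majorant k (x + v)))"
proof -
  define r :: real where "r = 2 powi k"
  have r: "r > 0" by (simp add: r_def)
  have "r \<le> t" using t by (simp add: r_def)
  then have t0: "t > 0" "r \<le> t" using r by linarith+
  define B where "B = 8 ^ Suc CARD('n) * C"
  have B: "B \<ge> 0" using C(1)[of 0] by (simp add: B_def)
  have split: "ennreal (norm v) * (ennreal (B / r) * M) = ennreal (norm v / r) * (ennreal B * M)" for M
  proof -
    have "ennreal (norm v) * ennreal (B / r) = ennreal (norm v / r) * ennreal B"
      using B r by (simp add: ennreal_mult'[symmetric])
    then show ?thesis by (simp only: mult.assoc[symmetric])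
  qed
  show ?thesis
  proof (cases "norm v \<le> r")
    case True
    have e: "(x + v) /\<^sub>R t = x /\<^sub>R t + v /\<^sub>R t" by (simp add: scaleR_add_right)
    obtain s where s: "0 < s" "s < 1" and le: "\<bar>\<phi> (x /\<^sub>R t + v /\<^sub>R t) - \<phi> (x /\<^sub>R t)\<bar>
      \<le> norm (v /\<^sub>R t) * (\<Sum>i\<in>UNIV. \<bar>partial_deriv i \<phi> (x /\<^sub>R t + s *\<^sub>R (v /\<^sub>R t))\<bar>)"
      by (rule mean_value_partial[OF d])
    define z where "z = x + s *\<^sub>R v"
    have ze: "x /\<^sub>R t + s *\<^sub>R (v /\<^sub>R t) = z /\<^sub>R t" by (simp add: z_def scaleR_add_right)
    define u where "u y = (\<Sum>i\<in>UNIV. \<bar>partial_deriv i \<phi> y\<bar>)" for y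
    have u0: "u y \<ge> 0" for y by (simp add: u_def sum_nonneg)
    have zx: "norm (z - x) \<le> r"
    proof -
      have "s * norm v \<le> 1 * norm v" using s by (intro mult_right_mono) auto
      then show ?thesis using True s by (simp add: z_def)
    qed
    have "ennreal (\<bar>u (z /\<^sub>R t)\<bar> / t ^ DIM(real^'n)) \<le> ennreal (8 ^ Suc DIM(real^'n) * C) * majorant k x"
      by (rule decay_le_majorant) (use C(3,4) u0 t zx in \<open>auto simp: u_def[symmetric] r_def abs_of_nonneg\<close>)
    then have ub: "ennreal (u (z /\<^sub>R t) / t ^ CARD('n)) \<le> ennreal B * majorant k x"
      by (simp add: B_def abs_of_nonneg[OF u0])
    have "\<bar>dilate \<phi> t (x + v) - dilate \<phi> t x\<bar> = \<bar>\<phi> (x /\<^sub>R t + v /\<^sub>R t) - \<phi> (x /\<^sub>R t)\<bar> / t ^ CARD('n)"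
      using t0 by (simp add: dilate_def e diff_divide_distrib[symmetric])
    also have "\<dots> \<le> norm (v /\<^sub>R t) * u (z /\<^sub>R t) / t ^ CARD('n)"
      using le t0 unfolding ze u_def[symmetric] by (intro divide_right_mono) auto
    also have "\<dots> = norm v / t * (u (z /\<^sub>R t) / t ^ CARD('n))"
      using t0 by (simp add: divide_inverse mult.commute)
    also have "\<dots> \<le> norm v / r * (u (z /\<^sub>R t) / t ^ CARD('n))"
      using t0 r u0 by (intro mult_right_mono divide_left_mono) auto
    finally have "ennreal \<bar>dilate \<phi> t (x + v) - dilate \<phi> t x\<bar> \<le> ennreal (norm v / r * (u (z /\<^sub>R t) / t ^ CARD('n)))"
      by (rule ennreal_leI)
    also have "\<dots> = ennreal (norm v / r) * ennreal (u (z /\<^sub>R t) / t ^ CARD('n))"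
      using r by (intro ennreal_mult') auto
    also have "\<dots> \<le> ennreal (norm v / r) * (ennreal B * majorant k x)"
      by (intro mult_left_mono ub) auto
    also have "\<dots> \<le> ennreal (norm v / r) * (ennreal B * (majorant k x + majorant k (x + v)))"
      by (intro mult_left_mono) auto
    finally show ?thesis unfolding B_def[symmetric] r_def[symmetric] split .
  next
    case False
    have one: "ennreal \<bar>dilate \<phi> t y\<bar> \<le> ennreal B * majorant k y" for y
    proof -
      have "ennreal (\<bar>\<phi> (y /\<^sub>R t)\<bar> / t ^ DIM(real^'n)) \<le> ennreal (8 ^ Suc DIM(real^'n) * C) * majorant k y"
        by (rule decay_le_majorant) (use C(1,2) t in auto)
      then show ?thesis using t0 by (simp add: B_def dilate_def)
    qed
    have "ennreal \<bar>dilate \<phi> t (x + v) - dilate \<phi> t x\<bar> \<le> ennreal (\<bar>dilate \<phi> t x\<bar> + \<bar>dilate \<phi> t (x + v)\<bar>)"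
      by (intro ennreal_leI) linarith
    also have "\<dots> = ennreal \<bar>dilate \<phi> t x\<bar> + ennreal \<bar>dilate \<phi> t (x + v)\<bar>" by simp
    also have "\<dots> \<le> ennreal B * majorant k x + ennreal B * majorant k (x + v)" by (intro add_mono one)
    also have "\<dots> = ennreal 1 * (ennreal B * (majorant k x + majorant k (x + v)))" by (simp add: distrib_left)
    also have "\<dots> \<le> ennreal (norm v / r) * (ennreal B * (majorant k x + majorant k (x + v)))"
      using False r by (intro mult_right_mono ennreal_leI) (auto simp: pos_le_divide_eq)
    finally show ?thesis unfolding B_def[symmetric] r_def[symmetric] split .
  qed
qed

text \<open>By continuity \<open>\<phi>\<close> is at least \<open>\<phi> x0 / 2\<close> on a ball
  about \<open>x0\<close>. Dilation multiplies the radius by \<open>t\<close> and divides the height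
  by \<open>t ^ CARD('n)\<close>, so the resulting lower bound is the same for all
  \<open>t\<close>.\<close>

lemma dilate_integral_ge:
  fixes \<phi> :: "real^'n \<Rightarrow> real"
  assumes c: "continuous_on UNIV \<phi>" and nn: "\<And>x. \<phi> x \<ge> 0" and x0: "\<phi> x0 > 0"
  obtains \<delta> where "\<delta> > 0" "\<And>t. t > 0 \<Longrightarrow> integrable lborel (dilate \<phi> t) \<Longrightarrow> \<delta> \<le> (LINT x|lborel. dilate \<phi> t x)"
proof -
  define a where "a = \<phi> x0 / 2"
  have a: "a > 0" using x0 by (simp add: a_def)
  have "isCont \<phi> x0" using c by (simp add: continuous_on_eq_continuous_at)
  then obtain d where d: "d > 0" "\<And>y. dist y x0 < d \<Longrightarrow> dist (\<phi> y) (\<phi> x0) < a"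
    using a unfolding continuous_at_eps_delta by blast
  have low: "\<phi> y \<ge> a" if "dist y x0 < d" for y
    using d(2)[OF that] unfolding dist_real_def a_def by linarith
  show thesis
  proof (rule that[of "a * (d ^ DIM(real^'n) * vball TYPE(real^'n) 1)"])
    show "a * (d ^ DIM(real^'n) * vball TYPE(real^'n) 1) > 0" using a d by simp
    fix t :: real assume t: "t > 0" and int: "integrable lborel (dilate \<phi> t)"
    have m: "measure lborel (ball (t *\<^sub>R x0) (t * d)) = (t * d) ^ DIM(real^'n) * vball TYPE(real^'n) 1"
      using content_ball_conv_unit_ball[of "t * d" "t *\<^sub>R x0"] t d by (simp add: vball_def)
    have "a * (d ^ DIM(real^'n) * vball TYPE(real^'n) 1) = a / t ^ CARD('n) * ((t * d) ^ DIM(real^'n) * vball TYPE(real^'n) 1)"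
      using t by (simp add: power_mult_distrib)
    also have "\<dots> = (LINT x|lborel. a / t ^ CARD('n) * indicator (ball (t *\<^sub>R x0) (t * d)) x)"
      by (simp add: m)
    also have "\<dots> \<le> (LINT x|lborel. dilate \<phi> t x)"
    proof (rule integral_mono[OF _ int])
      show "integrable lborel (\<lambda>x. a / t ^ CARD('n) * indicator (ball (t *\<^sub>R x0) (t * d)) x)"
        by (intro integrable_mult_right) (simp add: emeasure_vball)
      fix x
      show "a / t ^ CARD('n) * indicator (ball (t *\<^sub>R x0) (t * d)) x \<le> dilate \<phi> t x"
      proof (cases "x \<in> ball (t *\<^sub>R x0) (t * d)")
        case True
        have e: "x /\<^sub>R t - x0 = (x - t *\<^sub>R x0) /\<^sub>R t" using t by (simp add: scaleR_diff_right)
        have "norm ((x - t *\<^sub>R x0) /\<^sub>R t) = norm (x - t *\<^sub>R x0) / t" using t by (simp add: divide_inverse mult.commute)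
        moreover have "norm (x - t *\<^sub>R x0) < t * d" using True by (simp add: dist_norm norm_minus_commute)
        ultimately have "dist (x /\<^sub>R t) x0 < d"
          unfolding dist_norm e using t by (simp add: pos_divide_less_eq mult.commute)
        then show ?thesis using True low[of "x /\<^sub>R t"] t by (simp add: dilate_def divide_right_mono)
      qed (use nn t in \<open>simp add: dilate_def\<close>)
    qed
    finally show "a * (d ^ DIM(real^'n) * vball TYPE(real^'n) 1) \<le> (LINT x|lborel. dilate \<phi> t x)" .
  qed
qed

lemma kernel_family_vec_dilate:
  fixes \<phi> :: "real^'n \<Rightarrow> real"
  assumes n: "CARD('n) \<ge> 2" and \<alpha>: "0 < \<alpha>" "\<alpha> < 1" and \<phi>: "schwartz \<phi>" and nn: "\<And>x. \<phi> x \<ge> 0" and x0: "\<phi> x0 > 0"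
  obtains \<Phi> \<Psi> c \<delta> where "kernel_family_vec {0<..} (dilate \<phi>) (\<lambda>t. \<lfloor>log 2 t\<rfloor>) (\<lambda>t. t powr \<alpha>) \<Phi> \<Psi> c \<alpha> \<delta> (\<lambda>m. 2 ^ m)"
proof -
  have sm: "smooth \<phi>" using \<phi> by (simp add: schwartz_def)
  have d: "\<phi> differentiable (at x)" for x by (rule smooth_differentiable[OF sm])
  have cont: "continuous_on UNIV \<phi>"
    using d by (meson continuous_at_imp_continuous_on differentiable_imp_continuous_within)
  have \<phi>m [measurable]: "\<phi> \<in> borel_measurable borel" by (rule borel_measurable_continuous_onI[OF cont])
  have dm [measurable]: "dilate \<phi> t \<in> borel_measurable borel" for t unfolding dilate_def[abs_def] by measurable
  obtain C where C: "\<And>x. \<bar>\<phi> x\<bar> \<le> C" "\<And>x. norm x ^ Suc CARD('n) * \<bar>\<phi> x\<bar> \<le> C"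
    "\<And>x. (\<Sum>i\<in>UNIV. \<bar>partial_deriv i \<phi> x\<bar>) \<le> C" "\<And>x. norm x ^ Suc CARD('n) * (\<Sum>i\<in>UNIV. \<bar>partial_deriv i \<phi> x\<bar>) \<le> C"
    by (rule schwartz_gradient_bound[OF \<phi>, of "Suc CARD('n)"]) (rule that, blast+)
  define B where "B = 8 ^ Suc CARD('n) * C"
  have B: "B \<ge> 0" using C(1)[of 0] by (simp add: B_def)
  define v1 where "v1 = vball TYPE(real^'n) 1"
  have v1: "v1 > 0" by (simp add: v1_def)
  \<comment> \<open>Large enough for all demands on the family: integral and height of
    \<open>\<Phi>\<close>, the integral of \<open>\<Psi>\<close> with its two majorants, and the
    factor \<open>2 powr \<alpha> \<le> 2\<close> lost by rounding \<open>t\<close> down to a power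
    of 2.\<close>
  define c where "c = B * (4 * v1 + 2) + 2"
  have c: "c \<ge> 2" "B * (2 * v1) \<le> c" "B * 2 \<le> c" "B * (4 * v1) \<le> c"
  proof -
    have "0 \<le> B * v1" using B v1 by simp
    then show "c \<ge> 2" "B * (2 * v1) \<le> c" "B * 2 \<le> c" "B * (4 * v1) \<le> c" using B by (auto simp: c_def algebra_simps)
  qed
  define \<Phi> :: "int \<Rightarrow> real^'n \<Rightarrow> ennreal" where "\<Phi> k x = ennreal B * majorant k x" for k x
  define \<Psi> :: "int \<Rightarrow> real^'n \<Rightarrow> real^'n \<Rightarrow> ennreal" where "\<Psi> k v x = ennreal (B / 2 powi k) * (majorant k x + majorant k (x + v))" for k v x
  have \<Phi>m [measurable]: "\<Phi> k \<in> borel_measurable borel" for k unfolding \<Phi>_def by measurable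
  have \<Psi>m [measurable]: "\<Psi> k v \<in> borel_measurable borel" for k v unfolding \<Psi>_def by measurable
  have \<Phi>i: "(\<integral>\<^sup>+x. \<Phi> k x \<partial>lborel) \<le> ennreal c" for k
  proof -
    have "(\<integral>\<^sup>+x. \<Phi> k x \<partial>lborel) = ennreal B * ennreal (2 * v1)"
      unfolding \<Phi>_def by (subst nn_integral_cmult) (auto simp: nn_integral_majorant v1_def)
    also have "\<dots> = ennreal (B * (2 * v1))" using B by (intro ennreal_mult'[symmetric])
    also have "\<dots> \<le> ennreal c" by (intro ennreal_leI c)
    finally show ?thesis .
  qed
  have K_le: "ennreal \<bar>dilate \<phi> t x\<bar> \<le> \<Phi> \<lfloor>log 2 t\<rfloor> x" if "t > 0" for t x
  proof -
    have "ennreal (\<bar>\<phi> (x /\<^sub>R t)\<bar> / t ^ DIM(real^'n)) \<le> ennreal (8 ^ Suc DIM(real^'n) * C) * majorant \<lfloor>log 2 t\<rfloor> x"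
      by (rule decay_le_majorant) (use C(1,2) dyadic_floor[OF that] in auto)
    then show ?thesis using that by (simp add: B_def dilate_def \<Phi>_def)
  qed
  have int: "integrable lborel (dilate \<phi> t)" if "t > 0" for t
  proof (rule integrableI_bounded)
    have "(\<integral>\<^sup>+x. ennreal (norm (dilate \<phi> t x)) \<partial>lborel) \<le> (\<integral>\<^sup>+x. \<Phi> \<lfloor>log 2 t\<rfloor> x \<partial>lborel)"
      using K_le[OF that] by (intro nn_integral_mono) auto
    also have "\<dots> < \<infinity>" by (rule le_less_trans[OF \<Phi>i]) simp
    finally show "(\<integral>\<^sup>+x. ennreal (norm (dilate \<phi> t x)) \<partial>lborel) < \<infinity>" .
  qed measurable
  obtain \<delta>' where \<delta>': "\<delta>' > 0" "\<And>t. t > 0 \<Longrightarrow> integrable lborel (dilate \<phi> t) \<Longrightarrow> \<delta>' \<le> (LINT x|lborel. dilate \<phi> t x)"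
    using dilate_integral_ge[OF cont nn x0] by blast
  \<comment> \<open>Capped at 1 because the weight of the kernel with \<open>t = 2 ^ m\<close> is
    exactly \<open>2 powr (\<alpha> * real m)\<close>.\<close>
  define \<delta> where "\<delta> = min 1 \<delta>'"
  show thesis
  proof (rule that[of \<Phi> \<Psi> c \<delta>])
    show "kernel_family_vec {0<..} (dilate \<phi>) (\<lambda>t. \<lfloor>log 2 t\<rfloor>) (\<lambda>t. t powr \<alpha>) \<Phi> \<Psi> c \<alpha> \<delta> (\<lambda>m. 2 ^ m)"
    proof
      show "DIM(real^'n) \<ge> 2" using n by simp
      show "0 < \<alpha>" "\<alpha> < 1" by (fact \<alpha>)+
      show "c > 0" using c(1) by simp
      show "dilate \<phi> t \<in> borel_measurable borel" for t by measurable
      show "\<Phi> k \<in> borel_measurable borel" "\<Psi> k v \<in> borel_measurable borel" for k v by measurable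
      show "0 \<le> t powr \<alpha>" for t by simp
      show "t powr \<alpha> \<le> c * (2 powi \<lfloor>log 2 t\<rfloor>) powr \<alpha>" if "t \<in> {0<..}" for t
      proof -
        have "t powr \<alpha> \<le> (2 * 2 powi \<lfloor>log 2 t\<rfloor>) powr \<alpha>"
          using dyadic_floor(2)[of t] that \<alpha> by (intro powr_mono2) auto
        also have "\<dots> = 2 powr \<alpha> * (2 powi \<lfloor>log 2 t\<rfloor>) powr \<alpha>" by (rule powr_mult)
        also have "2 powr \<alpha> \<le> 2 powr 1" using \<alpha> by (intro powr_mono) auto
        also have "2 powr 1 \<le> c" using c(1) by simp
        finally show ?thesis by (simp add: mult_right_mono)
      qed
      show "ennreal \<bar>dilate \<phi> t x\<bar> \<le> \<Phi> \<lfloor>log 2 t\<rfloor> x" if "t \<in> {0<..}" for t x using K_le that by simp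
      show "ennreal \<bar>dilate \<phi> t (x + v) - dilate \<phi> t x\<bar> \<le> ennreal (norm v) * \<Psi> \<lfloor>log 2 t\<rfloor> v x" if "t \<in> {0<..}" for t x v
        unfolding \<Psi>_def B_def using that by (intro dilate_difference_le d C dyadic_floor) auto
      show "(\<integral>\<^sup>+x. \<Phi> k x \<partial>lborel) \<le> ennreal c" for k by (rule \<Phi>i)
      show "\<Phi> k x \<le> ennreal (c / (2 powi k) ^ DIM(real^'n))" for k x
      proof -
        have "\<Phi> k x \<le> ennreal B * ennreal (2 / (2 powi k) ^ DIM(real^'n))"
          unfolding \<Phi>_def by (intro mult_left_mono majorant_le) auto
        also have "\<dots> = ennreal (B * (2 / (2 powi k) ^ DIM(real^'n)))" using B by (intro ennreal_mult'[symmetric])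
        also have "B * (2 / (2 powi k) ^ DIM(real^'n)) = B * 2 / (2 powi k) ^ DIM(real^'n)" by simp
        also have "\<dots> \<le> c / (2 powi k) ^ DIM(real^'n)" by (intro divide_right_mono c) auto
        finally show ?thesis by (simp add: ennreal_leI)
      qed
      show "(\<integral>\<^sup>+x. \<Psi> k v x \<partial>lborel) \<le> ennreal (c / 2 powi k)" for k v
      proof -
        have "(\<integral>\<^sup>+x. \<Psi> k v x \<partial>lborel) = ennreal (B / 2 powi k) * ((\<integral>\<^sup>+x. majorant k (x::real^'n) \<partial>lborel) + (\<integral>\<^sup>+x. majorant k (x + v) \<partial>lborel))"
          unfolding \<Psi>_def by (subst nn_integral_cmult) (auto simp: nn_integral_add)
        also have "(\<integral>\<^sup>+x. majorant k (x + v) \<partial>lborel) = (\<integral>\<^sup>+x. majorant k (x::real^'n) \<partial>lborel)"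
          by (rule nn_integral_lborel_translate) measurable
        also have "(\<integral>\<^sup>+x. majorant k (x::real^'n) \<partial>lborel) = ennreal (2 * v1)" by (simp add: nn_integral_majorant v1_def)
        also have "ennreal (2 * v1) + ennreal (2 * v1) = ennreal (4 * v1)"
          using v1 by (simp add: ennreal_plus[symmetric] del: ennreal_plus)
        also have "ennreal (B / 2 powi k) * ennreal (4 * v1) = ennreal (B / 2 powi k * (4 * v1))"
          using B by (intro ennreal_mult'[symmetric]) simp
        also have "B / 2 powi k * (4 * v1) = B * (4 * v1) / 2 powi k" by simp
        also have "\<dots> \<le> c / 2 powi k" by (intro divide_right_mono c) auto
        finally show ?thesis by (simp add: ennreal_leI)
      qed
      show "\<delta> > 0" using \<delta>'(1) by (simp add: \<delta>_def)
      show "2 ^ m \<in> {0::real<..}" "\<lfloor>log 2 (2 ^ m)\<rfloor> = int m" for m by auto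
      show "\<delta> * 2 powr (\<alpha> * real m) \<le> (2 ^ m) powr \<alpha>" for m
      proof -
        have "(2 ^ m :: real) powr \<alpha> = 2 powr (\<alpha> * real m)"
          by (simp add: powr_realpow[symmetric] powr_powr mult.commute)
        then show ?thesis by (simp add: \<delta>_def mult_le_cancel_right1)
      qed
      show "\<delta> \<le> \<bar>LINT x|lborel. dilate \<phi> (2 ^ m) x\<bar>" for m
        using \<delta>'(2)[OF _ int, of "2 ^ m"] by (simp add: \<delta>_def)
    qed
  qed
qed

lemma smooth_maximal_gradient:
  fixes \<phi> :: "real^'n \<Rightarrow> real"
  assumes n: "CARD('n) \<ge> 2" and \<alpha>: "0 < \<alpha>" "\<alpha> < 1" and \<phi>: "schwartz \<phi>" and nn: "\<And>x. \<phi> x \<ge> 0"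
  shows "\<exists>C::real. C \<ge> 0 \<and> (\<forall>f \<in> BV_dot. (\<exists>x. smooth_maximal \<phi> \<alpha> f x < \<infinity>) \<longrightarrow>
    (\<exists>G. has_weak_gradient (smooth_maximal \<phi> \<alpha> f) G \<and>
      Lp_norm (real CARD('n) / (real CARD('n) - \<alpha>)) G \<le> ennreal C * BV_seminorm f))"
proof (cases "\<exists>x0. \<phi> x0 > 0")
  case True
  then obtain x0 where "\<phi> x0 > 0" by blast
  then obtain \<Phi> \<Psi> c \<delta> where "kernel_family_vec {0<..} (dilate \<phi>) (\<lambda>t. \<lfloor>log 2 t\<rfloor>) (\<lambda>t. t powr \<alpha>) \<Phi> \<Psi> c \<alpha> \<delta> (\<lambda>m. 2 ^ m)"
    by (rule kernel_family_vec_dilate[OF n \<alpha> \<phi> nn])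
  then interpret kernel_family_vec "{0<..}" "dilate \<phi>" "\<lambda>t. \<lfloor>log 2 t\<rfloor>" "\<lambda>t. t powr \<alpha>" \<Phi> \<Psi> c \<alpha> \<delta> "\<lambda>m. 2 ^ m" .
  have \<mu>: "\<mu> = real CARD('n) / (real CARD('n) - \<alpha>)" by (simp add: \<mu>_def)
  show ?thesis
  proof (intro exI[of _ grad_const] conjI ballI impI grad_const_nonneg)
    fix f :: "real^'n \<Rightarrow> real" assume f: "f \<in> BV_dot" and "\<exists>x. smooth_maximal \<phi> \<alpha> f x < \<infinity>"
    then obtain x1 where "smooth_maximal \<phi> \<alpha> f x1 < \<infinity>" by blast
    from BV_maximal_gradient[OF f this[unfolded smooth_maximal_def convolve_def]]
    show "\<exists>G. has_weak_gradient (smooth_maximal \<phi> \<alpha> f) G \<and>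
      Lp_norm (real CARD('n) / (real CARD('n) - \<alpha>)) G \<le> ennreal grad_const * BV_seminorm f"
      unfolding smooth_maximal_def[abs_def] convolve_def \<mu> .
  qed
next
  \<comment> \<open>Positivity of \<open>\<phi>\<close> is encoded as
    \<open>\<phi> x \<ge> 0\<close>, so \<open>\<phi>\<close> may vanish identically. Then no kernel
    has a positive integral and the mean value at infinity cannot be excluded, but the maximal
    function is 0.\<close>
  case False
  then have "\<not> 0 < \<phi> x" for x by blast
  then have z: "\<phi> x = 0" for x using nn[of x] by (simp add: order.order_iff_strict)
  have M: "smooth_maximal \<phi> \<alpha> f = (\<lambda>x. 0)" for f
    unfolding smooth_maximal_def[abs_def] convolve_def dilate_def by (simp add: z)
  have "has_weak_gradient (\<lambda>x::real^'n. 0) (\<lambda>x. 0)"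
    by (simp add: has_weak_gradient_def locally_integrable_def set_integrable_def)
  moreover have "Lp_norm p (\<lambda>x::real^'n. 0::real^'n) = 0" for p by (simp add: Lp_norm_def)
  ultimately show ?thesis unfolding M by (intro exI[of _ 0]) auto
qed

theorem theorem1p1:
  fixes \<alpha> :: real and \<phi> :: "real^'n \<Rightarrow> real"
  assumes "CARD('n) \<ge> 2"
    and "0 < \<alpha>" and "\<alpha> < 1"
    and "schwartz \<phi>" and "\<And>x. \<phi> x \<ge> 0"
  shows "\<forall>M \<in> {lac_maximal \<alpha>, smooth_maximal \<phi> \<alpha>}.
           \<exists>C::real. C \<ge> 0 \<and>
             (\<forall>f \<in> BV_dot. (\<exists>x. M f x < \<infinity>) \<longrightarrow>
                (\<exists>G. has_weak_gradient (M f) G \<and>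
                   Lp_norm (real CARD('n) / (real CARD('n) - \<alpha>)) G
                     \<le> ennreal C * BV_seminorm f))"
proof
  fix M :: "(real^'n \<Rightarrow> real) \<Rightarrow> real^'n \<Rightarrow> ennreal"
  assume "M \<in> {lac_maximal \<alpha>, smooth_maximal \<phi> \<alpha>}"
  then consider "M = lac_maximal \<alpha>" | "M = smooth_maximal \<phi> \<alpha>" by blast
  then show "\<exists>C::real. C \<ge> 0 \<and> (\<forall>f \<in> BV_dot. (\<exists>x. M f x < \<infinity>) \<longrightarrow>
      (\<exists>G. has_weak_gradient (M f) G \<and>
        Lp_norm (real CARD('n) / (real CARD('n) - \<alpha>)) G \<le> ennreal C * BV_seminorm f))"
    using lac_maximal_gradient[OF assms(1-3)] smooth_maximal_gradient[OF assms] by cases (simp_all only:)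
qed

end
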